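(* (1) Every finite nilpotent group $G$ is (isomorphic to) a subdirect product of $d(Z(G))$ groups each of which has cyclic centre. Moreover, $G$ is not isomorphic to a subdirect product of fewer than $d(Z(G))$ groups each of which has cyclic centre. (2) Let $G$ be a finite nilpotent group of class at most $2$ whose commutator subgroup $G'$ is cyclic. Then there are an integer $t\ge 0$ and pairwise commuting subgroups $A, E_1,\dots,E_t$ of $G$ such that $G=AE_1\cdots E_t$ (that is, $G$ is the internal central product of these subgroups), where $A\le Z(G)$ (in particular $A$ is abelian), each $E_i$ is $2$-generated (i.e. $d(E_i)=2$) and nilpotent of class exactly $2$, $d(G)=d(A)+2t$, and $$G'=E_1'\supseteq E_2'\supseteq\dots\supseteq E_t'\neq 1$$ (for $t=0$ this chain is to be read as $G'=1$). Furthermore, for any subgroups $A,E_1,\dots,E_t$ with these properties, the integer $t=\frac12 d(G/Z(G))$ and the subgroups $E_i'\subseteq G'$ are invariants of $G$ (independent of the choice of the subgroups), given by $G/Z(G)\cong\prod_{i=1}^t (E_i'\times E_i')$.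
   Context: For a group $G$, $d(G)$ denotes the smallest cardinality of a generating set of $G$ (so $d(1)=0$), $Z(G)$ the centre and $G'=[G,G]$ the commutator subgroup. A subdirect product of groups $G_1,\dots,G_n$ is a subgroup of $G_1\times\dots\times G_n$ that projects onto every factor $G_i$ (the empty product being the trivial group). Two subgroups $H,K\le G$ are commuting if $[H,K]=1$; "pairwise commuting" refers to pairs of distinct members of the list. *)

theory Defs
  imports "HOL-Algebra.Algebra"
begin

definition centre :: "('a, 'b) monoid_scheme \<Rightarrow> 'a set" where
  "centre G = {z \<in> carrier G. \<forall>x\<in>carrier G. z \<otimes>\<^bsub>G\<^esub> x = x \<otimes>\<^bsub>G\<^esub> z}"

(* Meaningful for finitely generated groups only; for other groups the LEAST is unspecified. *)
definition min_gens :: "('a, 'b) monoid_scheme \<Rightarrow> nat" where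
  "min_gens G = (LEAST n. \<exists>S. S \<subseteq> carrier G \<and> finite S \<and> card S = n \<and> generate G S = carrier G)"

(* The commutator convention is that of the library constant derived, so that
   commutator_subgroup G H H is literally derived G H. *)
definition commutator_subgroup ::
    "('a, 'b) monoid_scheme \<Rightarrow> 'a set \<Rightarrow> 'a set \<Rightarrow> 'a set" where
  "commutator_subgroup G H K =
     generate G (\<Union>h\<in>H. \<Union>k\<in>K. {h \<otimes>\<^bsub>G\<^esub> k \<otimes>\<^bsub>G\<^esub> inv\<^bsub>G\<^esub> h \<otimes>\<^bsub>G\<^esub> inv\<^bsub>G\<^esub> k})"

definition commuting :: "('a, 'b) monoid_scheme \<Rightarrow> 'a set \<Rightarrow> 'a set \<Rightarrow> bool" where
  "commuting G H K \<longleftrightarrow> commutator_subgroup G H K = {\<one>\<^bsub>G\<^esub>}"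

(* Indexed from 0, so the group has class at most c iff the term with index c is trivial. *)
primrec lower_central :: "('a, 'b) monoid_scheme \<Rightarrow> nat \<Rightarrow> 'a set" where
  "lower_central G 0 = carrier G"
| "lower_central G (Suc n) = commutator_subgroup G (lower_central G n) (carrier G)"

definition nilpotent :: "('a, 'b) monoid_scheme \<Rightarrow> bool" where
  "nilpotent G \<longleftrightarrow> (\<exists>n. lower_central G n = {\<one>\<^bsub>G\<^esub>})"

(* To be used together with nilpotent only. *)
definition nilpotency_class :: "('a, 'b) monoid_scheme \<Rightarrow> nat" where
  "nilpotency_class G = (LEAST n. lower_central G n = {\<one>\<^bsub>G\<^esub>})"

definition subdirect_product ::
    "'i set \<Rightarrow> ('i \<Rightarrow> ('a, 'b) monoid_scheme) \<Rightarrow> ('i \<Rightarrow> 'a) set \<Rightarrow> bool" where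
  "subdirect_product I H S \<longleftrightarrow>
     (\<forall>i\<in>I. group (H i)) \<and> subgroup S (product_group I H) \<and>
     (\<forall>i\<in>I. (\<lambda>x. x i) ` S = carrier (H i))"

(* The foldl is the product of subsets A E_1 ... E_t. For t = 0 it is A, and the
   chain of commutator subgroups is then read as G' = 1. *)
definition central_decomposition ::
    "('a, 'b) monoid_scheme \<Rightarrow> nat \<Rightarrow> 'a set \<Rightarrow> (nat \<Rightarrow> 'a set) \<Rightarrow> bool" where
  "central_decomposition G t A E \<longleftrightarrow>
     subgroup A G \<and> (\<forall>i\<in>{1..t}. subgroup (E i) G) \<and>
     (\<forall>i\<in>{1..t}. commuting G A (E i)) \<and>
     (\<forall>i\<in>{1..t}. \<forall>j\<in>{1..t}. i \<noteq> j \<longrightarrow> commuting G (E i) (E j)) \<and>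
     carrier G = foldl (\<lambda>P i. P <#>\<^bsub>G\<^esub> E i) A [1..<Suc t] \<and>
     A \<subseteq> centre G \<and>
     (\<forall>i\<in>{1..t}. min_gens (G\<lparr>carrier := E i\<rparr>) = 2 \<and>
        nilpotent (G\<lparr>carrier := E i\<rparr>) \<and> nilpotency_class (G\<lparr>carrier := E i\<rparr>) = 2) \<and>
     min_gens G = min_gens (G\<lparr>carrier := A\<rparr>) + 2 * t \<and>
     (if t = 0 then derived G (carrier G) = {\<one>\<^bsub>G\<^esub>}
      else derived G (carrier G) = derived G (E 1) \<and>
           (\<forall>i\<in>{1..<t}. derived G (E (i + 1)) \<subseteq> derived G (E i)) \<and>
           derived G (E t) \<noteq> {\<one>\<^bsub>G\<^esub>})"

end

theory Submission
  imports Defs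
begin

text \<open>
  For (1), Rado's choice of a generating tuple starting with an element of minimal order yields
  subgroups \<open>K i\<close> of the centre, one for each member of a minimal generating set, with trivial
  intersection and cyclic quotients. Take \<open>N i\<close> maximal among the normal subgroups meeting the
  centre in \<open>K i\<close>: then \<open>G Mod N i\<close> has cyclic centre, and the \<open>N i\<close> intersect trivially since in a
  nilpotent group every nontrivial normal subgroup meets the centre. Conversely, the centre of a
  subdirect product embeds into the product of the centres of the factors, and a subgroup of a
  product of \<open>n\<close> cyclic groups has \<open>n\<close> generators.

  For (2), the commutator is an alternating bilinear form with values in the cyclic group \<open>G'\<close>.
  Nielsen moves bring a minimal generating tuple of \<open>G\<close> into symplectic normal form: split off a
  pair whose commutator has maximal order and recurse. Working with a tuple of minimal length
  makes the rank formula automatic. Given any decomposition with \<open>E i\<close> generated by \<open>x i\<close>, \<open>y i\<close>, the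
  map sending \<open>g\<close> to all \<open>([g, x i], [g, y i])\<close> induces the isomorphism from the quotient by the
  centre, and counting torsion elements there recovers \<open>t\<close> and the groups \<open>E i'\<close>.
\<close>

section \<open>Generated subgroups\<close>

text \<open>In (1) the obstacle is that the centre of \<open>G Mod N i\<close> can be larger than
  the image of the centre of \<open>G\<close>. Maximality of \<open>N i\<close> only forces the
  central elements of prime order into that image, which is cyclic because \<open>K i\<close> and
  one further element generate the centre. This is why a criterion is needed that makes a finite
  abelian group cyclic once a single cyclic subgroup contains its socle.

  In (2) the form has values in a cyclic group, not in a field, so a nonzero value need not be a
  usable pivot: the other values must be powers of it. The order of \<open>G'\<close> need not be a
  prime power, its subgroups need not form a chain, and comparing the orders of the commutators of
  one tuple would not do. Taking the maximum over all generating tuples of the same length helps,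
  because the Euclidean algorithm would otherwise manufacture a commutator of larger order.

  Uniqueness rests on the fact that a subgroup of a finite cyclic group is the full set of elements
  annihilated by its order. Numbers of torsion elements therefore detect the subgroups themselves
  and not merely their isomorphism types.\<close>

context group
begin

lemma generate_eqI:
  assumes "S \<subseteq> generate G T" "T \<subseteq> generate G S" "S \<subseteq> carrier G" "T \<subseteq> carrier G"
  shows "generate G S = generate G T"
  by (intro equalityI generate_subgroup_incl assms generate_is_subgroup)

lemma generate_Un_cong:
  assumes "generate G S = generate G T" "S \<subseteq> carrier G" "T \<subseteq> carrier G" "U \<subseteq> carrier G"
  shows "generate G (S \<union> U) = generate G (T \<union> U)"
proof (rule generate_eqI)
  show "S \<union> U \<subseteq> generate G (T \<union> U)" "T \<union> U \<subseteq> generate G (S \<union> U)"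
    using mono_generate[of T "T \<union> U"] mono_generate[of S "S \<union> U"] assms
    by (blast intro: generate.incl)+
qed (use assms in auto)

lemma generate_insert_cong:
  assumes "generate G S = generate G T" "S \<subseteq> carrier G" "T \<subseteq> carrier G" "x \<in> carrier G"
  shows "generate G (insert x S) = generate G (insert x T)"
  using generate_Un_cong[of S T "{x}"] assms by simp

lemma generate_subgroup_self: "subgroup H G \<Longrightarrow> generate G H = H"
  by (metis generate.incl generate_subgroup_incl order_refl subsetI subset_antisym)

lemma subgroup_nat_pow_closed:
  assumes "subgroup H G" "h \<in> H" shows "h [^] (k :: nat) \<in> H"
  using subgroup_int_pow_closed[OF assms, of "int k"] by (simp add: int_pow_int)

lemma subgroup_commutant:
  assumes "x \<in> carrier G" shows "subgroup {g \<in> carrier G. g \<otimes> x = x \<otimes> g} G"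
proof
  fix g h assume "g \<in> {g \<in> carrier G. g \<otimes> x = x \<otimes> g}" "h \<in> {g \<in> carrier G. g \<otimes> x = x \<otimes> g}"
  then show "g \<otimes> h \<in> {g \<in> carrier G. g \<otimes> x = x \<otimes> g}"
    using assms by (auto simp: m_assoc) (metis m_assoc)
next
  fix g assume "g \<in> {g \<in> carrier G. g \<otimes> x = x \<otimes> g}"
  then have g: "g \<in> carrier G" "g \<otimes> x = x \<otimes> g" by simp_all
  have "inv g \<otimes> x = inv g \<otimes> (x \<otimes> g) \<otimes> inv g"
    using assms g(1) by (simp add: m_assoc)
  also have "\<dots> = (inv g \<otimes> g) \<otimes> (x \<otimes> inv g)"
    unfolding g(2)[symmetric] using g(1) assms by (simp only: m_assoc m_closed inv_closed)
  also have "\<dots> = x \<otimes> inv g" using g(1) assms by simp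
  finally show "inv g \<in> {g \<in> carrier G. g \<otimes> x = x \<otimes> g}" using g by simp
qed (use assms in auto)

lemma commute_generate:
  assumes "S \<subseteq> carrier G" "x \<in> carrier G" "\<And>s. s \<in> S \<Longrightarrow> s \<otimes> x = x \<otimes> s"
    and "g \<in> generate G S"
  shows "g \<otimes> x = x \<otimes> g"
  using generate_subgroup_incl[OF _ subgroup_commutant[OF assms(2)], of S] assms by blast

lemma commuting_mult_subgroup:
  assumes H: "subgroup H G" and K: "subgroup K G"
    and c: "\<And>h k. h \<in> H \<Longrightarrow> k \<in> K \<Longrightarrow> h \<otimes> k = k \<otimes> h"
  shows "subgroup (H <#> K) G"
proof
  note mem = subgroup.mem_carrier[OF H] subgroup.mem_carrier[OF K]
  show "H <#> K \<subseteq> carrier G" using mem by (auto simp: set_mult_def)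
  show "\<one> \<in> H <#> K"
    using subgroup.one_closed[OF H] subgroup.one_closed[OF K] by (force simp: set_mult_def)
  fix x assume "x \<in> H <#> K"
  then obtain h k where x: "x = h \<otimes> k" "h \<in> H" "k \<in> K" by (auto simp: set_mult_def)
  have "inv x = inv h \<otimes> inv k" using x c[of h k] mem by (metis inv_mult_group)
  then show "inv x \<in> H <#> K"
    using x subgroup.m_inv_closed[OF H] subgroup.m_inv_closed[OF K] by (auto simp: set_mult_def)
  fix y assume "y \<in> H <#> K"
  then obtain h' k' where y: "y = h' \<otimes> k'" "h' \<in> H" "k' \<in> K" by (auto simp: set_mult_def)
  have "x \<otimes> y = h \<otimes> (k \<otimes> h') \<otimes> k'" using x y mem by (simp add: m_assoc)
  also have "\<dots> = h \<otimes> (h' \<otimes> k) \<otimes> k'" using c[OF y(2) x(3)] by simp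
  also have "\<dots> = (h \<otimes> h') \<otimes> (k \<otimes> k')" using x y mem by (simp add: m_assoc)
  finally show "x \<otimes> y \<in> H <#> K"
    unfolding set_mult_def
    using subgroup.m_closed[OF H x(2) y(2)] subgroup.m_closed[OF K x(3) y(3)] by blast
qed

lemma generate_commuting_Un:
  assumes H: "subgroup H G" and K: "subgroup K G"
    and c: "\<And>h k. h \<in> H \<Longrightarrow> k \<in> K \<Longrightarrow> h \<otimes> k = k \<otimes> h"
  shows "generate G (H \<union> K) = H <#> K"
proof
  have "H \<union> K \<subseteq> H <#> K"
    using subgroup.one_closed[OF H] subgroup.one_closed[OF K]
      subgroup.mem_carrier[OF H] subgroup.mem_carrier[OF K]
    by (force simp: set_mult_def)
  then show "generate G (H \<union> K) \<subseteq> H <#> K"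
    by (rule generate_subgroup_incl[OF _ commuting_mult_subgroup[OF assms]])
  show "H <#> K \<subseteq> generate G (H \<union> K)"
    by (auto simp: set_mult_def intro!: generate.eng intro: generate.incl)
qed

lemma generate_generate_Un:
  assumes "S \<subseteq> carrier G" "T \<subseteq> carrier G"
  shows "generate G (generate G S \<union> generate G T) = generate G (S \<union> T)"
proof (rule generate_eqI)
  show "generate G S \<union> generate G T \<subseteq> generate G (S \<union> T)"
    using mono_generate[of S "S \<union> T"] mono_generate[of T "S \<union> T"] by blast
  show "S \<union> T \<subseteq> generate G (generate G S \<union> generate G T)" by (blast intro: generate.incl)
qed (use assms generate_incl in auto)

text \<open>The elementary Nielsen move. It holds without commutativity, so it drives both the
  Euclidean algorithm on exponents in abelian groups and the one on commutators.\<close>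

lemma generate_pair_step:
  assumes "x \<in> carrier G" "z \<in> carrier G"
  shows "generate G {z \<otimes> x [^] (q::int), x} = generate G {x, z}"
proof (rule generate_eqI)
  let ?H = "generate G {z \<otimes> x [^] q, x}"
  have H: "subgroup ?H G" using assms by (intro generate_is_subgroup) auto
  have K: "subgroup (generate G {x, z}) G" using assms by (intro generate_is_subgroup) auto
  have "(z \<otimes> x [^] q) \<otimes> inv (x [^] q) \<in> ?H"
    by (rule subgroup.m_closed[OF H generate.incl
          subgroup.m_inv_closed[OF H subgroup_int_pow_closed[OF H generate.incl]]]) simp_all
  moreover have "(z \<otimes> x [^] q) \<otimes> inv (x [^] q) = z" using assms by (simp add: m_assoc)
  ultimately have "z \<in> ?H" by metis
  moreover have "x \<in> ?H" by (rule generate.incl) simp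
  ultimately show "{x, z} \<subseteq> ?H" by blast
  show "{z \<otimes> x [^] q, x} \<subseteq> generate G {x, z}"
    by (auto intro!: subgroup.m_closed[OF K] subgroup_int_pow_closed[OF K] intro: generate.incl)
qed (use assms in auto)

end

lemma min_gens_le:
  "\<lbrakk>S \<subseteq> carrier G; finite S; generate G S = carrier G\<rbrakk> \<Longrightarrow> min_gens G \<le> card S"
  unfolding min_gens_def by (rule Least_le) blast

lemma (in group) min_gens_obtain:
  assumes "finite (carrier G)"
  obtains S where "S \<subseteq> carrier G" "finite S" "card S = min_gens G" "generate G S = carrier G"
proof -
  have "\<exists>S. S \<subseteq> carrier G \<and> finite S \<and> card S = card (carrier G) \<and> generate G S = carrier G"
    using assms generate_subgroup_self[OF subgroup_self] by blast
  from LeastI[of "\<lambda>n. \<exists>S. S \<subseteq> carrier G \<and> finite S \<and> card S = n \<and> generate G S = carrier G", OF this]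
  show thesis using that unfolding min_gens_def by blast
qed

lemma (in group) min_gens_subgroup_le:
  assumes "subgroup H G" "S \<subseteq> H" "finite S" "generate G S = H"
  shows "min_gens (G\<lparr>carrier := H\<rparr>) \<le> card S"
  using assms by (intro min_gens_le) (auto simp: generate_consistent)

text \<open>Lists instead of sets: the moves below replace entries, which may then coincide, and
  only the length of the list stays under control.\<close>

lemma (in group) min_gens_subgroup_obtain:
  assumes "subgroup H G" "finite H"
  obtains xs where "set xs \<subseteq> H" "length xs = min_gens (G\<lparr>carrier := H\<rparr>)" "generate G (set xs) = H"
proof -
  interpret H: group "G\<lparr>carrier := H\<rparr>" by (rule subgroup_imp_group[OF assms(1)])
  obtain S where S: "S \<subseteq> H" "finite S" "card S = min_gens (G\<lparr>carrier := H\<rparr>)"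
      "generate (G\<lparr>carrier := H\<rparr>) S = H"
    by (rule H.min_gens_obtain) (use assms in simp_all)
  obtain xs where "set xs = S" "distinct xs" using finite_distinct_list[OF \<open>finite S\<close>] by blast
  then show thesis using that[of xs] S assms
    by (auto simp: distinct_card generate_consistent)
qed

section \<open>Finite abelian groups\<close>

context comm_group
begin

text \<open>With \<open>q = m div n\<close> one has \<open>x^m z^n = (z x^q)^n x^(m mod n)\<close>,
  so a Nielsen move on the pair turns the exponents \<open>(m, n)\<close> into
  \<open>(n, m mod n)\<close>. When the algorithm stops, one generator carries the whole
  product.\<close>

lemma euclid_power:
  fixes a b :: nat
  assumes "x \<in> carrier G" "z \<in> carrier G"
  shows "\<exists>w\<in>carrier G. \<exists>w'\<in>carrier G.
    generate G {w, w'} = generate G {x, z} \<and> x [^] a \<otimes> z [^] b = w [^] gcd a b"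
  using assms
proof (induction a b arbitrary: x z rule: gcd_nat_induct)
  case (base m)
  then show ?case by (intro bexI[of _ x] bexI[of _ z]) auto
next
  case (step m n)
  let ?q = "m div n" and ?r = "m mod n"
  obtain w w' where w: "w \<in> carrier G" "w' \<in> carrier G"
      "generate G {w, w'} = generate G {z \<otimes> x [^] ?q, x}"
      "(z \<otimes> x [^] ?q) [^] n \<otimes> x [^] ?r = w [^] gcd n ?r"
    using step.IH[of "z \<otimes> x [^] ?q" x] step.prems by auto
  have "(z \<otimes> x [^] ?q) [^] n \<otimes> x [^] ?r = z [^] n \<otimes> (x [^] (?q * n) \<otimes> x [^] ?r)"
    using step.prems by (simp add: nat_pow_distrib nat_pow_pow m_assoc)
  also have "\<dots> = z [^] n \<otimes> x [^] m"
    using step.prems by (simp add: nat_pow_mult)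
  finally have "x [^] m \<otimes> z [^] n = w [^] gcd m n"
    using w step.prems step.hyps by (simp add: m_comm gcd_non_0_nat)
  moreover have "generate G {w, w'} = generate G {x, z}"
    using generate_pair_step[OF step.prems, of "int ?q"] w(3) by (simp add: int_pow_int)
  ultimately show ?case using w by blast
qed

text \<open>Finiteness makes natural exponents suffice, as \<open>euclid_power\<close>
  requires.\<close>

lemma generate_insert_eq:
  assumes "finite (carrier G)" "x \<in> carrier G" "S \<subseteq> carrier G"
  shows "generate G (insert x S) = {x [^] (k::nat) \<otimes> s | k s. s \<in> generate G S}"
proof -
  have "generate G (insert x S) = generate G (generate G {x} \<union> generate G S)"
    using generate_generate_Un[of "{x}" S] assms by simp
  also have "\<dots> = generate G {x} <#> generate G S"
    using assms by (intro generate_commuting_Un generate_is_subgroup m_comm)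
      (auto intro: generate_in_carrier[rotated])
  also have "\<dots> = {x [^] (k::nat) \<otimes> s | k s. s \<in> generate G S}"
    using assms by (auto simp: set_mult_def generate_pow_on_finite_carrier)
  finally show ?thesis .
qed

text \<open>In terms of exponent vectors: every integer vector is a multiple of a primitive one,
  and primitive vectors extend to a basis.\<close>
lemma power_of_generator:
  assumes fin: "finite (carrier G)"
    and "set (x # xs) \<subseteq> carrier G" "y \<in> generate G (set (x # xs))"
  shows "\<exists>z zs k. length zs = length xs \<and> set (z # zs) \<subseteq> carrier G \<and>
    generate G (set (z # zs)) = generate G (set (x # xs)) \<and> y = z [^] (k::nat)"
  using assms(2,3)
proof (induction xs arbitrary: x y)
  case Nil
  then obtain k where "y = x [^] (k::nat)" by (auto simp: generate_pow_on_finite_carrier fin)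
  then show ?case using Nil by (intro exI[of _ x] exI[of _ "[]"] exI[of _ k]) auto
next
  case (Cons x' xs)
  then obtain b y' where y: "y = x [^] (b::nat) \<otimes> y'" "y' \<in> generate G (set (x' # xs))"
    using generate_insert_eq[OF fin, of x "set (x' # xs)"] by auto
  obtain z zs k where z: "length zs = length xs" "set (z # zs) \<subseteq> carrier G"
      "generate G (set (z # zs)) = generate G (set (x' # xs))" "y' = z [^] (k::nat)"
    using Cons.IH[OF _ y(2)] Cons.prems by auto
  \<comment> \<open>Now \<open>y = x^b z^k\<close> involves only the two leading generators, so one
    run of the Euclidean algorithm merges them and leaves \<open>zs\<close> alone.\<close>
  obtain w w' where w: "w \<in> carrier G" "w' \<in> carrier G"
      "generate G {w, w'} = generate G {x, z}" "x [^] b \<otimes> z [^] k = w [^] gcd b k"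
    using euclid_power[of x z b k] Cons.prems z by auto
  have "generate G (set (w # w' # zs)) = generate G ({w, w'} \<union> set zs)" by simp
  also have "\<dots> = generate G ({x, z} \<union> set zs)"
    using w z Cons.prems by (intro generate_Un_cong) auto
  also have "\<dots> = generate G (insert x (set (z # zs)))" by simp
  also have "\<dots> = generate G (insert x (set (x' # xs)))"
    using z Cons.prems by (intro generate_insert_cong) auto
  finally show ?case
    using w z Cons.prems y by (intro exI[of _ w] exI[of _ "w' # zs"] exI[of _ "gcd b k"]) auto
qed

text \<open>A nontrivial relation $x^a y = 1$ would give a generator of order at most
  $\gcd(a,k)$, where $y = z^k$, against minimality.\<close>
lemma minimal_order_generator:
  assumes fin: "finite (carrier G)" and xs: "set (x # xs) \<subseteq> carrier G"
    and min: "\<And>y ys. \<lbrakk>length ys = length xs; set (y # ys) \<subseteq> carrier G;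
      generate G (set (y # ys)) = generate G (set (x # xs))\<rbrakk> \<Longrightarrow> ord x \<le> ord y"
  shows "generate G {x} \<inter> generate G (set xs) = {\<one>}"
proof (rule ccontr)
  assume "\<not> ?thesis"
  then obtain u where u: "u \<in> generate G {x}" "u \<in> generate G (set xs)" "u \<noteq> \<one>"
    by (auto simp: generate.one)
  have x: "x \<in> carrier G" using xs by simp
  obtain i where i: "u = x [^] (i::nat)"
    using u x by (auto simp: generate_pow_on_finite_carrier fin)
  \<comment> \<open>Reduction modulo \<open>ord x\<close> makes the exponent positive and smaller
    than \<open>ord x\<close>; any divisor of it, such as \<open>gcd a k\<close> below, is then too
    small to be the order of a first generator.\<close>
  define a where "a = i mod ord x"
  have ox: "ord x > 0" using ord_ge_1[OF fin x] by simp
  have ua: "u = x [^] a"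
  proof -
    have "x [^] i = x [^] (ord x * (i div ord x) + a)" by (simp add: a_def)
    also have "\<dots> = (x [^] ord x) [^] (i div ord x) \<otimes> x [^] a"
      using x by (simp only: nat_pow_mult[symmetric] nat_pow_pow)
    finally show ?thesis using x i by simp
  qed
  have a: "0 < a" "a < ord x"
    using u(3) ua ox by (auto simp: a_def intro: Nat.gr0I)
  show False
  proof (cases xs)
    case Nil
    then show False using u by (simp add: generate_empty)
  next
    case (Cons x' xs')
    have "inv u \<in> generate G (set xs)"
      using u xs by (intro generate_m_inv_closed) auto
    then obtain z zs k where z: "length zs = length xs'" "set (z # zs) \<subseteq> carrier G"
        "generate G (set (z # zs)) = generate G (set xs)" "inv u = z [^] (k::nat)"
      using power_of_generator[OF fin, of x' xs' "inv u"] xs Cons by auto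
    obtain w w' where w: "w \<in> carrier G" "w' \<in> carrier G"
        "generate G {w, w'} = generate G {x, z}" "x [^] a \<otimes> z [^] k = w [^] gcd a k"
      using euclid_power[of x z a k] x z by auto
    have "w [^] gcd a k = u \<otimes> inv u" using w(4) z(4) ua by simp
    also have "\<dots> = \<one>" using x ua by simp
    finally have "ord w dvd gcd a k" using w(1) by (simp add: pow_eq_id)
    then have "ord w \<le> a" using a by (meson dvd_imp_le dvd_trans gcd_dvd1)
    moreover have "generate G (set (w # w' # zs)) = generate G (set (x # xs))"
    proof -
      have "generate G (set (w # w' # zs)) = generate G ({w, w'} \<union> set zs)" by simp
      also have "\<dots> = generate G ({x, z} \<union> set zs)"
        using w z x by (intro generate_Un_cong) auto
      also have "\<dots> = generate G (insert x (set (z # zs)))" by simp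
      also have "\<dots> = generate G (insert x (set xs))"
        using z xs by (intro generate_insert_cong) auto
      finally show ?thesis by simp
    qed
    ultimately show False using min[of "w' # zs" w] w z Cons a by auto
  qed
qed

text \<open>A first generator of minimal order splits off a cyclic direct factor \<open>C\<close>
  with complement \<open>D\<close>, and induction treats \<open>D\<close>. Cyclicity of the quotient
  by \<open>K i\<close> is expressed by the one extra generator \<open>z i\<close>. The intersection
  is cut down to the generated group because for the empty list the intersection over no index is
  the whole type.\<close>

lemma cyclic_quotient_family:
  assumes fin: "finite (carrier G)" and "set xs \<subseteq> carrier G"
  shows "\<exists>K z. (\<forall>i<length xs. subgroup (K i) G \<and> z i \<in> carrier G \<and>
      generate G (insert (z i) (K i)) = generate G (set xs)) \<and>
    (\<Inter>i<length xs. K i) \<inter> generate G (set xs) = {\<one>}"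
  using assms(2)
proof (induction "length xs" arbitrary: xs)
  case 0
  then show ?case by (auto simp: generate_empty)
next
  case (Suc n)
  let ?A = "generate G (set xs)"
  let ?P = "\<lambda>ys. length ys = Suc n \<and> set ys \<subseteq> carrier G \<and> generate G (set ys) = ?A"
  \<comment> \<open>The minimum is taken over generating tuples of the same length, so the induction
    hypothesis applies to the tail of \<open>ys\<close>.\<close>
  obtain ys where ys: "?P ys" and min: "\<And>zs. ?P zs \<Longrightarrow> ord (hd ys) \<le> ord (hd zs)"
    using ex_has_least_nat[of ?P xs "\<lambda>ys. ord (hd ys)"] Suc by auto
  obtain x B where xB: "ys = x # B" "length B = n" using ys by (cases ys) auto
  have x: "x \<in> carrier G" and Bc: "set B \<subseteq> carrier G" using ys xB by auto
  define C where "C = generate G {x}"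
  define D where "D = generate G (set B)"
  have C: "subgroup C G" and D: "subgroup D G"
    unfolding C_def D_def using x Bc by (auto intro: generate_is_subgroup)
  have CD: "C \<inter> D = {\<one>}"
    unfolding C_def D_def
  proof (rule minimal_order_generator[OF fin])
    show "set (x # B) \<subseteq> carrier G" using x Bc by simp
    fix y zs
    assume "length zs = length B" "set (y # zs) \<subseteq> carrier G"
      "generate G (set (y # zs)) = generate G (set (x # B))"
    then have "?P (y # zs)" using ys xB by simp
    from min[OF this] show "ord x \<le> ord y" by (simp add: xB)
  qed
  have A: "?A = generate G (insert x D)"
  proof -
    have "generate G (insert x D) = generate G (insert x (set B))"
      using x Bc D by (intro generate_insert_cong) (auto simp: D_def generate_subgroup_self subgroup.subset)
    then show ?thesis using ys xB by simp
  qed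
  obtain K z where Kz: "(\<forall>i<n. subgroup (K i) G \<and> z i \<in> carrier G \<and>
      generate G (insert (z i) (K i)) = D) \<and> (\<Inter>i<n. K i) \<inter> D = {\<one>}"
    using Suc.hyps(1)[OF xB(2)[symmetric] Bc] unfolding D_def xB(2) by meson
  then have K: "\<And>i. i < n \<Longrightarrow> subgroup (K i) G" "\<And>i. i < n \<Longrightarrow> z i \<in> carrier G"
      "\<And>i. i < n \<Longrightarrow> generate G (insert (z i) (K i)) = D" "(\<Inter>i<n. K i) \<inter> D = {\<one>}"
    by simp_all
  \<comment> \<open>The quotient by \<open>D\<close> is generated by \<open>x\<close>. The old
    \<open>K i\<close> are enlarged by \<open>C\<close>, so that their quotients in the whole group
    are the ones they had in \<open>D\<close>.\<close>
  define K' where "K' = (\<lambda>i. if i = 0 then D else C <#> K (i - 1))"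
  define z' where "z' = (\<lambda>i. if i = 0 then x else z (i - 1))"
  have KD: "K i \<subseteq> D" if "i < n" for i
    using K(3)[OF that] by (metis generate.incl insertCI subsetI)
  have sub: "subgroup (K' i) G" if "i < Suc n" for i
    using that D K C by (auto simp: K'_def intro!: mult_subgroups)
  have gen: "generate G (insert (z' i) (K' i)) = ?A" if "i < Suc n" for i
  proof (cases i)
    case 0
    then show ?thesis by (simp add: K'_def z'_def A)
  next
    case (Suc j)
    then have j: "j < n" using that by simp
    have CK: "C <#> K j = generate G (insert x (K j))"
    proof -
      have "C <#> K j = generate G (C \<union> K j)"
        using C K(1)[OF j] by (intro generate_commuting_Un[symmetric] m_comm)
          (auto dest: subgroup.mem_carrier)
      also have "\<dots> = generate G (generate G {x} \<union> generate G (K j))"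
        using K(1)[OF j] by (simp add: C_def generate_subgroup_self)
      also have "\<dots> = generate G ({x} \<union> K j)"
        using K(1)[OF j] x by (intro generate_generate_Un) (auto dest: subgroup.mem_carrier)
      finally show ?thesis by simp
    qed
    have Kc: "K j \<subseteq> carrier G" using K(1)[OF j] by (rule subgroup.subset)
    have "generate G (insert (z j) (C <#> K j)) = generate G (insert (z j) (insert x (K j)))"
      unfolding CK using Kc K(2)[OF j] x
      by (intro generate_insert_cong generate_subgroup_self generate_is_subgroup generate_incl) auto
    also have "\<dots> = generate G (insert x (insert (z j) (K j)))" by (simp add: insert_commute)
    also have "\<dots> = generate G (insert x D)"
      using K(2,3)[OF j] Kc x D subgroup.subset[OF D]
      by (intro generate_insert_cong) (auto simp: generate_subgroup_self)
    finally show ?thesis using Suc A by (simp add: K'_def z'_def)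
  qed
  \<comment> \<open>Such a \<open>u\<close> lies in \<open>D = K' 0\<close>. Written as
    \<open>c k\<close> with \<open>c\<close> in \<open>C\<close> and \<open>k\<close> in
    \<open>K i\<close>, it forces \<open>c\<close> into the trivial intersection of \<open>C\<close>
    and \<open>D\<close>, so it lies in every \<open>K i\<close>.\<close>
  have "u = \<one>" if u: "u \<in> (\<Inter>i<Suc n. K' i)" for u
  proof -
    have uD: "u \<in> D" using u by (force simp: K'_def)
    have "u \<in> K i" if i: "i < n" for i
    proof -
      have "u \<in> C <#> K i" using u i by (force simp: K'_def)
      then obtain c k where ck: "u = c \<otimes> k" "c \<in> C" "k \<in> K i" by (auto simp: set_mult_def)
      have cc: "c \<in> carrier G" "k \<in> carrier G"
        using ck C K(1)[OF i] by (auto dest: subgroup.mem_carrier)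
      have "c = u \<otimes> inv k" using ck cc by (simp add: m_assoc)
      also have "\<dots> \<in> D"
        using uD ck KD[OF i] D by (auto intro!: subgroup.m_closed subgroup.m_inv_closed)
      finally have "c = \<one>" using CD ck by blast
      then show ?thesis using ck cc by simp
    qed
    then show ?thesis using K(4) uD by blast
  qed
  moreover have "\<one> \<in> (\<Inter>i<Suc n. K' i)" using sub subgroup.one_closed by fastforce
  ultimately have "(\<Inter>i<Suc n. K' i) \<inter> ?A = {\<one>}" using generate.one by blast
  moreover have "z' i \<in> carrier G" if "i < Suc n" for i
    using that x K(2) by (auto simp: z'_def)
  ultimately show ?case using sub gen Suc(2)[symmetric] by metis
qed

end

section \<open>Torsion counts and a criterion for cyclicity\<close>

lemma (in group_hom) card_kernel_image:
  "card (h ` carrier G) * card (kernel G H h) = card (carrier G)"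
proof -
  let ?I = "H\<lparr>carrier := h ` carrier G\<rparr>"
  interpret I: group ?I
    by (rule H.subgroup_imp_group[OF img_is_subgroup])
  interpret f: group_hom G ?I h
    by unfold_locales (auto simp: hom_def)
  have "G Mod kernel G ?I h \<cong> ?I" by (rule f.FactGroup_iso) simp
  then have "card (rcosets (kernel G H h)) = card (h ` carrier G)"
    by (auto dest!: iso_same_card simp: FactGroup_def kernel_def)
  then show ?thesis using G.lagrange[OF subgroup_kernel] by (simp add: order_def)
qed

text \<open>The elements in question form the kernel of the power map, whose order is the index of
  its image \<open>D\<close>. Modulo \<open>D\<close> every generator is annihilated by
  \<open>k\<close>, so that index is at most \<open>k ^ card S\<close>. This bounds ranks from below
  without a structure theorem.\<close>

lemma (in comm_group) card_torsion_le:
  assumes fin: "finite (carrier G)" and S: "S \<subseteq> carrier G" "generate G S = carrier G"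
    and k: "k > 0"
  shows "card {x \<in> carrier G. x [^] (k::nat) = \<one>} \<le> k ^ card S"
proof -
  let ?f = "\<lambda>x. x [^] k"
  interpret f: group_hom G G ?f
    by unfold_locales (auto simp: hom_def nat_pow_distrib)
  define D where "D = ?f ` carrier G"
  have D: "subgroup D G" unfolding D_def by (rule f.img_is_subgroup)
  have Dc: "D \<subseteq> carrier G" by (rule subgroup.subset[OF D])
  have finS: "finite S" using S fin finite_subset by blast
  \<comment> \<open>Reducing an exponent modulo \<open>k\<close> costs only an element of
    \<open>D\<close>, so each further generator multiplies the order by at most
    \<open>k\<close>.\<close>
  have "card (generate G (S \<union> D)) \<le> k ^ card S * card D"
    using finS S(1)
  proof (induction S rule: finite_induct)
    case empty
    then show ?case by (simp add: generate_subgroup_self[OF D])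
  next
    case (insert g S)
    let ?X = "generate G (S \<union> D)"
    have X: "subgroup ?X G" using insert Dc by (intro generate_is_subgroup) auto
    have g: "g \<in> carrier G" using insert by simp
    have finX: "finite ?X" using fin subgroup.subset[OF X] finite_subset by blast
    have "generate G (insert g S \<union> D) \<subseteq> (\<lambda>(j, s). g [^] j \<otimes> s) ` ({..<k} \<times> ?X)"
    proof
      fix u assume "u \<in> generate G (insert g S \<union> D)"
      then obtain i s where u: "u = g [^] (i::nat) \<otimes> s" "s \<in> ?X"
        using generate_insert_eq[OF fin g, of "S \<union> D"] insert Dc by auto
      have s: "s \<in> carrier G" using u(2) X by (rule subgroup.mem_carrier[rotated])
      have "(g [^] (i div k)) [^] k \<in> ?X"
        using g by (auto simp: D_def intro!: generate.incl)
      then have "(g [^] (i div k)) [^] k \<otimes> s \<in> ?X" using u X by (simp add: subgroup.m_closed)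
      moreover have "g [^] i = g [^] (i mod k) \<otimes> (g [^] (i div k)) [^] k"
        using g by (simp add: nat_pow_mult nat_pow_pow)
      then have "u = g [^] (i mod k) \<otimes> ((g [^] (i div k)) [^] k \<otimes> s)"
        using u g s by (simp add: m_assoc)
      ultimately show "u \<in> (\<lambda>(j, s). g [^] j \<otimes> s) ` ({..<k} \<times> ?X)"
        using k by (intro image_eqI[of _ _ "(i mod k, (g [^] (i div k)) [^] k \<otimes> s)"]) auto
    qed
    then have "card (generate G (insert g S \<union> D)) \<le> card ({..<k} \<times> ?X)"
      using finX by (intro surj_card_le) simp_all
    also have "\<dots> \<le> k * (k ^ card S * card D)" using insert by (simp add: card_cartesian_product)
    finally show ?case using insert by simp
  qed
  moreover have "generate G (S \<union> D) = carrier G"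
    using S Dc mono_generate[of S "S \<union> D"] generate_incl[of "S \<union> D"] by auto
  ultimately have "card D * card (kernel G G ?f) \<le> card D * k ^ card S"
    using f.card_kernel_image by (simp add: D_def mult.commute)
  moreover have "card D > 0" using D fin Dc
    by (metis card_gt_0_iff empty_iff finite_subset subgroup.one_closed)
  ultimately show ?thesis by (simp add: kernel_def)
qed

text \<open>The case of a single generator in \<open>card_torsion_le\<close>; it applies inside any
  group because a cyclic subgroup is abelian.\<close>

lemma (in group) card_torsion_cyclic:
  assumes fin: "finite (carrier G)" and c: "c \<in> carrier G" and k: "k > 0"
  shows "card {x \<in> generate G {c}. x [^] (k::nat) = \<one>} \<le> k"
proof -
  let ?C = "subgroup_generated G {c}"
  interpret C: comm_group ?C
    using cyclic_group_generated[of c] group.cyclic_imp_abelian_group[OF group_subgroup_generated]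
    by blast
  have sub: "subgroup (generate G {c}) G" using c by (intro generate_is_subgroup) auto
  have carr: "carrier ?C = generate G {c}" using c by (simp add: carrier_subgroup_generated)
  have "finite (carrier ?C)" unfolding carr using generate_incl[of "{c}"] c fin finite_subset by auto
  moreover have "generate ?C {c} = carrier ?C"
    using c generate_consistent[OF _ sub, of "{c}"]
    by (simp add: carr subgroup_generated_def generate.incl)
  ultimately have "card {x \<in> carrier ?C. x [^]\<^bsub>?C\<^esub> k = \<one>\<^bsub>?C\<^esub>} \<le> k ^ card {c}"
    using k by (intro C.card_torsion_le) (auto simp: carr intro: generate.incl)
  then show ?thesis by (simp add: carr pow_subgroup_generated)
qed

text \<open>Bezout gives \<open>p * m = ord x * n + 1\<close>. For \<open>p = 0\<close> coprimality
  forces \<open>ord x = 1\<close>.\<close>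

lemma (in group) generate_pow_coprime:
  assumes fin: "finite (carrier G)" and x: "x \<in> carrier G" and "coprime p (ord x)"
  shows "\<exists>m::nat. x = (x [^] p) [^] m"
proof (cases "p = 0")
  case True
  then have "x = \<one>" using assms ord_eq_1 by auto
  then show ?thesis by auto
next
  case False
  obtain m n where "p * m = ord x * n + gcd p (ord x)" using bezout_nat[OF False] by blast
  then have "(x [^] p) [^] m = (x [^] ord x) [^] n \<otimes> x [^] (1::nat)"
    using x assms(3) by (simp only: nat_pow_pow nat_pow_mult) simp
  then show ?thesis using x by (metis l_one nat_pow_eone nat_pow_one pow_ord_eq_1)
qed

text \<open>The hypothesis says that the cyclic subgroup generated by $z$ contains the socle.\<close>
lemma (in comm_group) cyclic_if_cyclic_socle:
  assumes fin: "finite (carrier G)" and z: "z \<in> carrier G"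
    and socle: "\<And>p u. \<lbrakk>Factorial_Ring.prime (p::nat); u \<in> carrier G; u [^] p = \<one>\<rbrakk> \<Longrightarrow> u \<in> generate G {z}"
  shows "\<exists>x\<in>carrier G. generate G {x} = carrier G"
proof -
  have sub: "subgroup (generate G {a}) G" if "a \<in> carrier G" for a
    using that by (intro generate_is_subgroup) auto
  have fing: "finite (generate G {a})" if "a \<in> carrier G" for a
    using fin subgroup.subset[OF sub[OF that]] finite_subset by blast
  have "\<exists>x. x \<in> carrier G \<and> (\<forall>y. y \<in> carrier G \<longrightarrow> ord y \<le> ord x)"
    by (rule ex_has_greatest_nat[of _ \<one> _ "Suc (order G)"])
      (auto simp: less_Suc_eq_le ord_le_group_order[OF fin])
  then obtain x where x: "x \<in> carrier G" and max: "\<And>y. y \<in> carrier G \<Longrightarrow> ord y \<le> ord x" by blast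
  let ?X = "generate G {x}"
  have X: "subgroup ?X G" by (rule sub[OF x])
  have xX: "x \<in> ?X" by (simp add: generate.incl)
  \<comment> \<open>Since \<open>x\<close> has maximal order, no cyclic subgroup properly contains
    \<open>?X\<close>.\<close>
  have eqX: "generate G {w} = ?X" if "w \<in> carrier G" "x \<in> generate G {w}" for w
  proof -
    have "?X \<subseteq> generate G {w}" using that sub by (intro generate_subgroup_incl) auto
    moreover have "card (generate G {w}) \<le> card ?X"
      using max[OF that(1)] generate_pow_card x that by simp
    ultimately show ?thesis using card_seteq[OF fing[OF that(1)]] by metis
  qed
  have "carrier G \<subseteq> ?X"
  proof (rule ccontr)
    assume "\<not> ?thesis"
    then obtain y0 where y0: "y0 \<in> carrier G" "y0 \<notin> ?X" by blast
    \<comment> \<open>\<open>k\<close> is the order of \<open>y0\<close> modulo \<open>?X\<close>.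
      Leaving out one prime factor \<open>p\<close> of it gives an element \<open>y\<close> outside
      \<open>?X\<close> whose \<open>p\<close>-th power lies in \<open>?X\<close>.\<close>
    define k where "k = (LEAST k::nat. k > 0 \<and> y0 [^] k \<in> ?X)"
    have "ord y0 > 0 \<and> y0 [^] ord y0 \<in> ?X"
      using ord_ge_1[OF fin y0(1)] y0 by (simp add: generate.one)
    then have k: "k > 0" "y0 [^] k \<in> ?X" and
      kmin: "\<And>j. 0 < j \<Longrightarrow> y0 [^] j \<in> ?X \<Longrightarrow> k \<le> j"
      unfolding k_def by (metis (mono_tags, lifting) LeastI, metis (mono_tags, lifting) LeastI,
        metis (mono_tags, lifting) Least_le)
    have "k \<noteq> 1" using k y0 by (metis nat_pow_eone)
    then obtain p where p: "Factorial_Ring.prime p" "p dvd k" using prime_factor_nat by blast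
    then obtain l where l: "k = l * p" by (metis dvdE mult.commute)
    have p1: "p > 1" using p(1) by (rule prime_gt_1_nat)
    define y where "y = y0 [^] l"
    have y: "y \<in> carrier G" "y [^] p \<in> ?X" "y \<notin> ?X"
      using y0 k l p1 kmin[of l] by (auto simp: y_def nat_pow_pow)
    obtain j where j: "y [^] p = x [^] (j::nat)"
      using y x by (auto simp: generate_pow_on_finite_carrier[OF fin])
    \<comment> \<open>It suffices to find \<open>s\<close> in \<open>?X\<close> with the same
      \<open>p\<close>-th power as \<open>y\<close>: then \<open>y\<close> times the inverse of
      \<open>s\<close> is annihilated by \<open>p\<close> and stays outside
      \<open>?X\<close>.\<close>
    have "\<exists>u\<in>carrier G. u [^] p = \<one> \<and> u \<notin> ?X"
    proof -
      have "\<exists>s\<in>?X. y [^] p = s [^] p"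
      proof (cases "p dvd j")
        case True
        then obtain i where "j = i * p" by (metis dvdE mult.commute)
        then have "y [^] p = (x [^] i) [^] p" using j x by (simp add: nat_pow_pow)
        then show ?thesis using subgroup_nat_pow_closed[OF X xX] by blast
      next
        case False
        then have "coprime j p" using p(1) by (metis coprime_commute prime_imp_coprime)
        have j0: "j \<noteq> 0" using False by (metis dvd_0_right)
        \<comment> \<open>With \<open>j u = p v + 1\<close> the element \<open>w\<close> satisfies
          \<open>w^p = x\<close>. By maximality \<open>w\<close> lies in \<open>?X\<close>, so
          \<open>y^p = x^j\<close> is the \<open>p\<close>-th power of \<open>w^j\<close>.\<close>
        obtain u v where uv: "j * u = p * v + gcd j p" using bezout_nat[OF j0] by blast
        define w where "w = y [^] u \<otimes> inv (x [^] v)"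
        have w: "w \<in> carrier G" using x y by (simp add: w_def)
        have "w [^] p = (y [^] p) [^] u \<otimes> inv (x [^] (p * v))"
          using x y by (simp add: w_def nat_pow_distrib nat_pow_pow nat_pow_inv mult.commute)
        also have "(y [^] p) [^] u = x [^] (p * v + 1)"
          using j x uv \<open>coprime j p\<close> by (simp add: nat_pow_pow)
        also have "\<dots> = x \<otimes> x [^] (p * v)"
          using x by (simp add: m_comm)
        finally have wp: "w [^] p = x" using x by (simp add: m_assoc)
        then have "x \<in> generate G {w}"
          by (metis generate.incl insertI1 sub subgroup_nat_pow_closed w)
        then have "generate G {w} = ?X" using eqX w by blast
        then have wX: "w \<in> ?X" by (metis generate.incl insertI1)
        have "y [^] p = (w [^] j) [^] p"
          unfolding j wp[symmetric] using w by (simp add: nat_pow_pow mult.commute)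
        then show ?thesis using subgroup_nat_pow_closed[OF X wX] by blast
      qed
      then obtain s where s: "s \<in> ?X" "y [^] p = s [^] p" by blast
      have sc: "s \<in> carrier G" using s X by (simp add: subgroup.mem_carrier)
      have "(y \<otimes> inv s) [^] p = \<one>"
        using s sc y by (simp add: nat_pow_distrib nat_pow_inv)
      moreover have "y \<otimes> inv s \<notin> ?X"
      proof
        assume "y \<otimes> inv s \<in> ?X"
        then have "y \<otimes> inv s \<otimes> s \<in> ?X" using s X by (simp add: subgroup.m_closed)
        then show False using y sc by (simp add: m_assoc)
      qed
      ultimately show ?thesis using y sc by blast
    qed
    then obtain u where u: "u \<in> carrier G" "u [^] p = \<one>" "u \<notin> ?X" by blast
    show False
    proof (cases "p dvd ord x")
      \<comment> \<open>Here \<open>x\<close> is a power of \<open>x^p = (x u)^p\<close>, so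
        \<open>x u\<close> generates \<open>?X\<close>, which puts \<open>u\<close> into
        \<open>?X\<close>.\<close>
      case False
      then have "coprime p (ord x)" using p(1) by (simp add: prime_imp_coprime)
      then obtain m where m: "x = (x [^] p) [^] (m::nat)"
        using generate_pow_coprime[OF fin x] by blast
      have xu: "x \<otimes> u \<in> carrier G" using x u by simp
      have "(x \<otimes> u) [^] p = x [^] p" using x u by (simp add: nat_pow_distrib)
      then have "x = ((x \<otimes> u) [^] p) [^] m" using m by simp
      then have "x \<in> generate G {x \<otimes> u}"
        using subgroup_nat_pow_closed[OF sub[OF xu]] by (metis generate.incl insertI1)
      then have "generate G {x \<otimes> u} = ?X" by (rule eqX[OF xu])
      then have "x \<otimes> u \<in> ?X" by (metis generate.incl insertI1)
      then have "inv x \<otimes> (x \<otimes> u) \<in> ?X"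
        using X xX by (simp add: subgroup.m_closed subgroup.m_inv_closed)
      then show False using x u by (simp flip: m_assoc)
    next
      case True
      have ox: "ord x > 0" using ord_ge_1[OF fin x] by simp
      \<comment> \<open>\<open>v\<close> generates a subgroup of order \<open>p\<close> inside
        \<open>?X\<close>. It lies in the \<open>p\<close>-torsion \<open>?T\<close> of the cyclic
        group generated by \<open>z\<close>, which has at most \<open>p\<close> elements; hence it
        equals \<open>?T\<close> and contains \<open>u\<close>.\<close>
      define v where "v = x [^] (ord x div p)"
      have v: "v \<in> carrier G" "v \<in> ?X" using x subgroup_nat_pow_closed[OF X xX] by (auto simp: v_def)
      have "ord x div p \<noteq> 0" using True ox by (metis dvd_div_eq_0_iff not_less_zero)
      then have "ord v = p"
        unfolding v_def using x True ox by (subst ord_pow) (auto simp: div_div_eq_right)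
      then have cv: "card (generate G {v}) = p" using generate_pow_card v by simp
      let ?T = "{w \<in> generate G {z}. w [^] p = \<one>}"
      have vp: "w [^] p = \<one>" if "w \<in> generate G {v}" for w
        using that v \<open>ord v = p\<close>
        by (auto simp: generate_pow_on_finite_carrier[OF fin] nat_pow_pow pow_eq_id)
      have "generate G {v} \<subseteq> ?T"
        using vp socle[OF p(1)] subgroup.mem_carrier[OF sub[OF v(1)]] by blast
      moreover have "card ?T \<le> card (generate G {v})"
        unfolding cv by (rule card_torsion_cyclic[OF fin z]) (use p1 in simp)
      moreover have "finite ?T" using fing[OF z] by simp
      ultimately have "generate G {v} = ?T" by (simp add: card_seteq)
      moreover have "u \<in> ?T" using u socle[OF p(1)] by simp
      moreover have "generate G {v} \<subseteq> ?X" using v X by (intro generate_subgroup_incl) auto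
      ultimately show False using u(3) by blast
    qed
  qed
  then have "?X = carrier G" using subgroup.subset[OF X] by blast
  then show ?thesis using x by blast
qed

lemma (in group_hom) subgroup_preimage:
  assumes "subgroup K H" shows "subgroup {g \<in> carrier G. h g \<in> K} G"
  using subgroup.m_closed[OF assms] subgroup.m_inv_closed[OF assms] subgroup.one_closed[OF assms]
  by unfold_locales auto

section \<open>Centres of nilpotent groups\<close>

context group
begin

lemma centreD: "z \<in> centre G \<Longrightarrow> z \<in> carrier G" "z \<in> centre G \<Longrightarrow> x \<in> carrier G \<Longrightarrow> z \<otimes> x = x \<otimes> z"
  by (auto simp: centre_def)

lemma centreI:
  "z \<in> carrier G \<Longrightarrow> (\<And>x. x \<in> carrier G \<Longrightarrow> z \<otimes> x = x \<otimes> z) \<Longrightarrow> z \<in> centre G"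
  unfolding centre_def by blast

lemma centre_subgroup: "subgroup (centre G) G"
proof -
  have "centre G = \<Inter> ((\<lambda>x. {g \<in> carrier G. g \<otimes> x = x \<otimes> g}) ` carrier G)"
    by (auto simp: centre_def)
  then show ?thesis
    by (metis (no_types, lifting) image_iff image_is_empty one_closed empty_iff subgroups_Inter subgroup_commutant)
qed

lemma central_subgroup_normal:
  assumes "subgroup K G" "K \<subseteq> centre G" shows "K \<lhd> G"
proof (rule normal_invI[OF assms(1)])
  fix x h assume x: "x \<in> carrier G" and h: "h \<in> K"
  then have "x \<otimes> h \<otimes> inv x = h \<otimes> (x \<otimes> inv x)"
    using assms centreD by (metis inv_closed m_assoc subsetD)
  then show "x \<otimes> h \<otimes> inv x \<in> K" using x h assms centreD by (auto simp: subset_eq)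
qed

lemma comm_group_centre: "comm_group (G\<lparr>carrier := centre G\<rparr>)"
proof -
  interpret Z: group "G\<lparr>carrier := centre G\<rparr>" by (rule subgroup_imp_group[OF centre_subgroup])
  show ?thesis
  proof (rule Z.group_comm_groupI)
    fix x y
    assume "x \<in> carrier (G\<lparr>carrier := centre G\<rparr>)" "y \<in> carrier (G\<lparr>carrier := centre G\<rparr>)"
    then show "x \<otimes>\<^bsub>G\<lparr>carrier := centre G\<rparr>\<^esub> y = y \<otimes>\<^bsub>G\<lparr>carrier := centre G\<rparr>\<^esub> x"
      using centreD by simp
  qed
qed

lemma commutator_subgroup_incl:
  assumes "subgroup K G" "\<And>x y. x \<in> H \<Longrightarrow> y \<in> L \<Longrightarrow> x \<otimes> y \<otimes> inv x \<otimes> inv y \<in> K"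
  shows "commutator_subgroup G H L \<subseteq> K"
  unfolding commutator_subgroup_def using assms by (intro generate_subgroup_incl) auto

lemma commutator_in_subgroup:
  "x \<in> H \<Longrightarrow> y \<in> L \<Longrightarrow> x \<otimes> y \<otimes> inv x \<otimes> inv y \<in> commutator_subgroup G H L"
  unfolding commutator_subgroup_def by (blast intro: generate.incl)

lemma commutator_eq_one_iff:
  assumes "x \<in> carrier G" "y \<in> carrier G"
  shows "x \<otimes> y \<otimes> inv x \<otimes> inv y = \<one> \<longleftrightarrow> x \<otimes> y = y \<otimes> x"
proof -
  have "x \<otimes> y \<otimes> inv x \<otimes> inv y = (x \<otimes> y) \<otimes> inv (y \<otimes> x)"
    using assms by (simp add: inv_mult_group m_assoc)
  then show ?thesis using assms by (metis inv_closed inv_equality inv_inv m_closed r_inv)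
qed

lemma lower_central_subgroup: "subgroup (lower_central G n) G"
proof (induction n)
  case (Suc n)
  then have "lower_central G n \<subseteq> carrier G" by (rule subgroup.subset)
  then show ?case by (auto simp: commutator_subgroup_def intro!: generate_is_subgroup)
qed (simp add: subgroup_self)

text \<open>Follow the lower central series to a term that meets \<open>N\<close> nontrivially while
  the next one does not. A commutator of an element of that intersection with any group element lies
  both in \<open>N\<close> and in the next term, so it is trivial.\<close>

lemma nilpotent_normal_meets_centre:
  assumes "nilpotent G" and N: "N \<lhd> G" and "N \<noteq> {\<one>}"
  shows "N \<inter> centre G \<noteq> {\<one>}"
proof -
  interpret N: normal N G by (rule N)
  obtain c where c: "lower_central G c = {\<one>}" using assms by (auto simp: nilpotent_def)
  let ?P = "\<lambda>n. N \<inter> lower_central G n = {\<one>}"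
  have "\<not> ?P 0" using assms N.subset by auto
  moreover have "?P c" using c N.one_closed by auto
  ultimately have "\<exists>n. \<not> ?P n \<and> ?P (Suc n)" by (induction c) blast+
  then obtain n where n: "\<not> ?P n" "?P (Suc n)" by blast
  have "\<one> \<in> N \<inter> lower_central G n"
    using subgroup.one_closed[OF lower_central_subgroup] by simp
  with n obtain x where x: "x \<in> N" "x \<in> lower_central G n" "x \<noteq> \<one>" by blast
  have "x \<otimes> y = y \<otimes> x" if y: "y \<in> carrier G" for y
  proof -
    have xc: "x \<in> carrier G" using x by simp
    have "x \<otimes> y \<otimes> inv x \<otimes> inv y \<in> lower_central G (Suc n)"
      using commutator_in_subgroup[OF x(2) y] by simp
    moreover have "x \<otimes> y \<otimes> inv x \<otimes> inv y = x \<otimes> (y \<otimes> inv x \<otimes> inv y)"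
      using xc y by (simp add: m_assoc)
    then have "x \<otimes> y \<otimes> inv x \<otimes> inv y \<in> N"
      using x y by (simp add: N.inv_op_closed2)
    ultimately have "x \<otimes> y \<otimes> inv x \<otimes> inv y = \<one>" using n by blast
    then show ?thesis using commutator_eq_one_iff xc y by blast
  qed
  then have "x \<in> centre G" using x by (intro centreI) simp_all
  then show ?thesis using x by blast
qed

text \<open>By maximality every nontrivial normal subgroup of the quotient meets the image of the
  centre of \<open>G\<close>, and that image is cyclic.\<close>
lemma cyclic_centre_quotient:
  assumes fin: "finite (carrier G)" and N: "N \<lhd> G" and K: "N \<inter> centre G = K"
    and max: "\<And>M. \<lbrakk>M \<lhd> G; N \<subseteq> M; M \<inter> centre G = K\<rbrakk> \<Longrightarrow> M = N"
    and z: "z \<in> centre G" "generate G (insert z K) = centre G"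
  shows "cyclic_group ((G Mod N)\<lparr>carrier := centre (G Mod N)\<rparr>)"
proof -
  interpret N: normal N G by (rule N)
  let ?Q = "G Mod N"
  interpret Q: group ?Q by (rule N.factorgroup_is_group)
  interpret pi: group_hom G ?Q "\<lambda>g. N #> g"
    using N.r_coset_hom_Mod by unfold_locales
  let ?C = "?Q\<lparr>carrier := centre ?Q\<rparr>"
  interpret C: comm_group ?C by (rule Q.comm_group_centre)
  have carQ: "carrier ?Q = (\<lambda>g. N #> g) ` carrier G" by (rule carrier_FactGroup)
  have finQ: "finite (carrier ?Q)" using fin by (simp add: carQ)
  have Zsub: "subgroup (centre ?Q) ?Q" by (rule Q.centre_subgroup)
  have finC: "finite (centre ?Q)" using finQ subgroup.subset[OF Zsub] finite_subset by blast
  have zc: "N #> g \<in> centre ?Q" if g: "g \<in> centre G" for g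
  proof -
    have "(N #> g) \<otimes>\<^bsub>?Q\<^esub> (N #> h) = (N #> h) \<otimes>\<^bsub>?Q\<^esub> (N #> g)" if h: "h \<in> carrier G" for h
      unfolding pi.hom_mult[OF centreD(1)[OF g] h, symmetric]
        pi.hom_mult[OF h centreD(1)[OF g], symmetric] centreD(2)[OF g h] ..
    note comm = this
    show ?thesis
    proof (rule Q.centreI)
      fix W assume "W \<in> carrier ?Q"
      then obtain h where h: "h \<in> carrier G" "W = N #> h" unfolding carQ by blast
      show "(N #> g) \<otimes>\<^bsub>?Q\<^esub> W = W \<otimes>\<^bsub>?Q\<^esub> (N #> g)" unfolding h(2) by (rule comm[OF h(1)])
    qed (rule pi.hom_closed[OF centreD(1)[OF g]])
  qed
  let ?D = "generate ?Q {N #> z}"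
  have D: "subgroup ?D ?Q" using centreD(1)[OF z(1)] by (intro Q.generate_is_subgroup) auto
  \<comment> \<open>\<open>K\<close> lies in \<open>N\<close> and dies in the quotient, so only the
    image of \<open>z\<close> is left to generate the image of the centre of
    \<open>G\<close>.\<close>
  have imD: "N #> g \<in> ?D" if "g \<in> centre G" for g
  proof -
    have "insert z K \<subseteq> {g \<in> carrier G. N #> g \<in> ?D}"
    proof -
      have "k \<in> carrier G \<and> N #> k \<in> ?D" if "k \<in> K" for k
      proof -
        have k: "k \<in> N" "k \<in> carrier G" using that K N.subset by blast+
        then have "N #> k = \<one>\<^bsub>?Q\<^esub>" by (simp add: coset_join2 N.subgroup_axioms)
        then show ?thesis using k(2) generate.one[of ?Q "{N #> z}"] by (simp only:)
      qed
      moreover have "N #> z \<in> ?D" by (rule generate.incl) simp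
      ultimately show ?thesis using centreD(1)[OF z(1)] by blast
    qed
    then show ?thesis
      using generate_subgroup_incl[OF _ pi.subgroup_preimage[OF D]] z that by blast
  qed
  have "\<exists>W\<in>carrier ?C. generate ?C {W} = carrier ?C"
  proof (rule C.cyclic_if_cyclic_socle)
    show "finite (carrier ?C)" using finC by simp
    show "N #> z \<in> carrier ?C" using zc z by simp
    fix p :: nat and U
    assume p: "Factorial_Ring.prime p" and "U \<in> carrier ?C" and "U [^]\<^bsub>?C\<^esub> p = \<one>\<^bsub>?C\<^esub>"
    then have U: "U \<in> centre ?Q" and Up: "U [^]\<^bsub>?Q\<^esub> p = \<one>\<^bsub>?Q\<^esub>"
      by (simp_all add: nat_pow_def)
    have UQ: "U \<in> carrier ?Q" using U by (rule Q.centreD)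
    have "U \<in> ?D"
    proof (cases "U = \<one>\<^bsub>?Q\<^esub>")
      case True
      then show ?thesis using generate.one by metis
    next
      case False
      have "Q.ord U dvd p" using Up Q.pow_eq_id[OF UQ] by blast
      moreover have "Q.ord U \<noteq> 1" using False Q.ord_eq_1[OF UQ] by blast
      ultimately have oU: "Q.ord U = p" using p unfolding prime_nat_iff by blast
      let ?V = "generate ?Q {U}"
      have V: "subgroup ?V ?Q" using UQ by (intro Q.generate_is_subgroup) auto
      have Vc: "?V \<subseteq> centre ?Q" using U Zsub by (intro Q.generate_subgroup_incl) auto
      \<comment> \<open>The preimage of the subgroup generated by \<open>U\<close> is normal because
        \<open>U\<close> is central. It properly contains \<open>N\<close>, so maximality of
        \<open>N\<close> produces an element \<open>m\<close> of it that is central in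
        \<open>G\<close> but not in \<open>N\<close>.\<close>
      let ?M = "{g \<in> carrier G. N #> g \<in> ?V}"
      have M: "?M \<lhd> G"
      proof (rule normal_invI[OF pi.subgroup_preimage[OF V]])
        fix x h assume x: "x \<in> carrier G" and h: "h \<in> ?M"
        have hc: "N #> h \<in> centre ?Q" using h Vc by blast
        have "N #> (x \<otimes> h \<otimes> inv x) = (N #> x) \<otimes>\<^bsub>?Q\<^esub> (N #> h) \<otimes>\<^bsub>?Q\<^esub> inv\<^bsub>?Q\<^esub> (N #> x)"
          using x h by (simp only: mem_Collect_eq pi.hom_mult pi.hom_inv m_closed inv_closed)
        also have "\<dots> = (N #> h) \<otimes>\<^bsub>?Q\<^esub> (N #> x) \<otimes>\<^bsub>?Q\<^esub> inv\<^bsub>?Q\<^esub> (N #> x)"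
          using Q.centreD(2)[OF hc pi.hom_closed[OF x]] by simp
        also have "\<dots> = N #> h"
          using x h by (simp only: mem_Collect_eq Q.m_assoc pi.hom_closed Q.inv_closed Q.r_inv Q.r_one)
        finally show "x \<otimes> h \<otimes> inv x \<in> ?M" using x h by simp
      qed
      obtain u where u: "u \<in> carrier G" "U = N #> u" using UQ carQ by auto
      have "N \<subseteq> ?M"
      proof
        fix k assume "k \<in> N"
        then have k: "N #> k = \<one>\<^bsub>?Q\<^esub>" "k \<in> carrier G"
          by (simp_all add: coset_join2 N.subgroup_axioms)
        show "k \<in> ?M" using k(2) generate.one[of ?Q "{U}"] unfolding mem_Collect_eq k(1) by blast
      qed
      moreover have "u \<in> ?M" using u generate.incl[of U "{U}" ?Q] by simp
      moreover have "u \<notin> N" using u False by (auto simp: coset_join2 N.subgroup_axioms)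
      ultimately have "?M \<inter> centre G \<noteq> K" using max[OF M] by blast
      then obtain m where m: "m \<in> ?M" "m \<in> centre G" "m \<notin> N"
        using \<open>N \<subseteq> ?M\<close> K by blast
      then obtain i where i: "N #> m = U [^]\<^bsub>?Q\<^esub> (i::nat)"
        using Q.generate_pow_on_finite_carrier[OF finQ UQ] by auto
      have "N #> m \<noteq> \<one>\<^bsub>?Q\<^esub>"
        using m N.subset by (metis (lifting) coset_join1 mem_Collect_eq N.subgroup_axioms one_FactGroup)
      \<comment> \<open>A nontrivial power of an element of prime order generates the same subgroup,
        so \<open>U\<close> is in turn a power of the image of the central element
        \<open>m\<close>.\<close>
      then have "\<not> p dvd i" unfolding i Q.pow_eq_id[OF UQ] oU .
      then have "coprime i (Q.ord U)" using p oU by (metis coprime_commute prime_imp_coprime)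
      then obtain j where j: "U = (U [^]\<^bsub>?Q\<^esub> i) [^]\<^bsub>?Q\<^esub> (j::nat)"
        using Q.generate_pow_coprime[OF finQ UQ] by blast
      have "(N #> m) [^]\<^bsub>?Q\<^esub> j \<in> ?D" by (rule Q.subgroup_nat_pow_closed[OF D imD[OF m(2)]])
      then show ?thesis unfolding i j[symmetric] .
    qed
    then show "U \<in> generate ?C {N #> z}"
      using Q.generate_consistent[OF _ Zsub, of "{N #> z}"] zc z by simp
  qed
  then obtain W where W: "W \<in> carrier ?C" "generate ?C {W} = carrier ?C" by blast
  then have "subgroup_generated ?C {W} = ?C"
    unfolding subgroup_generated_def by simp
  then show ?thesis unfolding cyclic_group_def using W by blast
qed

lemma subdirect_cyclic_centres:
  assumes fin: "finite (carrier G)" and nil: "nilpotent G"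
  defines "n \<equiv> min_gens (G\<lparr>carrier := centre G\<rparr>)"
  shows "\<exists>(H :: nat \<Rightarrow> 'a set monoid) S. subdirect_product {..<n} H S \<and>
    (\<forall>i<n. cyclic_group ((H i)\<lparr>carrier := centre (H i)\<rparr>)) \<and>
    G \<cong> (product_group {..<n} H)\<lparr>carrier := S\<rparr>"
proof -
  let ?Z = "G\<lparr>carrier := centre G\<rparr>"
  note Z = centre_subgroup
  interpret Z: comm_group ?Z by (rule comm_group_centre)
  have finZ: "finite (centre G)" using fin subgroup.subset[OF Z] finite_subset by blast
  obtain xs where xs: "set xs \<subseteq> centre G" "length xs = n" "generate G (set xs) = centre G"
    using min_gens_subgroup_obtain[OF Z finZ] unfolding n_def by metis
  obtain K z where Kz: "\<forall>i<n. subgroup (K i) ?Z \<and> z i \<in> carrier ?Z \<and>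
      generate ?Z (insert (z i) (K i)) = generate ?Z (set xs)"
    and Kint: "(\<Inter>i<n. K i) \<inter> generate ?Z (set xs) = {\<one>\<^bsub>?Z\<^esub>}"
    using Z.cyclic_quotient_family[of xs] finZ xs by auto
  have gxs: "generate ?Z (set xs) = centre G"
    using xs Z by (simp add: generate_consistent)
  have K: "subgroup (K i) G" "K i \<subseteq> centre G" "z i \<in> centre G"
      "generate G (insert (z i) (K i)) = centre G" if "i < n" for i
  proof -
    have i: "subgroup (K i) ?Z" "z i \<in> centre G" "generate ?Z (insert (z i) (K i)) = centre G"
      using Kz that gxs by auto
    show "subgroup (K i) G" using i(1) Z incl_subgroup by blast
    show Ki: "K i \<subseteq> centre G" using subgroup.subset[OF i(1)] by simp
    show "z i \<in> centre G" by (rule i)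
    show "generate G (insert (z i) (K i)) = centre G"
      using i Ki Z generate_consistent[of "insert (z i) (K i)" "centre G"] by simp
  qed
  have "\<exists>N. N \<lhd> G \<and> N \<inter> centre G = K i \<and>
      (\<forall>M. M \<lhd> G \<and> N \<subseteq> M \<and> M \<inter> centre G = K i \<longrightarrow> M = N)" if i: "i < n" for i
  proof -
    \<comment> \<open>The family is nonempty: \<open>K i\<close> is central, hence itself normal in
      \<open>G\<close>.\<close>
    let ?F = "{N. N \<lhd> G \<and> N \<inter> centre G = K i}"
    have "?F \<subseteq> Pow (carrier G)" using normal_imp_subgroup subgroup.subset by blast
    then have "finite ?F" using fin by (meson finite_Pow_iff finite_subset)
    moreover have "K i \<in> ?F" using K[OF i] central_subgroup_normal by auto
    ultimately obtain N where "N \<in> ?F" "\<forall>M\<in>?F. N \<subseteq> M \<longrightarrow> N = M"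
      using finite_has_maximal[of ?F] by blast
    then show ?thesis by blast
  qed
  then obtain N where N: "\<And>i. i < n \<Longrightarrow> N i \<lhd> G" "\<And>i. i < n \<Longrightarrow> N i \<inter> centre G = K i"
      "\<And>i M. i < n \<Longrightarrow> M \<lhd> G \<Longrightarrow> N i \<subseteq> M \<Longrightarrow> M \<inter> centre G = K i \<Longrightarrow> M = N i"
    by metis
  let ?H = "\<lambda>i. G Mod N i"
  let ?P = "product_group {..<n} ?H"
  let ?f = "\<lambda>g. \<lambda>i\<in>{..<n}. N i #> g"
  have grpH: "group (?H i)" if "i < n" for i using N(1)[OF that] by (rule normal.factorgroup_is_group)
  interpret P: group ?P by (rule product_group) (simp add: grpH)
  have homi: "(\<lambda>g. N i #> g) \<in> hom G (?H i)" if "i < n" for i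
    using N(1)[OF that] by (rule normal.r_coset_hom_Mod)
  interpret f: group_hom G ?P ?f
  proof unfold_locales
    show "?f \<in> hom G ?P"
    proof (rule homI)
      fix x y assume xy: "x \<in> carrier G" "y \<in> carrier G"
      show "?f x \<in> carrier ?P" using hom_in_carrier[OF homi xy(1)] by simp
      show "?f (x \<otimes> y) = ?f x \<otimes>\<^bsub>?P\<^esub> ?f y"
        using hom_mult[OF homi] xy by (auto simp: fun_eq_iff)
    qed
  qed
  \<comment> \<open>Intersecting with \<open>carrier G\<close> matters for \<open>n = 0\<close>,
    where the intersection over no index is the whole type; the argument then shows that trivial
    centre forces \<open>G\<close> to be trivial.\<close>
  let ?I = "carrier G \<inter> (\<Inter>i<n. N i)"
  have I: "?I \<lhd> G"
  proof (rule normal_invI)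
    show "subgroup ?I G"
    proof (cases "n = 0")
      case False
      then have "subgroup (\<Inter> (N ` {..<n})) G"
        using N(1) by (intro subgroups_Inter) (auto simp: normal_imp_subgroup)
      then show ?thesis by (meson inf.absorb2 subgroup.subset subgroup_self subgroups_Inter_pair)
    qed (simp add: subgroup_self)
    show "x \<otimes> h \<otimes> inv x \<in> ?I" if "x \<in> carrier G" "h \<in> ?I" for x h
      using that N(1) by (auto simp: normal.inv_op_closed2)
  qed
  have "?I \<inter> centre G = {\<one>}"
  proof -
    have "?I \<inter> centre G = (\<Inter>i<n. K i) \<inter> centre G"
      using N(2) centreD(1) by blast
    then show ?thesis using Kint gxs by simp
  qed
  then have I1: "?I = {\<one>}" using nilpotent_normal_meets_centre[OF nil I] by blast
  have inj: "inj_on ?f (carrier G)"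
  proof -
    have "x = \<one>" if x: "x \<in> carrier G" "?f x = \<one>\<^bsub>?P\<^esub>" for x
    proof -
      have "x \<in> N i" if "i < n" for i
      proof -
        have "N i #> x = N i" using x(2) that by (auto simp: fun_eq_iff dest: spec[of _ i])
        then show ?thesis using x(1) N(1)[OF that] by (metis coset_join1 normal_imp_subgroup)
      qed
      then show ?thesis using I1 x by blast
    qed
    then show ?thesis using f.inj_on_one_iff by blast
  qed
  let ?S = "?f ` carrier G"
  have "subdirect_product {..<n} ?H ?S"
    unfolding subdirect_product_def
  proof (intro conjI ballI)
    fix i assume i: "i \<in> {..<n}"
    then show "group (?H i)" using grpH by simp
    show "(\<lambda>x. x i) ` ?S = carrier (?H i)" using i by (force simp: carrier_FactGroup image_image)
  qed (rule f.img_is_subgroup)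
  moreover have "cyclic_group ((?H i)\<lparr>carrier := centre (?H i)\<rparr>)" if "i < n" for i
    using cyclic_centre_quotient[OF fin N(1)[OF that] N(2)[OF that]] N(3)[OF that] K[OF that] by blast
  moreover have "?f \<in> iso G (?P\<lparr>carrier := ?S\<rparr>)"
    using inj f.homh by (auto simp: iso_def hom_def bij_betw_def simp del: mult_product_group carrier_product_group)
  ultimately show ?thesis unfolding is_iso_def by blast
qed

text \<open>By induction the kernel of the last map on \<open>A\<close> needs at most
  \<open>n\<close> generators, and one element whose last image generates the cyclic image of
  \<open>A\<close> completes them. Joint injectivity of the \<open>f i\<close> on \<open>A\<close>
  takes the place of an embedding into a product of cyclic groups.\<close>

lemma generators_from_cyclic_images:
  fixes H :: "nat \<Rightarrow> ('c, 'd) monoid_scheme"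
  assumes "subgroup A G"
    and "\<And>i. i < n \<Longrightarrow> group_hom G (H i) (f i)"
    and "\<And>i. i < n \<Longrightarrow> c i \<in> carrier (H i)"
    and "\<And>i. i < n \<Longrightarrow> f i ` A \<subseteq> range (\<lambda>k::int. c i [^]\<^bsub>H i\<^esub> k)"
    and "\<And>a. a \<in> A \<Longrightarrow> (\<And>i. i < n \<Longrightarrow> f i a = \<one>\<^bsub>H i\<^esub>) \<Longrightarrow> a = \<one>"
  shows "\<exists>S\<subseteq>A. finite S \<and> card S \<le> n \<and> generate G S = A"
  using assms
proof (induction n arbitrary: A)
  case 0
  then have "A = {\<one>}" using subgroup.one_closed by fastforce
  then show ?case by (intro exI[of _ "{}"]) (simp add: generate_empty)
next
  case (Suc n)
  note A = Suc.prems(1)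
  interpret f: group_hom G "H n" "f n" using Suc.prems(2) by simp
  define K where "K = A \<inter> kernel G (H n) (f n)"
  have K: "subgroup K G" unfolding K_def by (rule subgroups_Inter_pair[OF A f.subgroup_kernel])
  have "\<exists>S\<subseteq>K. finite S \<and> card S \<le> n \<and> generate G S = K"
  proof (rule Suc.IH[OF K])
    fix a assume a: "a \<in> K" and a1: "\<And>i. i < n \<Longrightarrow> f i a = \<one>\<^bsub>H i\<^esub>"
    show "a = \<one>"
      using Suc.prems(5)[of a] a a1 by (auto simp: K_def kernel_def less_Suc_eq)
  next
    show "f i ` K \<subseteq> range (\<lambda>k::int. c i [^]\<^bsub>H i\<^esub> k)" if "i < n" for i
      using Suc.prems(4)[of i] that by (auto simp: K_def image_subset_iff)
  qed (use Suc.prems in simp_all)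
  then obtain S where S: "S \<subseteq> K" "finite S" "card S \<le> n" "generate G S = K" by blast
  have cn: "c n \<in> carrier (H n)" using Suc.prems(3) by simp
  have Ac: "a \<in> carrier G" if "a \<in> A" for a using A that by (rule subgroup.mem_carrier)
  show ?case
  proof (cases "K = A")
    case True
    then show ?thesis using S by (metis le_SucI)
  next
    case False
    \<comment> \<open>The least positive exponent occurring in the image of \<open>A\<close> will be
      \<open>k\<close>. The exponent \<open>k0\<close> may be negative, hence the passage to its
      absolute value.\<close>
    let ?P = "\<lambda>k::nat. k > 0 \<and> c n [^]\<^bsub>H n\<^esub> (int k) \<in> f n ` A"
    obtain a0 where a0: "a0 \<in> A" "f n a0 \<noteq> \<one>\<^bsub>H n\<^esub>" using False Ac by (auto simp: K_def kernel_def)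
    then obtain k0 where k0: "f n a0 = c n [^]\<^bsub>H n\<^esub> (k0::int)" using Suc.prems(4)[of n] by auto
    have "k0 \<noteq> 0" using k0 a0 by auto
    moreover have "c n [^]\<^bsub>H n\<^esub> (\<bar>k0\<bar>) \<in> f n ` A"
    proof (cases "k0 > 0")
      case False
      then have "c n [^]\<^bsub>H n\<^esub> (\<bar>k0\<bar>) = f n (inv a0)"
        using k0 a0 Ac cn by (simp add: f.H.int_pow_neg abs_if)
      then show ?thesis using a0 A by (auto simp: subgroup.m_inv_closed)
    next
      case True
      then show ?thesis using a0(1) k0 by (metis abs_of_pos imageI)
    qed
    ultimately have "?P (nat \<bar>k0\<bar>)" by simp
    then have "?P (LEAST k. ?P k)" by (rule LeastI)
    then obtain k where k: "k > 0" "c n [^]\<^bsub>H n\<^esub> (int k) \<in> f n ` A"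
      and kmin: "\<And>j. ?P j \<Longrightarrow> k \<le> j" using Least_le[of ?P] by metis
    then obtain a where a: "a \<in> A" "f n a = c n [^]\<^bsub>H n\<^esub> (int k)" by auto
    have SA: "insert a S \<subseteq> A" using S a by (auto simp: K_def)
    have sub: "subgroup (generate G (insert a S)) G"
      using SA Ac by (intro generate_is_subgroup) auto
    have "A \<subseteq> generate G (insert a S)"
    proof
      fix b assume b: "b \<in> A"
      then obtain j where j: "f n b = c n [^]\<^bsub>H n\<^esub> (j::int)" using Suc.prems(4)[of n] by auto
      \<comment> \<open>Division with remainder: the last image of \<open>b'\<close> has exponent
        \<open>j mod k\<close>, which is zero by minimality of \<open>k\<close>, so
        \<open>b'\<close> falls into the kernel \<open>K\<close>.\<close>
      define q where "q = j div int k"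
      define b' where "b' = b \<otimes> inv (a [^] q)"
      have aq: "a [^] q \<in> A" using A a by (simp add: subgroup_int_pow_closed)
      have b': "b' \<in> A" unfolding b'_def using A b aq by (simp add: subgroup.m_closed subgroup.m_inv_closed)
      have "f n b' = f n b \<otimes>\<^bsub>H n\<^esub> inv\<^bsub>H n\<^esub> (f n a [^]\<^bsub>H n\<^esub> q)"
        using a b Ac by (simp add: b'_def f.hom_int_pow)
      also have "\<dots> = c n [^]\<^bsub>H n\<^esub> (j - int k * q)"
        using cn a j by (simp add: f.H.int_pow_diff f.H.int_pow_pow)
      also have "j - int k * q = int (nat (j mod int k))"
        using k(1) by (simp add: q_def minus_mult_div_eq_mod)
      finally have fb': "f n b' = c n [^]\<^bsub>H n\<^esub> int (nat (j mod int k))" .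
      have "nat (j mod int k) < k" using k(1) by (simp add: nat_less_iff)
      then have "nat (j mod int k) = 0"
        using kmin[of "nat (j mod int k)"] fb' b' by (metis gr0I imageI not_le)
      then have "b' \<in> K" using fb' b' Ac by (simp add: K_def kernel_def)
      then have "b' \<in> generate G (insert a S)"
        using S(4) mono_generate[of S "insert a S"] by blast
      moreover have "a [^] q \<in> generate G (insert a S)"
        by (rule subgroup_int_pow_closed[OF sub]) (simp add: generate.incl)
      ultimately have "b' \<otimes> a [^] q \<in> generate G (insert a S)" by (rule subgroup.m_closed[OF sub])
      moreover have "b' \<otimes> a [^] q = b" using b aq Ac by (simp add: b'_def m_assoc)
      ultimately show "b \<in> generate G (insert a S)" by simp
    qed
    then have "generate G (insert a S) = A" using generate_subgroup_incl[OF SA A] by blast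
    moreover have "card (insert a S) \<le> Suc n" using S(2,3) by (simp add: card_insert_if)
    ultimately show ?thesis using SA S(2) by (intro exI[of _ "insert a S"]) auto
  qed
qed

text \<open>Surjectivity of the projections is what makes a central element of \<open>G\<close>
  central in each factor; an arbitrary subgroup of the product would not do.\<close>

lemma subdirect_cyclic_centres_bound:
  fixes H :: "nat \<Rightarrow> 'c monoid"
  assumes sd: "subdirect_product {..<n} H S"
    and cyc: "\<And>i. i < n \<Longrightarrow> cyclic_group ((H i)\<lparr>carrier := centre (H i)\<rparr>)"
    and iso: "G \<cong> (product_group {..<n} H)\<lparr>carrier := S\<rparr>"
  shows "min_gens (G\<lparr>carrier := centre G\<rparr>) \<le> n"
proof -
  let ?P = "product_group {..<n} H"
  have grp: "group (H i)" if "i < n" for i using sd that by (simp add: subdirect_product_def)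
  interpret P: group ?P by (rule product_group) (simp add: grp)
  have S: "subgroup S ?P" and proj: "\<And>i. i < n \<Longrightarrow> (\<lambda>x. x i) ` S = carrier (H i)"
    using sd by (auto simp: subdirect_product_def)
  obtain h where h: "h \<in> iso G (?P\<lparr>carrier := S\<rparr>)" using iso by (auto simp: is_iso_def)
  have hb: "bij_betw h (carrier G) S" and hh: "h \<in> hom G (?P\<lparr>carrier := S\<rparr>)"
    using h by (auto simp: iso_def)
  have hP: "h \<in> hom G ?P" using hh subgroup.subset[OF S] by (auto simp: hom_def simp del: carrier_product_group)
  interpret h: group_hom G ?P h using hP by unfold_locales
  have f: "group_hom G (H i) (\<lambda>g. h g i)" if i: "i < n" for i
  proof -
    interpret Hi: group "H i" by (rule grp[OF i])
    show ?thesis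
    proof (unfold_locales, rule homI)
      fix x y assume xy: "x \<in> carrier G" "y \<in> carrier G"
      show "h x i \<in> carrier (H i)" using h.hom_closed[OF xy(1)] i by (auto simp: PiE_iff)
      show "h (x \<otimes> y) i = h x i \<otimes>\<^bsub>H i\<^esub> h y i" using h.hom_mult[OF xy] i by simp
    qed
  qed
  have fc: "h a i \<in> centre (H i)" if i: "i < n" and a: "a \<in> centre G" for i a
  proof -
    interpret fi: group_hom G "H i" "\<lambda>g. h g i" by (rule f[OF i])
    have onto: "(\<lambda>g. h g i) ` carrier G = carrier (H i)"
      using proj[OF i] unfolding bij_betw_imp_surj_on[OF hb, symmetric] image_image .
    have "h a i \<otimes>\<^bsub>H i\<^esub> y = y \<otimes>\<^bsub>H i\<^esub> h a i" if "y \<in> carrier (H i)" for y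
    proof -
      have "y \<in> (\<lambda>g. h g i) ` carrier G" using that unfolding onto .
      then obtain g where g: "g \<in> carrier G" "y = h g i" by (elim imageE)
      show ?thesis
        unfolding g(2) fi.hom_mult[OF centreD(1)[OF a] g(1), symmetric]
          fi.hom_mult[OF g(1) centreD(1)[OF a], symmetric] centreD(2)[OF a g(1)] ..
    qed
    then show ?thesis by (rule group.centreI[OF grp[OF i] fi.hom_closed[OF centreD(1)[OF a]]])
  qed
  have "\<exists>c\<in>centre (H i). centre (H i) = range (\<lambda>k::int. c [^]\<^bsub>H i\<^esub> k)" if i: "i < n" for i
  proof -
    interpret Hi: group "H i" by (rule grp[OF i])
    interpret C: group "(H i)\<lparr>carrier := centre (H i)\<rparr>"
      by (rule Hi.subgroup_imp_group[OF Hi.centre_subgroup])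
    from cyc[OF i] obtain c where c: "c \<in> centre (H i)"
        "centre (H i) = range (\<lambda>k::int. c [^]\<^bsub>(H i)\<lparr>carrier := centre (H i)\<rparr>\<^esub> k)"
      unfolding C.cyclic_group by auto
    show ?thesis
      using c(2) unfolding Hi.int_pow_consistent[OF Hi.centre_subgroup c(1), symmetric]
      using c(1) by blast
  qed
  then obtain c where c: "\<And>i. i < n \<Longrightarrow> c i \<in> centre (H i)"
      "\<And>i. i < n \<Longrightarrow> centre (H i) = range (\<lambda>k::int. c i [^]\<^bsub>H i\<^esub> k)" by metis
  have "\<exists>S\<subseteq>centre G. finite S \<and> card S \<le> n \<and> generate G S = centre G"
  proof (rule generators_from_cyclic_images[OF centre_subgroup, where H = H and f = "\<lambda>i g. h g i" and c = c])
    show "c i \<in> carrier (H i)" if "i < n" for i by (rule group.centreD(1)[OF grp[OF that] c(1)[OF that]])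
    show "(\<lambda>g. h g i) ` centre G \<subseteq> range (\<lambda>k::int. c i [^]\<^bsub>H i\<^esub> k)" if "i < n" for i
      using fc[OF that] c(2)[OF that] by blast
    fix a assume a: "a \<in> centre G" "\<And>i. i < n \<Longrightarrow> h a i = \<one>\<^bsub>H i\<^esub>"
    have ac: "a \<in> carrier G" using a by (simp add: centreD)
    have "h a = \<one>\<^bsub>?P\<^esub>"
    proof
      fix i
      show "h a i = \<one>\<^bsub>?P\<^esub> i"
        using a(2) h.hom_closed[OF ac] by (auto simp: PiE_iff extensional_def)
    qed
    then have "h a = h \<one>" unfolding h.hom_one .
    then show "a = \<one>" by (rule inj_onD[OF bij_betw_imp_inj_on[OF hb] _ ac one_closed])
  qed (use f in auto)
  then show ?thesis using min_gens_subgroup_le[OF centre_subgroup] by (meson le_trans)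
qed

end

section \<open>Groups of class at most two\<close>

definition (in group) commutator :: "'a \<Rightarrow> 'a \<Rightarrow> 'a" where
  "commutator x y = x \<otimes> y \<otimes> inv x \<otimes> inv y"

text \<open>Class at most 2 in the form in which it is used: central values make the commutator
  bilinear.\<close>

locale class_two_group = group +
  assumes commutator_central:
    "\<lbrakk>x \<in> carrier G; y \<in> carrier G\<rbrakk> \<Longrightarrow> commutator x y \<in> centre G"
begin

lemma commutator_closed [simp, intro]:
  "\<lbrakk>x \<in> carrier G; y \<in> carrier G\<rbrakk> \<Longrightarrow> commutator x y \<in> carrier G"
  by (simp add: commutator_def)

lemma commutator_commute:
  "\<lbrakk>x \<in> carrier G; y \<in> carrier G; z \<in> carrier G\<rbrakk> \<Longrightarrow> commutator x y \<otimes> z = z \<otimes> commutator x y"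
  by (rule centreD(2)[OF commutator_central])

lemma commutator_one_iff:
  "\<lbrakk>x \<in> carrier G; y \<in> carrier G\<rbrakk> \<Longrightarrow> commutator x y = \<one> \<longleftrightarrow> x \<otimes> y = y \<otimes> x"
  unfolding commutator_def by (rule commutator_eq_one_iff)

lemma commutator_self [simp]: "x \<in> carrier G \<Longrightarrow> commutator x x = \<one>"
  by (simp add: commutator_one_iff)

lemma commutator_swap:
  "\<lbrakk>x \<in> carrier G; y \<in> carrier G\<rbrakk> \<Longrightarrow> x \<otimes> y = commutator x y \<otimes> (y \<otimes> x)"
  by (simp add: commutator_def m_assoc) (simp flip: m_assoc)

text \<open>Commutators are computed below by checking a swap identity instead of expanding
  inverses.\<close>

lemma commutator_unique:
  assumes "x \<in> carrier G" "y \<in> carrier G" "c \<in> carrier G" "x \<otimes> y = c \<otimes> (y \<otimes> x)"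
  shows "commutator x y = c"
proof -
  have "commutator x y \<otimes> (y \<otimes> x) = c \<otimes> (y \<otimes> x)"
    using commutator_swap[OF assms(1,2)] assms(4) by simp
  then show ?thesis using assms by (metis commutator_closed m_closed right_cancel)
qed

lemma commutator_inv_swap:
  assumes "x \<in> carrier G" "y \<in> carrier G"
  shows "commutator y x = inv (commutator x y)"
proof (rule commutator_unique[OF assms(2,1)])
  have "inv (commutator x y) \<otimes> (x \<otimes> y) = inv (commutator x y) \<otimes> (commutator x y \<otimes> (y \<otimes> x))"
    using commutator_swap[OF assms] by simp
  also have "\<dots> = (inv (commutator x y) \<otimes> commutator x y) \<otimes> (y \<otimes> x)"
    using assms by (simp only: m_assoc commutator_closed inv_closed m_closed)
  also have "\<dots> = y \<otimes> x" using assms by simp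
  finally show "y \<otimes> x = inv (commutator x y) \<otimes> (x \<otimes> y)" ..
qed (use assms in simp)

text \<open>Moving \<open>z\<close> to the left past \<open>y\<close> and then past \<open>x\<close>
  produces the two commutators, which can be collected in front because they are central.\<close>

lemma commutator_mult_left:
  assumes "x \<in> carrier G" "y \<in> carrier G" "z \<in> carrier G"
  shows "commutator (x \<otimes> y) z = commutator x z \<otimes> commutator y z"
proof (rule commutator_unique)
  let ?a = "commutator x z" and ?b = "commutator y z"
  note c = assms commutator_closed inv_closed m_closed
  have "x \<otimes> y \<otimes> z = x \<otimes> (?b \<otimes> (z \<otimes> y))"
    using commutator_swap[OF assms(2,3)] assms by (simp add: m_assoc)
  also have "\<dots> = (x \<otimes> ?b) \<otimes> (z \<otimes> y)" using c by (simp only: m_assoc)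
  also have "x \<otimes> ?b = ?b \<otimes> x" by (rule commutator_commute[symmetric]) fact+
  also have "?b \<otimes> x \<otimes> (z \<otimes> y) = ?b \<otimes> (x \<otimes> z) \<otimes> y" using c by (simp only: m_assoc)
  also have "x \<otimes> z = ?a \<otimes> (z \<otimes> x)" by (rule commutator_swap[OF assms(1,3)])
  also have "?b \<otimes> (?a \<otimes> (z \<otimes> x)) \<otimes> y = (?b \<otimes> ?a) \<otimes> (z \<otimes> (x \<otimes> y))" using c by (simp only: m_assoc)
  also have "?b \<otimes> ?a = ?a \<otimes> ?b"
    by (rule commutator_commute) (use assms in auto)
  finally show "x \<otimes> y \<otimes> z = ?a \<otimes> ?b \<otimes> (z \<otimes> (x \<otimes> y))" .
qed (use assms in auto)

lemma commutator_hom_left: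
  assumes "z \<in> carrier G" shows "group_hom G G (\<lambda>x. commutator x z)"
  by unfold_locales (use assms in \<open>auto simp: hom_def commutator_mult_left\<close>)

lemma commutator_hom_right:
  assumes "z \<in> carrier G" shows "group_hom G G (\<lambda>x. commutator z x)"
proof unfold_locales
  show "(\<lambda>x. commutator z x) \<in> hom G G"
  proof (rule homI)
    fix x y assume xy: "x \<in> carrier G" "y \<in> carrier G"
    have "commutator z (x \<otimes> y) = inv (commutator x z \<otimes> commutator y z)"
      using commutator_inv_swap[of "x \<otimes> y" z] xy assms by (simp add: commutator_mult_left)
    also have "\<dots> = inv (commutator y z) \<otimes> inv (commutator x z)"
      using xy assms by (simp add: inv_mult_group)
    also have "\<dots> = commutator z y \<otimes> commutator z x"
      using commutator_inv_swap[OF xy(1) assms] commutator_inv_swap[OF xy(2) assms] by simp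
    also have "\<dots> = commutator z x \<otimes> commutator z y"
      by (rule commutator_commute) (use xy assms in auto)
    finally show "commutator z (x \<otimes> y) = commutator z x \<otimes> commutator z y" .
  qed (use assms in simp)
qed

lemma commutator_mult_right:
  "\<lbrakk>x \<in> carrier G; y \<in> carrier G; z \<in> carrier G\<rbrakk> \<Longrightarrow>
    commutator z (x \<otimes> y) = commutator z x \<otimes> commutator z y"
  by (rule group_hom.hom_mult[OF commutator_hom_right])

lemma commutator_int_pow_right:
  "\<lbrakk>x \<in> carrier G; z \<in> carrier G\<rbrakk> \<Longrightarrow> commutator z (x [^] (i::int)) = commutator z x [^] i"
  by (rule group_hom.hom_int_pow[OF commutator_hom_right])

lemma commutator_int_pow_left:
  "\<lbrakk>x \<in> carrier G; z \<in> carrier G\<rbrakk> \<Longrightarrow> commutator (x [^] (i::int)) z = commutator x z [^] i"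
  by (rule group_hom.hom_int_pow[OF commutator_hom_left])

lemma commutator_right_generate:
  assumes "z \<in> carrier G" "S \<subseteq> carrier G" "subgroup K G"
    and "\<And>s. s \<in> S \<Longrightarrow> commutator z s \<in> K" and "g \<in> generate G S"
  shows "commutator z g \<in> K"
proof -
  have "S \<subseteq> {g \<in> carrier G. commutator z g \<in> K}" using assms by blast
  then show ?thesis
    using generate_subgroup_incl[OF _ group_hom.subgroup_preimage[OF commutator_hom_right[OF assms(1)] assms(3)]]
      assms(5) by blast
qed

lemma commutator_left_generate:
  assumes "z \<in> carrier G" "S \<subseteq> carrier G" "subgroup K G"
    and "\<And>s. s \<in> S \<Longrightarrow> commutator s z \<in> K" and "g \<in> generate G S"
  shows "commutator g z \<in> K"
proof -
  have "S \<subseteq> {g \<in> carrier G. commutator g z \<in> K}" using assms by blast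
  then show ?thesis
    using generate_subgroup_incl[OF _ group_hom.subgroup_preimage[OF commutator_hom_left[OF assms(1)] assms(3)]]
      assms(5) by blast
qed

lemma commutator_generate:
  assumes S: "S \<subseteq> carrier G" and K: "subgroup K G"
    and "\<And>s t. s \<in> S \<Longrightarrow> t \<in> S \<Longrightarrow> commutator s t \<in> K"
    and g: "g \<in> generate G S" and h: "h \<in> generate G S"
  shows "commutator g h \<in> K"
proof (rule commutator_right_generate[OF _ S K _ h])
  show "g \<in> carrier G" using generate_in_carrier[OF S g] .
  show "commutator g s \<in> K" if "s \<in> S" for s
    by (rule commutator_left_generate[OF _ S K _ g]) (use that assms in auto)
qed

lemma derived_commutators: "derived G H = generate G (\<Union>x\<in>H. \<Union>y\<in>H. {commutator x y})"
  by (simp add: derived_def commutator_def)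

lemma commutator_in_derived: "\<lbrakk>x \<in> H; y \<in> H\<rbrakk> \<Longrightarrow> commutator x y \<in> derived G H"
  unfolding derived_commutators by (blast intro: generate.incl)

lemma derived_subset:
  assumes "subgroup K G" "\<And>x y. x \<in> H \<Longrightarrow> y \<in> H \<Longrightarrow> commutator x y \<in> K"
  shows "derived G H \<subseteq> K"
  unfolding derived_commutators using assms by (intro generate_subgroup_incl) auto

text \<open>A bilinear alternating form on two generators has only powers of the one value
  \<open>commutator x y\<close>. This identifies each \<open>E i'\<close> as a cyclic group with a
  known generator.\<close>

lemma derived_generate_pair:
  assumes "x \<in> carrier G" "y \<in> carrier G"
  shows "derived G (generate G {x, y}) = generate G {commutator x y}"
proof
  have K: "subgroup (generate G {commutator x y}) G" using assms by (intro generate_is_subgroup) auto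
  show "derived G (generate G {x, y}) \<subseteq> generate G {commutator x y}"
  proof (rule derived_subset[OF K])
    fix g h assume gh: "g \<in> generate G {x, y}" "h \<in> generate G {x, y}"
    show "commutator g h \<in> generate G {commutator x y}"
    proof (rule commutator_generate[OF _ K _ gh])
      fix s t assume "s \<in> {x, y}" "t \<in> {x, y}"
      then show "commutator s t \<in> generate G {commutator x y}"
        using assms generate.incl[of "commutator x y" "{commutator x y}" G]
          generate.one[of G "{commutator x y}"] commutator_inv_swap[OF assms]
          subgroup.m_inv_closed[OF K] by auto
    qed (use assms in auto)
  qed
  have "generate G {x, y} \<subseteq> carrier G" using assms by (intro generate_incl) auto
  then show "generate G {commutator x y} \<subseteq> derived G (generate G {x, y})"
    by (intro generate_subgroup_incl[OF _ derived_is_subgroup])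
      (auto intro!: commutator_in_derived generate.incl)
qed

lemma class_two_subgroup:
  assumes "subgroup H G" shows "class_two_group (G\<lparr>carrier := H\<rparr>)"
proof -
  interpret H: group "G\<lparr>carrier := H\<rparr>" by (rule subgroup_imp_group[OF assms])
  have c: "H.commutator x y = commutator x y" if "x \<in> H" "y \<in> H" for x y
    using that assms by (simp add: H.commutator_def commutator_def m_inv_consistent)
  show ?thesis
  proof unfold_locales
    fix x y assume xy: "x \<in> carrier (G\<lparr>carrier := H\<rparr>)" "y \<in> carrier (G\<lparr>carrier := H\<rparr>)"
    then have xy': "x \<in> H" "y \<in> H" "x \<in> carrier G" "y \<in> carrier G"
      using subgroup.mem_carrier[OF assms] by auto
    have "H.commutator x y \<in> H"
      unfolding c[OF xy'(1,2)] commutator_def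
      by (simp add: xy' subgroup.m_closed[OF assms] subgroup.m_inv_closed[OF assms])
    then show "H.commutator x y \<in> centre (G\<lparr>carrier := H\<rparr>)"
      unfolding c[OF xy'(1,2)]
      by (intro H.centreI) (simp_all add: commutator_commute[OF xy'(3,4)] subgroup.mem_carrier[OF assms])
  qed
qed

lemma lower_central_two: "lower_central G 2 = {\<one>}"
proof -
  have "lower_central G 1 \<subseteq> centre G"
    unfolding One_nat_def lower_central.simps
    by (rule commutator_subgroup_incl[OF centre_subgroup])
      (use commutator_central in \<open>simp add: commutator_def\<close>)
  then have "lower_central G (Suc 1) \<subseteq> {\<one>}"
    unfolding lower_central.simps(2)[of _ 1]
    using centreD commutator_eq_one_iff
    by (intro commutator_subgroup_incl[OF triv_subgroup]) blast
  moreover have "\<one> \<in> lower_central G (Suc 1)"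
    using subgroup.one_closed[OF lower_central_subgroup] .
  ultimately show ?thesis by (auto simp: numeral_2_eq_2)
qed

lemma nilpotency_class_two:
  assumes "x \<in> carrier G" "y \<in> carrier G" "x \<otimes> y \<noteq> y \<otimes> x"
  shows "nilpotent G \<and> nilpotency_class G = 2"
proof
  show "nilpotent G" using lower_central_two by (auto simp: nilpotent_def)
  have nc: "commutator x y \<noteq> \<one>" using assms commutator_one_iff by simp
  have "commutator x y \<in> lower_central G 1"
    unfolding One_nat_def lower_central.simps commutator_def
    by (rule commutator_in_subgroup) (use assms in auto)
  then have 1: "lower_central G 1 \<noteq> {\<one>}" using nc by blast
  have 0: "lower_central G 0 \<noteq> {\<one>}" using nc assms by auto
  show "nilpotency_class G = 2"
    unfolding nilpotency_class_def
  proof (rule Least_equality)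
    show "lower_central G 2 = {\<one>}" by (rule lower_central_two)
    fix n assume n: "lower_central G n = {\<one>}"
    have "n \<noteq> 0" by (rule notI) (use n 0 in \<open>simp only:\<close>)
    moreover have "n \<noteq> 1" by (rule notI) (use n 1 in \<open>simp only:\<close>)
    ultimately show "2 \<le> n" by linarith
  qed
qed

end

lemma (in group) class_two_groupI:
  assumes "nilpotent G" "nilpotency_class G \<le> 2"
  shows "class_two_group G"
proof -
  have L: "lower_central G (nilpotency_class G) = {\<one>}"
    using assms(1) unfolding nilpotent_def nilpotency_class_def by (rule LeastI_ex)
  \<comment> \<open>The class may be smaller than 2; a trivial term keeps all later terms trivial,
    so the term with index 2 is trivial in every case.\<close>
  have "lower_central G (nilpotency_class G + k) = {\<one>}" for k
  proof (induction k)
    case (Suc k)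
    have "commutator_subgroup G {\<one>} (carrier G) \<subseteq> {\<one>}"
      by (rule commutator_subgroup_incl[OF triv_subgroup]) simp
    then have "lower_central G (nilpotency_class G + Suc k) \<subseteq> {\<one>}" using Suc by simp
    then show ?case using subgroup.one_closed[OF lower_central_subgroup] by blast
  qed (simp add: L)
  from this[of "2 - nilpotency_class G"] have L2: "lower_central G (Suc 1) = {\<one>}"
    using assms(2) by (simp add: numeral_2_eq_2)
  show ?thesis
  proof unfold_locales
    fix x y assume xy: "x \<in> carrier G" "y \<in> carrier G"
    have c: "commutator x y \<in> lower_central G 1"
      unfolding One_nat_def lower_central.simps commutator_def
      by (rule commutator_in_subgroup) (use xy in auto)
    have cc: "commutator x y \<in> carrier G" using xy by (simp add: commutator_def)
    show "commutator x y \<in> centre G"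
    proof (rule centreI[OF cc])
      fix z assume z: "z \<in> carrier G"
      have "commutator x y \<otimes> z \<otimes> inv (commutator x y) \<otimes> inv z \<in> lower_central G (Suc 1)"
        unfolding lower_central.simps(2)[of _ 1] by (rule commutator_in_subgroup[OF c z])
      then show "commutator x y \<otimes> z = z \<otimes> commutator x y"
        using L2 commutator_eq_one_iff[OF cc z] by blast
    qed
  qed
qed

section \<open>Symplectic generating systems\<close>

text \<open>All values of the form are powers of one element \<open>c\<close>, which lets the
  Euclidean algorithm act on their exponents.\<close>

locale class_two_cyclic = class_two_group +
  fixes c
  assumes fin: "finite (carrier G)"
    and c_closed: "c \<in> carrier G"
    and commutator_in_cyclic:
      "\<lbrakk>x \<in> carrier G; y \<in> carrier G\<rbrakk> \<Longrightarrow> commutator x y \<in> generate G {c}"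
begin

text \<open>The Euclidean algorithm on the exponents of the two commutators, carried out by
  Nielsen moves so that the generated subgroup does not change.\<close>
lemma euclid_commutator:
  assumes "g \<in> carrier G" "x \<in> carrier G" "z \<in> carrier G"
    and "commutator g x = c [^] (a::nat)" "commutator g z = c [^] (b::nat)"
  shows "\<exists>w\<in>carrier G. \<exists>w'\<in>carrier G.
    generate G {w, w'} = generate G {x, z} \<and> commutator g w' = \<one>"
  using assms(2-)
proof (induction a b arbitrary: x z rule: gcd_nat_induct)
  case (base m)
  then show ?case by (intro bexI[of _ x] bexI[of _ z]) auto
next
  case (step m n)
  let ?q = "m div n" and ?r = "m mod n"
  let ?y = "x \<otimes> z [^] (- int ?q)"
  have "commutator g ?y = c [^] (int m) \<otimes> (c [^] (int n)) [^] (- int ?q)"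
    using step.prems assms(1)
    by (simp only: commutator_mult_right commutator_int_pow_right int_pow_closed int_pow_int)
  also have "\<dots> = c [^] (int m + int n * (- int ?q))"
    using c_closed by (simp only: int_pow_pow int_pow_mult)
  also have "int m + int n * (- int ?q) = int ?r"
    by (simp add: zmod_int zdiv_int minus_mult_div_eq_mod[symmetric])
  finally have "commutator g ?y = c [^] ?r" by (simp add: int_pow_int)
  then obtain w w' where w: "w \<in> carrier G" "w' \<in> carrier G"
      "generate G {w, w'} = generate G {z, ?y}" "commutator g w' = \<one>"
    using step.IH[of z ?y] step.prems by auto
  have "generate G {z, ?y} = generate G {?y, z}" by (simp add: insert_commute)
  also have "\<dots> = generate G {x, z}"
    using generate_pair_step[of z x "- int ?q"] step.prems by (simp add: insert_commute)
  finally show ?case using w by metis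
qed

text \<open>A sweep from the end of the list: the entry that carries the commutator of the tail is
  merged with the entry in front of it by \<open>euclid_commutator\<close>. Pairing with
  \<open>g\<close> ends up concentrated in the leading entry.\<close>

lemma clear_commutators:
  assumes g: "g \<in> carrier G" and "set (y # ys) \<subseteq> carrier G"
  shows "\<exists>z zs. length zs = length ys \<and> set (z # zs) \<subseteq> carrier G \<and>
    generate G (set (z # zs)) = generate G (set (y # ys)) \<and> (\<forall>s\<in>set zs. commutator g s = \<one>)"
  using assms(2)
proof (induction ys arbitrary: y)
  case Nil
  then show ?case by (intro exI[of _ y] exI[of _ "[]"]) auto
next
  case (Cons y' ys)
  then obtain z zs where z: "length zs = length ys" "set (z # zs) \<subseteq> carrier G"
      "generate G (set (z # zs)) = generate G (set (y' # ys))" "\<forall>s\<in>set zs. commutator g s = \<one>"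
    by (meson set_subset_Cons subset_trans)
  have y: "y \<in> carrier G" and zc: "z \<in> carrier G" using Cons z by auto
  obtain a where a: "commutator g y = c [^] (a::nat)"
    using commutator_in_cyclic[OF g y] by (auto simp: generate_pow_on_finite_carrier[OF fin c_closed])
  obtain b where b: "commutator g z = c [^] (b::nat)"
    using commutator_in_cyclic[OF g zc] by (auto simp: generate_pow_on_finite_carrier[OF fin c_closed])
  obtain w w' where w: "w \<in> carrier G" "w' \<in> carrier G"
      "generate G {w, w'} = generate G {y, z}" "commutator g w' = \<one>"
    using euclid_commutator[OF g y zc a b] by blast
  have "generate G (set (w # w' # zs)) = generate G ({w, w'} \<union> set zs)" by simp
  also have "\<dots> = generate G ({y, z} \<union> set zs)"
    using w z y by (intro generate_Un_cong) auto
  also have "\<dots> = generate G (insert y (set (z # zs)))" by simp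
  also have "\<dots> = generate G (insert y (set (y' # ys)))"
    using z Cons.prems by (intro generate_insert_cong) auto
  finally have "generate G (set (w # w' # zs)) = generate G (set (y # y' # ys))" by simp
  then show ?case using w z by (intro exI[of _ w] exI[of _ "w' # zs"]) auto
qed

lemma generate_eq_of_ord_le:
  assumes "a \<in> carrier G" "b \<in> carrier G" "a \<in> generate G {b}" "ord b \<le> ord a"
  shows "generate G {b} = generate G {a}"
proof -
  have "generate G {a} \<subseteq> generate G {b}"
    using assms by (intro generate_subgroup_incl generate_is_subgroup) auto
  moreover have "finite (generate G {b})"
    using assms fin generate_incl[of "{b}"] finite_subset by auto
  ultimately show ?thesis
    using assms generate_pow_card by (metis card_seteq)
qed

text \<open>After clearing, all commutators of \<open>x\<close> with the span of \<open>y # rest\<close> are powers of the single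
  leading commutator of another generating tuple, which by maximality has no larger order.\<close>
lemma maximal_commutator:
  assumes max: "\<And>x' y' rest'. \<lbrakk>length rest' = n; set (x' # y' # rest') \<subseteq> carrier G;
      generate G (set (x' # y' # rest')) = H\<rbrakk> \<Longrightarrow> ord (commutator x' y') \<le> ord a"
    and a: "a \<in> carrier G"
    and l: "length rest = n" "set (x # y # rest) \<subseteq> carrier G" "generate G (set (x # y # rest)) = H"
    and v: "v \<in> generate G (set (y # rest))" "a = commutator x v"
    and u: "u \<in> generate G (set (y # rest))"
  shows "commutator x u \<in> generate G {a}"
proof -
  have x: "x \<in> carrier G" using l by simp
  obtain z zs where z: "length zs = length rest" "set (z # zs) \<subseteq> carrier G"
      "generate G (set (z # zs)) = generate G (set (y # rest))" "\<forall>s\<in>set zs. commutator x s = \<one>"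
    using clear_commutators[OF x, of y rest] l by auto
  have zc: "z \<in> carrier G" using z by simp
  let ?b = "commutator x z"
  have K: "subgroup (generate G {?b}) G" using x zc by (intro generate_is_subgroup) auto
  have in_b: "commutator x w \<in> generate G {?b}" if w: "w \<in> generate G (set (y # rest))" for w
  proof (rule commutator_right_generate[OF x z(2) K])
    show "commutator x s \<in> generate G {?b}" if "s \<in> set (z # zs)" for s
      using that z(4) generate.one[of G "{?b}"] generate.incl[of ?b "{?b}" G] by auto
    show "w \<in> generate G (set (z # zs))" using w z(3) by simp
  qed
  have "generate G (set (x # z # zs)) = generate G (insert x (set (z # zs)))" by simp
  also have "\<dots> = generate G (insert x (set (y # rest)))"
    using z l by (intro generate_insert_cong) auto
  finally have "generate G (set (x # z # zs)) = H" using l by simp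
  then have "ord ?b \<le> ord a" using max[of zs x z] z l by simp
  \<comment> \<open>\<open>a\<close> is itself a commutator with \<open>x\<close> and so lies in the
    group generated by \<open>?b\<close>; as \<open>?b\<close> has no larger order, both generate
    the same subgroup.\<close>
  then have "generate G {?b} = generate G {a}"
    using generate_eq_of_ord_le[OF a, of ?b] in_b[OF v(1)] v(2) x zc by simp
  then show ?thesis using in_b[OF u] by simp
qed

text \<open>Many Nielsen moves at once: \<open>s\<close> is recovered from its replacement because
  the correction \<open>h s\<close> is generated by the unchanged part \<open>T\<close>.\<close>

lemma generate_modify:
  assumes "S \<subseteq> carrier G" "T \<subseteq> carrier G" "\<And>s. s \<in> S \<Longrightarrow> h s \<in> generate G T"
  shows "generate G (T \<union> (\<lambda>s. s \<otimes> h s) ` S) = generate G (T \<union> S)"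
proof (rule generate_eqI)
  let ?L = "generate G (T \<union> (\<lambda>s. s \<otimes> h s) ` S)" and ?R = "generate G (T \<union> S)"
  have hc: "h s \<in> carrier G" if "s \<in> S" for s
    using generate_in_carrier[OF assms(2)] assms(3) that by blast
  show L: "T \<union> (\<lambda>s. s \<otimes> h s) ` S \<subseteq> carrier G" "T \<union> S \<subseteq> carrier G" using assms hc by auto
  have sL: "subgroup ?L G" and sR: "subgroup ?R G"
    using generate_is_subgroup[OF L(1)] generate_is_subgroup[OF L(2)] by simp_all
  have hL: "h s \<in> ?L" and hR: "h s \<in> ?R" if "s \<in> S" for s
    using mono_generate[of T "T \<union> (\<lambda>s. s \<otimes> h s) ` S"] mono_generate[of T "T \<union> S"] assms(3)[OF that]
    by blast+
  have "s \<otimes> h s \<in> ?R" if "s \<in> S" for s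
    by (rule subgroup.m_closed[OF sR _ hR[OF that]]) (simp add: generate.incl that)
  then show "T \<union> (\<lambda>s. s \<otimes> h s) ` S \<subseteq> ?R" by (auto intro: generate.incl)
  have "s \<in> ?L" if s: "s \<in> S" for s
  proof -
    have "s \<otimes> h s \<in> ?L" using s by (intro generate.incl) blast
    then have "(s \<otimes> h s) \<otimes> inv (h s) \<in> ?L"
      using subgroup.m_closed[OF sL] subgroup.m_inv_closed[OF sL hL[OF s]] by blast
    moreover have "(s \<otimes> h s) \<otimes> inv (h s) = s" using s hc assms(1) by (simp add: m_assoc subset_iff)
    ultimately show ?thesis by simp
  qed
  then show "T \<union> S \<subseteq> ?L" by (auto intro: generate.incl)
qed

text \<open>If \<open>commutator x y = a\<close> has the largest order that occurs over all
  generating tuples of this length, then \<open>x\<close> and \<open>y\<close> pair with every other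
  generator in powers of \<open>a\<close>. So the other generators can be projected onto the
  orthogonal complement of the hyperbolic plane spanned by \<open>x\<close> and
  \<open>y\<close>.\<close>

lemma split_hyperbolic_pair:
  assumes xs: "set xs \<subseteq> carrier G" "length xs = Suc (Suc n)"
  shows "\<exists>x y rest. length rest = n \<and> set (x # y # rest) \<subseteq> carrier G \<and>
    generate G (set (x # y # rest)) = generate G (set xs) \<and>
    (\<forall>r\<in>set rest. commutator x r = \<one> \<and> commutator y r = \<one>) \<and>
    (\<forall>r\<in>set rest. \<forall>s\<in>set rest. commutator r s \<in> generate G {commutator x y})"
proof -
  let ?H = "generate G (set xs)"
  define Q where "Q m \<longleftrightarrow> (\<exists>x y rest. length rest = n \<and> set (x # y # rest) \<subseteq> carrier G \<and>
    generate G (set (x # y # rest)) = ?H \<and> m = ord (commutator x y))" for m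
  obtain x0 y0 r0 where x0: "xs = x0 # y0 # r0" "length r0 = n" using xs(2) by (metis length_Suc_conv)
  have Q0: "Q (ord (commutator x0 y0))"
    unfolding Q_def using x0 xs(1) by (intro exI[of _ x0] exI[of _ y0] exI[of _ r0]) simp
  have Qb: "m \<le> order G" if "Q m" for m
    using that unfolding Q_def by (auto intro!: ord_le_group_order[OF fin])
  have "Q (Greatest Q)" by (rule GreatestI_nat[of Q, OF Q0 Qb])
  then obtain x y rest where len: "length rest = n" and car: "set (x # y # rest) \<subseteq> carrier G"
    and gen: "generate G (set (x # y # rest)) = ?H" and o: "Greatest Q = ord (commutator x y)"
    unfolding Q_def by blast
  have x: "x \<in> carrier G" and y: "y \<in> carrier G" and rc: "\<And>r. r \<in> set rest \<Longrightarrow> r \<in> carrier G"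
    using car by auto
  define a where "a = commutator x y"
  have a: "a \<in> carrier G" using x y by (simp add: a_def)
  have max: "ord (commutator x' y') \<le> ord a"
    if "length rest' = n" "set (x' # y' # rest') \<subseteq> carrier G" "generate G (set (x' # y' # rest')) = ?H"
    for x' y' rest'
  proof -
    have "Q (ord (commutator x' y'))" unfolding Q_def using that by blast
    then show ?thesis using Greatest_le_nat[of Q _ "order G"] Qb o unfolding a_def by metis
  qed
  have xr: "commutator x r \<in> generate G {a}" if "r \<in> set rest" for r
    by (rule maximal_commutator[OF max a len car gen, where v = y and u = r])
      (use that in \<open>auto simp: a_def intro: generate.incl\<close>)
  \<comment> \<open>\<open>maximal_commutator\<close> with the roles of \<open>x\<close> and
    \<open>y\<close> exchanged. \<open>commutator y x\<close> is the inverse of \<open>a\<close>, so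
    \<open>a\<close> itself is obtained as the commutator of \<open>y\<close> with
    \<open>inv x\<close>.\<close>
  have yr: "commutator y r \<in> generate G {a}" if r: "r \<in> set rest" for r
  proof (rule maximal_commutator[OF max a len, where x = y and y = x and v = "inv x" and u = r])
    show "set (y # x # rest) \<subseteq> carrier G" using car by simp
    show "generate G (set (y # x # rest)) = ?H" using gen by (simp add: insert_commute)
    show "inv x \<in> generate G (set (x # rest))" by (rule generate.inv) simp
    show "r \<in> generate G (set (x # rest))" using r by (intro generate.incl) simp
    have "commutator y (inv x) = inv (commutator y x)"
      by (rule group_hom.hom_inv[OF commutator_hom_right[OF y] x])
    then show "a = commutator y (inv x)"
      using commutator_inv_swap[OF x y] a by (simp add: a_def)
  qed
  have "\<forall>r\<in>set rest. \<exists>i j. commutator x r = a [^] (i::int) \<and> commutator y r = a [^] (j::int)"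
    using xr yr a by (auto simp: generate_pow)
  then obtain i j where i: "\<And>r. r \<in> set rest \<Longrightarrow> commutator x r = a [^] (i r :: int)"
      and j: "\<And>r. r \<in> set rest \<Longrightarrow> commutator y r = a [^] (j r :: int)" by metis
  \<comment> \<open>The power of \<open>y\<close> contributes \<open>a^(-i)\<close> to the
    commutator with \<open>x\<close>, and the power of \<open>x\<close> contributes
    \<open>a^(-j)\<close> to the commutator with \<open>y\<close>; each cancels the value found for
    \<open>r\<close>.\<close>
  define h where "h r = y [^] (- i r) \<otimes> x [^] (j r)" for r
  define f where "f r = r \<otimes> h r" for r
  have hc: "h r \<in> carrier G" for r using x y by (simp add: h_def)
  have fc: "f r \<in> carrier G" if "r \<in> set rest" for r using rc[OF that] hc by (simp add: f_def)
  have xf: "commutator x (f r) = \<one>" if r: "r \<in> set rest" for r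
  proof -
    have "commutator x (f r) = commutator x r \<otimes> (a [^] (- i r) \<otimes> commutator x x [^] (j r))"
      using x y rc[OF r] hc
      by (simp only: f_def h_def commutator_mult_right commutator_int_pow_right int_pow_closed
          m_closed a_def)
    also have "\<dots> = a [^] (i r + - i r)" using x a i[OF r] by (simp only: int_pow_mult commutator_self int_pow_one r_one int_pow_closed)
    finally show ?thesis by simp
  qed
  have yf: "commutator y (f r) = \<one>" if r: "r \<in> set rest" for r
  proof -
    have "commutator y (f r) = commutator y r \<otimes> (commutator y y [^] (- i r) \<otimes> commutator y x [^] (j r))"
      using x y rc[OF r] hc
      by (simp only: f_def h_def commutator_mult_right commutator_int_pow_right int_pow_closed m_closed)
    also have "\<dots> = a [^] (j r) \<otimes> inv a [^] (j r)"
      using y a j[OF r] commutator_inv_swap[OF x y] by (simp add: a_def)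
    also have "\<dots> = \<one>" using a by (simp add: int_pow_inv)
    finally show ?thesis .
  qed
  let ?rest = "map f rest"
  have len': "length ?rest = n" and car': "set (x # y # ?rest) \<subseteq> carrier G"
    using len x y fc by auto
  have hT: "h r \<in> generate G {x, y}" for r
  proof -
    have K: "subgroup (generate G {x, y}) G" using x y by (intro generate_is_subgroup) auto
    show ?thesis unfolding h_def
      by (intro subgroup.m_closed[OF K] subgroup_int_pow_closed[OF K]) (auto intro: generate.incl)
  qed
  have gen': "generate G (set (x # y # ?rest)) = ?H"
  proof -
    have "generate G (set (x # y # ?rest)) = generate G ({x, y} \<union> (\<lambda>r. r \<otimes> h r) ` set rest)"
      by (simp add: f_def)
    also have "\<dots> = generate G ({x, y} \<union> set rest)"
      using x y rc hT by (intro generate_modify) auto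
    finally show ?thesis using gen by simp
  qed
  \<comment> \<open>Maximality speaks about commutators with a member of the leading pair, so
    \<open>r\<close> is smuggled into it: by orthogonality, replacing \<open>x\<close> by
    \<open>x r\<close> keeps the commutator \<open>a\<close> with \<open>y\<close>, while the
    commutator with \<open>s\<close> becomes that of \<open>r\<close> and \<open>s\<close>.\<close>
  have rs: "commutator r s \<in> generate G {a}" if r: "r \<in> set ?rest" and s: "s \<in> set ?rest" for r s
  proof -
    have rc': "r \<in> carrier G" and sc': "s \<in> carrier G" using r s car' by auto
    have xr1: "commutator x s = \<one>" using s xf by auto
    have ry: "commutator r y = \<one>" using r yf commutator_inv_swap[OF y rc'] by auto
    have "commutator (x \<otimes> r) s \<in> generate G {a}"
    proof (rule maximal_commutator[OF max a len', where x = "x \<otimes> r" and y = y and v = y and u = s])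
      show "set (x \<otimes> r # y # ?rest) \<subseteq> carrier G" using car' rc' by simp
      have "generate G (set (x \<otimes> r # y # ?rest)) =
          generate G ((insert y (set ?rest)) \<union> (\<lambda>u. u \<otimes> r) ` {x})" by simp
      also have "\<dots> = generate G ((insert y (set ?rest)) \<union> {x})"
        by (rule generate_modify) (use car' r in \<open>auto intro: generate.incl\<close>)
      also have "\<dots> = ?H" using gen' by (simp add: insert_commute)
      finally show "generate G (set (x \<otimes> r # y # ?rest)) = ?H" .
      show "y \<in> generate G (set (y # ?rest))" "s \<in> generate G (set (y # ?rest))"
        by (rule generate.incl, use s in simp)+
      show "a = commutator (x \<otimes> r) y"
        using commutator_mult_left[OF x rc' y] ry a by (simp add: a_def)
    qed
    then show ?thesis using commutator_mult_left[OF x rc' sc'] xr1 rc' sc' by simp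
  qed
  show ?thesis
    using len' car' gen' xf yf rs unfolding a_def
    by (intro exI[of _ x] exI[of _ y] exI[of _ ?rest]) auto
qed

definition orthogonal :: "'a \<times> 'a \<Rightarrow> 'a \<times> 'a \<Rightarrow> bool" where
  "orthogonal p q \<longleftrightarrow> (\<forall>u\<in>{fst p, snd p}. \<forall>v\<in>{fst q, snd q}. commutator u v = \<one>)"

text \<open>Split off a hyperbolic pair and recurse on \<open>rest\<close>, whose commutators are
  powers of the commutator just split off; this yields the descending chain. The length equation
  records that no generator is gained or lost, which becomes the rank formula when \<open>xs\<close>
  is of minimal length.\<close>

lemma symplectic_generators:
  assumes "set xs \<subseteq> carrier G"
  shows "\<exists>ps as. 2 * length ps + length as = length xs \<and>
    fst ` set ps \<union> snd ` set ps \<union> set as \<subseteq> carrier G \<and>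
    generate G (fst ` set ps \<union> snd ` set ps \<union> set as) = generate G (set xs) \<and>
    (\<forall>a\<in>set as. \<forall>g\<in>generate G (set xs). commutator a g = \<one>) \<and>
    (\<forall>(x, y)\<in>set ps. commutator x y \<noteq> \<one>) \<and>
    sorted_wrt (\<lambda>p q. orthogonal p q \<and>
      commutator (fst q) (snd q) \<in> generate G {commutator (fst p) (snd p)}) ps"
  using assms
proof (induction "length xs" arbitrary: xs rule: less_induct)
  case less
  let ?H = "generate G (set xs)"
  show ?case
  proof (cases "\<forall>g\<in>set xs. \<forall>h\<in>set xs. commutator g h = \<one>")
    case True
    have "commutator a g \<in> {\<one>}" if "a \<in> set xs" "g \<in> ?H" for a g
      by (rule commutator_right_generate[OF _ less.prems triv_subgroup _ that(2)])
        (use that less.prems True in auto)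
    then show ?thesis using less.prems by (intro exI[of _ "[]"] exI[of _ xs]) auto
  next
    case False
    then obtain g h where gh: "g \<in> set xs" "h \<in> set xs" "commutator g h \<noteq> \<one>" by blast
    then have "g \<noteq> h" using less.prems by auto
    then have "card {g, h} \<le> length xs" using gh card_length[of xs] card_mono[of "set xs" "{g, h}"] by simp
    then have "2 \<le> length xs" using \<open>g \<noteq> h\<close> by simp
    then obtain n where n: "length xs = Suc (Suc n)" by (metis add_2_eq_Suc le_Suc_ex)
    obtain x y rest where xy: "length rest = n" "set (x # y # rest) \<subseteq> carrier G"
        "generate G (set (x # y # rest)) = ?H"
        "\<forall>r\<in>set rest. commutator x r = \<one> \<and> commutator y r = \<one>"
        "\<forall>r\<in>set rest. \<forall>s\<in>set rest. commutator r s \<in> generate G {commutator x y}"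
      using split_hyperbolic_pair[OF less.prems n] by blast
    have x: "x \<in> carrier G" and y: "y \<in> carrier G" and rest: "set rest \<subseteq> carrier G" using xy by auto
    let ?a = "commutator x y" and ?R = "generate G (set rest)"
    have K: "subgroup (generate G {?a}) G" using x y by (intro generate_is_subgroup) auto
    obtain ps as where IH: "2 * length ps + length as = length rest"
        "fst ` set ps \<union> snd ` set ps \<union> set as \<subseteq> carrier G"
        "generate G (fst ` set ps \<union> snd ` set ps \<union> set as) = ?R"
        "\<forall>a\<in>set as. \<forall>g\<in>?R. commutator a g = \<one>"
        "\<forall>(x, y)\<in>set ps. commutator x y \<noteq> \<one>"
        "sorted_wrt (\<lambda>p q. orthogonal p q \<and>
          commutator (fst q) (snd q) \<in> generate G {commutator (fst p) (snd p)}) ps"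
      using less.hyps[of rest] rest xy n by auto
    let ?S = "fst ` set ps \<union> snd ` set ps \<union> set as"
    have SR: "?S \<subseteq> ?R" unfolding IH(3)[symmetric] by (blast intro: generate.incl)
    have xR: "commutator x g = \<one>" and yR: "commutator y g = \<one>" if "g \<in> ?R" for g
      using commutator_right_generate[OF x rest triv_subgroup _ that]
        commutator_right_generate[OF y rest triv_subgroup _ that] xy(4) by auto
    have RR: "commutator g h \<in> generate G {?a}" if "g \<in> ?R" "h \<in> ?R" for g h
      by (rule commutator_generate[OF rest K _ that]) (use xy(5) in blast)
    have gen: "generate G (fst ` set ((x, y) # ps) \<union> snd ` set ((x, y) # ps) \<union> set as) = ?H"
    proof -
      have "generate G (?S \<union> {x, y}) = generate G (set rest \<union> {x, y})"
        using IH rest x y by (intro generate_Un_cong) auto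
      moreover have "?S \<union> {x, y} = fst ` set ((x, y) # ps) \<union> snd ` set ((x, y) # ps) \<union> set as"
        "set rest \<union> {x, y} = set (x # y # rest)" by auto
      ultimately show ?thesis using xy(3) by simp
    qed
    \<comment> \<open>If the commutator of the pair were trivial, all commutators of the generators,
      and with them that of \<open>g\<close> and \<open>h\<close>, would be trivial.\<close>
    have a1: "?a \<noteq> \<one>"
    proof
      assume 1: "?a = \<one>"
      have comm1: "commutator s t \<in> {\<one>}" if st: "s \<in> insert x (insert y ?R)" "t \<in> insert x (insert y ?R)" for s t
      proof -
        have Rc: "r \<in> carrier G" if "r \<in> ?R" for r using generate_in_carrier[OF rest that] .
        have "commutator r x = \<one>" "commutator r y = \<one>" if "r \<in> ?R" for r
          using commutator_inv_swap[OF x Rc[OF that]] commutator_inv_swap[OF y Rc[OF that]]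
            xR[OF that] yR[OF that] by simp_all
        moreover have "commutator y x = \<one>" using commutator_inv_swap[OF x y] 1 by simp
        moreover have "commutator r s = \<one>" if "r \<in> ?R" "s \<in> ?R" for r s
          using RR[OF that] 1 generate_subgroup_self[OF triv_subgroup] by simp
        ultimately show ?thesis using st xR yR 1 x y by auto
      qed
      have "commutator g h \<in> {\<one>}"
      proof (rule commutator_generate[OF xy(2) triv_subgroup])
        show "g \<in> generate G (set (x # y # rest))" "h \<in> generate G (set (x # y # rest))"
          unfolding xy(3) using gh by (auto intro: generate.incl)
        show "commutator s t \<in> {\<one>}" if "s \<in> set (x # y # rest)" "t \<in> set (x # y # rest)" for s t
          by (rule comm1) (use that in \<open>auto intro: generate.incl\<close>)
      qed
      then show False using gh by simp
    qed
    have as: "commutator a g = \<one>" if a: "a \<in> set as" and g: "g \<in> ?H" for a g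
    proof -
      have aR: "a \<in> ?R" using a SR by blast
      have ac: "a \<in> carrier G" using generate_in_carrier[OF rest aR] .
      have "commutator a g \<in> {\<one>}"
      proof (rule commutator_right_generate[OF ac xy(2) triv_subgroup])
        show "commutator a s \<in> {\<one>}" if s: "s \<in> set (x # y # rest)" for s
        proof -
          have "commutator a r = \<one>" if "r \<in> set rest" for r
            using IH(4) a that by (blast intro: generate.incl)
          then show ?thesis
            using s commutator_inv_swap[OF x ac] commutator_inv_swap[OF y ac] xR[OF aR] yR[OF aR] by auto
        qed
        show "g \<in> generate G (set (x # y # rest))" using g xy(3) by simp
      qed
      then show ?thesis by simp
    qed
    have "orthogonal (x, y) q \<and> commutator (fst q) (snd q) \<in> generate G {?a}" if q: "q \<in> set ps" for q
    proof -
      have "fst q \<in> ?R" "snd q \<in> ?R" using q SR by blast+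
      then show ?thesis using xR yR RR by (simp add: orthogonal_def)
    qed
    then have "sorted_wrt (\<lambda>p q. orthogonal p q \<and>
        commutator (fst q) (snd q) \<in> generate G {commutator (fst p) (snd p)}) ((x, y) # ps)"
      using IH(6) by simp
    moreover have "fst ` set ((x, y) # ps) \<union> snd ` set ((x, y) # ps) \<union> set as \<subseteq> carrier G"
      using IH(2) x y by auto
    moreover have "2 * length ((x, y) # ps) + length as = length xs" using IH(1) xy(1) n by simp
    moreover have "\<forall>(x, y)\<in>set ((x, y) # ps). commutator x y \<noteq> \<one>" using IH(5) a1 by simp
    ultimately show ?thesis using gen as by blast
  qed
qed

end

section \<open>The quotient by the centre\<close>

lemma product_group_nat_pow:
  assumes "i \<in> I"
  shows "(f [^]\<^bsub>product_group I H\<^esub> (k::nat)) i = f i [^]\<^bsub>H i\<^esub> k"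
  by (induction k) (use assms in auto)

lemma DirProd_nat_pow:
  "w [^]\<^bsub>H \<times>\<times> K\<^esub> (k::nat) = (fst w [^]\<^bsub>H\<^esub> k, snd w [^]\<^bsub>K\<^esub> k)"
  by (induction k) (auto simp: mult_DirProd')

lemma subgroup_restrict_nat_pow: "u [^]\<^bsub>G\<lparr>carrier := H\<rparr>\<^esub> (k::nat) = u [^]\<^bsub>G\<^esub> k"
  by (simp add: nat_pow_def)

lemma iso_card_torsion:
  assumes "h \<in> iso G H" "group G" "group H"
  shows "card {x \<in> carrier G. x [^]\<^bsub>G\<^esub> (k::nat) = \<one>\<^bsub>G\<^esub>} =
    card {x \<in> carrier H. x [^]\<^bsub>H\<^esub> k = \<one>\<^bsub>H\<^esub>}"
proof (rule bij_betw_same_card)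
  have hh: "h \<in> hom G H" and b: "bij_betw h (carrier G) (carrier H)"
    using assms(1) by (auto simp: iso_def)
  interpret h: group_hom G H h using assms hh by (simp add: group_hom_def group_hom_axioms_def)
  have inj: "inj_on h (carrier G)" and im: "h ` carrier G = carrier H"
    using b by (auto simp: bij_betw_def)
  have iff: "h x [^]\<^bsub>H\<^esub> k = \<one>\<^bsub>H\<^esub> \<longleftrightarrow> x [^]\<^bsub>G\<^esub> k = \<one>\<^bsub>G\<^esub>" if "x \<in> carrier G" for x
    using inj_onD[OF inj, of "x [^]\<^bsub>G\<^esub> k" "\<one>\<^bsub>G\<^esub>"] that h.hom_nat_pow[OF that, of k] by auto
  show "bij_betw h {x \<in> carrier G. x [^]\<^bsub>G\<^esub> k = \<one>\<^bsub>G\<^esub>} {x \<in> carrier H. x [^]\<^bsub>H\<^esub> k = \<one>\<^bsub>H\<^esub>}"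
    unfolding bij_betw_def
  proof
    show "inj_on h {x \<in> carrier G. x [^]\<^bsub>G\<^esub> k = \<one>\<^bsub>G\<^esub>}" using inj by (rule inj_on_subset) auto
    show "h ` {x \<in> carrier G. x [^]\<^bsub>G\<^esub> k = \<one>\<^bsub>G\<^esub>} = {x \<in> carrier H. x [^]\<^bsub>H\<^esub> k = \<one>\<^bsub>H\<^esub>}"
      unfolding im[symmetric] using iff by auto
  qed
qed

lemma (in class_two_group) commutator_centre:
  assumes "z \<in> centre G" "w \<in> carrier G"
  shows "commutator z w = \<one>" "commutator w z = \<one>"
proof -
  have z: "z \<in> carrier G" and c: "z \<otimes> w = w \<otimes> z" using centreD[OF assms(1)] assms(2) by blast+
  show "commutator z w = \<one>" unfolding commutator_one_iff[OF z assms(2)] by (rule c)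
  show "commutator w z = \<one>" unfolding commutator_one_iff[OF assms(2) z] by (rule c[symmetric])
qed

text \<open>Common setting for both halves of (2): the system constructed for existence, and
  generating pairs of the \<open>E i\<close> of an arbitrary decomposition. \<open>A\<close> is a
  mere subset, namely the list of leftover generators in the first case and the subgroup in the
  second.\<close>

locale symplectic_system = class_two_group +
  fixes t :: nat and A and x y :: "nat \<Rightarrow> 'a"
  assumes fin: "finite (carrier G)"
    and x_closed: "i \<in> {1..t} \<Longrightarrow> x i \<in> carrier G"
    and y_closed: "i \<in> {1..t} \<Longrightarrow> y i \<in> carrier G"
    and central: "A \<subseteq> centre G"
    and generating: "generate G (A \<union> (\<Union>i\<in>{1..t}. {x i, y i})) = carrier G"
    and orthogonal: "\<lbrakk>i \<in> {1..t}; j \<in> {1..t}; i \<noteq> j; u \<in> {x i, y i}; v \<in> {x j, y j}\<rbrakk> \<Longrightarrow>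
      commutator u v = \<one>"
begin

text \<open>This is \<open>E i'\<close>, by \<open>derived_generate_pair\<close>.\<close>

definition D :: "nat \<Rightarrow> 'a set" where "D i = generate G {commutator (x i) (y i)}"

abbreviation gens :: "'a set" where "gens \<equiv> A \<union> (\<Union>i\<in>{1..t}. {x i, y i})"

lemma gens_closed: "gens \<subseteq> carrier G"
  using x_closed y_closed central centreD(1) by blast

lemma D_subgroup: "i \<in> {1..t} \<Longrightarrow> subgroup (D i) G"
  unfolding D_def using x_closed y_closed by (intro generate_is_subgroup) auto

text \<open>Among the generators only \<open>x i\<close> and \<open>y i\<close> can have nontrivial
  commutators with this pair. Hence the commutator map really takes values in
  \<open>P\<close>.\<close>

lemma commutator_in_D:
  assumes i: "i \<in> {1..t}" and g: "g \<in> carrier G"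
  shows "commutator g (x i) \<in> D i" "commutator g (y i) \<in> D i"
proof -
  note xy = x_closed[OF i] y_closed[OF i]
  have z: "commutator (x i) (y i) \<in> D i" unfolding D_def by (simp add: generate.incl)
  then have z': "commutator (y i) (x i) \<in> D i"
    unfolding commutator_inv_swap[OF xy] by (rule subgroup.m_inv_closed[OF D_subgroup[OF i]])
  have one: "\<one> \<in> D i" by (rule subgroup.one_closed[OF D_subgroup[OF i]])
  have "commutator s v \<in> D i" if s: "s \<in> gens" and v: "v \<in> {x i, y i}" for s v
  proof (cases "s \<in> A")
    case True
    then have "s \<in> centre G" using central by blast
    then have "commutator s v = \<one>" using v xy commutator_centre(1) by auto
    then show ?thesis using one by simp
  next
    case False
    then obtain j where j: "j \<in> {1..t}" "s \<in> {x j, y j}" using s by blast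
    show ?thesis
    proof (cases "j = i")
      case True
      then show ?thesis using j v z z' one xy by auto
    next
      case False
      then show ?thesis using orthogonal[OF j(1) i False j(2) v] one by simp
    qed
  qed
  then show "commutator g (x i) \<in> D i" "commutator g (y i) \<in> D i"
    using commutator_left_generate[OF _ gens_closed D_subgroup[OF i], of _ g] xy g
    unfolding generating by blast+
qed

lemma centre_iff:
  assumes g: "g \<in> carrier G"
  shows "g \<in> centre G \<longleftrightarrow> (\<forall>i\<in>{1..t}. commutator g (x i) = \<one> \<and> commutator g (y i) = \<one>)"
proof
  assume "g \<in> centre G"
  then show "\<forall>i\<in>{1..t}. commutator g (x i) = \<one> \<and> commutator g (y i) = \<one>"
    using commutator_centre(1) x_closed y_closed by blast
next
  assume R: "\<forall>i\<in>{1..t}. commutator g (x i) = \<one> \<and> commutator g (y i) = \<one>"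
  have gs: "commutator g s = \<one>" if s: "s \<in> gens" for s
  proof (cases "s \<in> A")
    case True
    then have "s \<in> centre G" using central by blast
    then show ?thesis using commutator_centre(2) g by blast
  next
    case False
    then show ?thesis using s R by blast
  qed
  have "commutator g h \<in> {\<one>}" if h: "h \<in> carrier G" for h
    by (rule commutator_right_generate[OF g gens_closed triv_subgroup])
      (use gs h generating in auto)
  then show "g \<in> centre G" using commutator_one_iff[OF g] by (intro centreI[OF g]) blast
qed

abbreviation P :: "(nat \<Rightarrow> 'a \<times> 'a) monoid" where
  "P \<equiv> product_group {1..t} (\<lambda>i. G\<lparr>carrier := D i\<rparr> \<times>\<times> G\<lparr>carrier := D i\<rparr>)"

lemma factor_group: "i \<in> {1..t} \<Longrightarrow> group (G\<lparr>carrier := D i\<rparr> \<times>\<times> G\<lparr>carrier := D i\<rparr>)"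
  by (intro DirProd_group subgroup_imp_group D_subgroup)

lemma P_group: "group P"
  by (rule product_group) (rule factor_group)

text \<open>Surjectivity onto \<open>P\<close>, one index at a time: multiplying by a product of
  powers of \<open>x i\<close> and \<open>y i\<close> adjusts the two commutators of index
  \<open>i\<close> and, by orthogonality, no others.\<close>

lemma prescribed_commutators:
  assumes u: "\<And>i. i \<in> {1..t} \<Longrightarrow> u i \<in> D i" and v: "\<And>i. i \<in> {1..t} \<Longrightarrow> v i \<in> D i"
  shows "\<exists>g\<in>carrier G. \<forall>i\<in>{1..t}. commutator g (x i) = u i \<and> commutator g (y i) = v i"
proof -
  have "\<exists>g\<in>carrier G. \<forall>i\<in>{1..t}. commutator g (x i) = (if i \<le> k then u i else \<one>) \<and>
      commutator g (y i) = (if i \<le> k then v i else \<one>)" if "k \<le> t" for k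
    using that
  proof (induction k)
    case 0
    have "commutator \<one> w = \<one>" if "w \<in> carrier G" for w
      using that by (simp add: commutator_one_iff)
    then show ?case using x_closed y_closed by (intro bexI[of _ \<one>]) auto
  next
    case (Suc k)
    then obtain g where g: "g \<in> carrier G"
      "\<And>i. i \<in> {1..t} \<Longrightarrow> commutator g (x i) = (if i \<le> k then u i else \<one>)"
      "\<And>i. i \<in> {1..t} \<Longrightarrow> commutator g (y i) = (if i \<le> k then v i else \<one>)" by auto
    let ?i = "Suc k"
    have i: "?i \<in> {1..t}" using Suc by simp
    note xy = x_closed[OF i] y_closed[OF i]
    let ?z = "commutator (x ?i) (y ?i)"
    have z: "?z \<in> carrier G" using xy by simp
    obtain r s where rs: "u ?i = ?z [^] (r::int)" "v ?i = ?z [^] (s::int)"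
      using u[OF i] v[OF i] z unfolding D_def generate_pow[OF z] by blast
    \<comment> \<open>With \<open>?z\<close> the commutator of the pair, \<open>y^(-r)\<close> has
      commutator \<open>?z^r\<close> with \<open>x ?i\<close>, and \<open>x^s\<close> has commutator
      \<open>?z^s\<close> with \<open>y ?i\<close>; each factor commutes with its own base.\<close>
    define e where "e = x ?i [^] s \<otimes> y ?i [^] (- r)"
    have e: "e \<in> carrier G" using xy by (simp add: e_def)
    have ew: "commutator e w = commutator (x ?i) w [^] s \<otimes> commutator (y ?i) w [^] (- r)"
      if "w \<in> carrier G" for w
      using that xy unfolding e_def
      by (simp only: commutator_mult_left commutator_int_pow_left int_pow_closed)
    have ex: "commutator e (x ?i) = u ?i"
      using ew[OF xy(1)] xy z unfolding rs commutator_inv_swap[OF xy]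
      by (simp add: int_pow_inv int_pow_neg)
    have ey: "commutator e (y ?i) = v ?i"
      using ew[OF xy(2)] xy z unfolding rs by simp
    have ej: "commutator e w = \<one>" if j: "j \<in> {1..t}" "j \<noteq> ?i" and w: "w \<in> {x j, y j}" for j w
    proof -
      have wc: "w \<in> carrier G" using w x_closed[OF j(1)] y_closed[OF j(1)] by auto
      show ?thesis
        using ew[OF wc] orthogonal[OF i j(1) _ _ w] j(2) by simp
    qed
    have ge: "commutator (g \<otimes> e) w = commutator g w \<otimes> commutator e w" if "w \<in> carrier G" for w
      by (rule commutator_mult_left[OF g(1) e that])
    have uc: "u j \<in> carrier G" "v j \<in> carrier G" if "j \<in> {1..t}" for j
      by (rule subgroup.mem_carrier[OF D_subgroup[OF that] u[OF that]],
          rule subgroup.mem_carrier[OF D_subgroup[OF that] v[OF that]])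
    have "commutator (g \<otimes> e) (x j) = (if j \<le> Suc k then u j else \<one>) \<and>
        commutator (g \<otimes> e) (y j) = (if j \<le> Suc k then v j else \<one>)" if j: "j \<in> {1..t}" for j
    proof (cases "j = ?i")
      case True
      then show ?thesis
        using ge[OF xy(1)] ge[OF xy(2)] g(2,3)[OF i] ex ey uc[OF i] by simp
    next
      case False
      then show ?thesis
        using ge[OF x_closed[OF j]] ge[OF y_closed[OF j]] g(2,3)[OF j] ej[OF j False] uc[OF j]
        by (auto simp: le_Suc_eq)
    qed
    then show ?case using g(1) e by blast
  qed
  from this[of t] obtain g where "g \<in> carrier G"
    "\<forall>i\<in>{1..t}. commutator g (x i) = (if i \<le> t then u i else \<one>) \<and>
      commutator g (y i) = (if i \<le> t then v i else \<one>)" by blast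
  then show ?thesis by (intro bexI[of _ g]) auto
qed

lemma quotient_iso: "G Mod centre G \<cong> P"
proof -
  let ?f = "\<lambda>g. \<lambda>i\<in>{1..t}. (commutator g (x i), commutator g (y i))"
  interpret P: group P by (rule P_group)
  interpret f: group_hom G P ?f
  proof unfold_locales
    show "?f \<in> hom G P"
    proof (rule homI)
      fix g h assume g: "g \<in> carrier G" and h: "h \<in> carrier G"
      show "?f g \<in> carrier P" using commutator_in_D[OF _ g] by simp
      show "?f (g \<otimes> h) = ?f g \<otimes>\<^bsub>P\<^esub> ?f h"
        using commutator_mult_left[OF g h] x_closed y_closed by (auto simp: fun_eq_iff)
    qed
  qed
  have "kernel G P ?f = centre G"
  proof -
    have "?f g = \<one>\<^bsub>P\<^esub> \<longleftrightarrow> g \<in> centre G" if "g \<in> carrier G" for g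
      unfolding centre_iff[OF that] by (auto simp: fun_eq_iff)
    then show ?thesis using centreD(1) unfolding kernel_def by blast
  qed
  moreover have "?f ` carrier G = carrier P"
  proof
    show "?f ` carrier G \<subseteq> carrier P" using f.hom_closed by blast
    show "carrier P \<subseteq> ?f ` carrier G"
    proof
      fix w assume w: "w \<in> carrier P"
      have wi: "fst (w i) \<in> D i" "snd (w i) \<in> D i" if "i \<in> {1..t}" for i
        using w that by (auto simp: PiE_iff mem_Times_iff)
      obtain g where g: "g \<in> carrier G"
        "\<forall>i\<in>{1..t}. commutator g (x i) = fst (w i) \<and> commutator g (y i) = snd (w i)"
        using prescribed_commutators[of "\<lambda>i. fst (w i)" "\<lambda>i. snd (w i)"] wi by blast
      have "w = ?f g"
      proof
        fix i show "w i = ?f g i"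
          using g(2) w by (cases "i \<in> {1..t}") (auto simp: PiE_iff extensional_def)
      qed
      then show "w \<in> ?f ` carrier G" using g(1) by blast
    qed
  qed
  ultimately show ?thesis using f.FactGroup_iso by metis
qed

lemma quotient_comm_group: "comm_group (G Mod centre G)"
proof -
  have N: "centre G \<lhd> G" by (rule central_subgroup_normal[OF centre_subgroup order_refl])
  interpret N: normal "centre G" G by (rule N)
  let ?V = "G Mod centre G"
  interpret V: group ?V by (rule N.factorgroup_is_group)
  interpret pi: group_hom G ?V "\<lambda>g. centre G #> g"
    using N.r_coset_hom_Mod by unfold_locales
  show ?thesis
  proof (rule V.group_comm_groupI)
    fix u v assume "u \<in> carrier ?V" "v \<in> carrier ?V"
    then obtain g h where g: "g \<in> carrier G" "u = centre G #> g" and h: "h \<in> carrier G" "v = centre G #> h"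
      unfolding carrier_FactGroup by blast
    let ?c = "commutator g h"
    have c: "?c \<in> carrier G" using g h by simp
    have "centre G #> ?c = \<one>\<^bsub>?V\<^esub>"
      using commutator_central[OF g(1) h(1)] c by (simp add: coset_join2 N.subgroup_axioms)
    then have "centre G #> (?c \<otimes> (h \<otimes> g)) = centre G #> (h \<otimes> g)"
      unfolding pi.hom_mult[OF c m_closed[OF h(1) g(1)]]
      using V.l_one[OF pi.hom_closed[OF m_closed[OF h(1) g(1)]]] by (simp only:)
    then have "centre G #> (g \<otimes> h) = centre G #> (h \<otimes> g)"
      using commutator_swap[OF g(1) h(1)] by simp
    then show "u \<otimes>\<^bsub>?V\<^esub> v = v \<otimes>\<^bsub>?V\<^esub> u"
      unfolding g(2) h(2) pi.hom_mult[OF g(1) h(1)] pi.hom_mult[OF h(1) g(1)] .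
  qed
qed

lemma finite_quotient: "finite (carrier (G Mod centre G))"
  using fin by (simp add: carrier_FactGroup)

text \<open>Torsion in \<open>P\<close> is counted componentwise; the square comes from the two
  copies of \<open>D i\<close>.\<close>

lemma card_quotient_torsion:
  "card {v \<in> carrier (G Mod centre G). v [^]\<^bsub>G Mod centre G\<^esub> (k::nat) = \<one>\<^bsub>G Mod centre G\<^esub>} =
    (\<Prod>i=1..t. (card {u \<in> D i. u [^] k = \<one>})\<^sup>2)"
proof -
  obtain h where h: "h \<in> iso (G Mod centre G) P" using quotient_iso by (auto simp: is_iso_def)
  interpret V: comm_group "G Mod centre G" by (rule quotient_comm_group)
  have "{w \<in> carrier P. w [^]\<^bsub>P\<^esub> k = \<one>\<^bsub>P\<^esub>} =
      (\<Pi>\<^sub>E i\<in>{1..t}. {u \<in> D i. u [^] k = \<one>} \<times> {u \<in> D i. u [^] k = \<one>})" (is "?L = ?R")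
  proof -
    interpret P: group P by (rule P_group)
    have "w [^]\<^bsub>P\<^esub> k = \<one>\<^bsub>P\<^esub> \<longleftrightarrow>
      (\<forall>i\<in>{1..t}. fst (w i) [^] k = \<one> \<and> snd (w i) [^] k = \<one>)" if w: "w \<in> carrier P" for w
    proof -
      have wk: "w [^]\<^bsub>P\<^esub> k \<in> carrier P" using w by (rule P.nat_pow_closed)
      have i: "(w [^]\<^bsub>P\<^esub> k) i = (fst (w i) [^] k, snd (w i) [^] k)" if "i \<in> {1..t}" for i
        unfolding product_group_nat_pow[OF that] DirProd_nat_pow subgroup_restrict_nat_pow ..
      show ?thesis
      proof
        assume 1: "w [^]\<^bsub>P\<^esub> k = \<one>\<^bsub>P\<^esub>"
        show "\<forall>i\<in>{1..t}. fst (w i) [^] k = \<one> \<and> snd (w i) [^] k = \<one>"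
        proof
          fix j assume j: "j \<in> {1..t}"
          show "fst (w j) [^] k = \<one> \<and> snd (w j) [^] k = \<one>"
            using fun_cong[OF 1, of j] j unfolding i[OF j] by simp
        qed
      next
        assume R: "\<forall>i\<in>{1..t}. fst (w i) [^] k = \<one> \<and> snd (w i) [^] k = \<one>"
        show "w [^]\<^bsub>P\<^esub> k = \<one>\<^bsub>P\<^esub>"
        proof
          fix j show "(w [^]\<^bsub>P\<^esub> k) j = \<one>\<^bsub>P\<^esub> j"
          proof (cases "j \<in> {1..t}")
            case True
            then show ?thesis using i[OF True] R by simp
          next
            case False
            then show ?thesis using PiE_arb[OF wk[unfolded carrier_product_group] False] by auto
          qed
        qed
      qed
    qed
    then have "?L = {w \<in> carrier P. \<forall>i\<in>{1..t}. fst (w i) [^] k = \<one> \<and> snd (w i) [^] k = \<one>}"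
      by blast
    also have "\<dots> = ?R"
      unfolding carrier_product_group carrier_DirProd by (auto simp: PiE_iff mem_Times_iff extensional_def)
    finally show ?thesis .
  qed
  then have "card {w \<in> carrier P. w [^]\<^bsub>P\<^esub> k = \<one>\<^bsub>P\<^esub>} = card ?R" by simp
  also have "\<dots> = (\<Prod>i=1..t. (card {u \<in> D i. u [^] k = \<one>})\<^sup>2)"
    by (simp add: card_PiE card_cartesian_product power2_eq_square)
  finally show ?thesis using iso_card_torsion[OF h V.is_group P_group, of k] by simp
qed

lemma min_gens_quotient_le: "min_gens (G Mod centre G) \<le> 2 * t"
proof -
  interpret N: normal "centre G" G by (rule central_subgroup_normal[OF centre_subgroup order_refl])
  let ?V = "G Mod centre G"
  interpret V: group ?V by (rule N.factorgroup_is_group)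
  interpret pi: group_hom G ?V "\<lambda>g. centre G #> g"
    using N.r_coset_hom_Mod by unfold_locales
  let ?T = "\<Union>i\<in>{1..t}. {x i, y i}"
  let ?S = "(\<lambda>g. centre G #> g) ` ?T"
  have T: "?T \<subseteq> carrier G" using gens_closed by blast
  have SV: "?S \<subseteq> carrier ?V" using T pi.hom_closed by blast
  have K: "subgroup (generate ?V ?S) ?V" by (rule V.generate_is_subgroup[OF SV])
  have "gens \<subseteq> {g \<in> carrier G. centre G #> g \<in> generate ?V ?S}"
  proof
    fix s assume s: "s \<in> gens"
    have sc: "s \<in> carrier G" using s gens_closed by blast
    have "centre G #> s \<in> generate ?V ?S"
    proof (cases "s \<in> A")
      case True
      then have "centre G #> s = \<one>\<^bsub>?V\<^esub>"
        using central sc by (auto simp: coset_join2 N.subgroup_axioms)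
      then show ?thesis using generate.one by metis
    next
      case False
      then have "s \<in> ?T" using s by blast
      then show ?thesis by (intro generate.incl imageI)
    qed
    then show "s \<in> {g \<in> carrier G. centre G #> g \<in> generate ?V ?S}" using sc by blast
  qed
  then have "generate G gens \<subseteq> {g \<in> carrier G. centre G #> g \<in> generate ?V ?S}"
    by (rule generate_subgroup_incl[OF _ pi.subgroup_preimage[OF K]])
  then have "carrier G \<subseteq> {g \<in> carrier G. centre G #> g \<in> generate ?V ?S}"
    unfolding generating .
  then have "carrier ?V \<subseteq> generate ?V ?S" unfolding carrier_FactGroup by blast
  then have "generate ?V ?S = carrier ?V" using subgroup.subset[OF K] by blast
  then have "min_gens ?V \<le> card ?S" using SV by (intro min_gens_le) auto
  also have "\<dots> \<le> card ?T" by (rule card_image_le) simp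
  also have "\<dots> \<le> (\<Sum>i\<in>{1..t}. card {x i, y i})" by (rule card_UN_le) simp
  also have "\<dots> \<le> (\<Sum>i\<in>{1..t}. 2)" by (rule sum_mono) (simp add: card_insert_if)
  finally show ?thesis by simp
qed

text \<open>Take \<open>k = card (D t)\<close>. Every \<open>D i\<close> contains
  \<open>D t\<close>, hence at least \<open>k\<close> elements annihilated by \<open>k\<close>, and
  the quotient has at least \<open>k ^ (2 * t)\<close> of them, whereas \<open>d\<close> generators
  allow at most \<open>k ^ d\<close>.\<close>

lemma min_gens_quotient:
  assumes chain: "\<And>i j. i \<in> {1..t} \<Longrightarrow> j \<in> {i..t} \<Longrightarrow> D j \<subseteq> D i"
    and nontriv: "t > 0 \<Longrightarrow> D t \<noteq> {\<one>}"
  shows "min_gens (G Mod centre G) = 2 * t"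
proof (cases "t = 0")
  case True
  then show ?thesis using min_gens_quotient_le by simp
next
  case False
  let ?V = "G Mod centre G"
  interpret V: comm_group ?V by (rule quotient_comm_group)
  have tt: "t \<in> {1..t}" using False by simp
  have Dfin: "finite (D i)" if "i \<in> {1..t}" for i
    using fin subgroup.subset[OF D_subgroup[OF that]] finite_subset by blast
  define k where "k = card (D t)"
  have one: "\<one> \<in> D t" by (rule subgroup.one_closed[OF D_subgroup[OF tt]])
  then obtain u where "u \<in> D t" "u \<noteq> \<one>" using nontriv False by blast
  then have "card {\<one>, u} \<le> k" unfolding k_def using one Dfin[OF tt] by (intro card_mono) auto
  then have k2: "2 \<le> k" using \<open>u \<noteq> \<one>\<close> by simp
  have pow: "u [^] k = \<one>" if "u \<in> D t" for u
  proof -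
    interpret Dt: group "G\<lparr>carrier := D t\<rparr>" by (rule subgroup_imp_group[OF D_subgroup[OF tt]])
    show ?thesis using Dt.pow_order_eq_1[of u] that
      by (simp add: order_def k_def subgroup_restrict_nat_pow)
  qed
  have "k ^ (2 * t) = (\<Prod>i=1..t. k\<^sup>2)" by (simp add: power_mult)
  also have "\<dots> \<le> (\<Prod>i=1..t. (card {u \<in> D i. u [^] k = \<one>})\<^sup>2)"
  proof (rule prod_mono)
    fix i assume i: "i \<in> {1..t}"
    have "D t \<subseteq> {u \<in> D i. u [^] k = \<one>}" using chain[OF i, of t] i pow by auto
    then have "k \<le> card {u \<in> D i. u [^] k = \<one>}"
      unfolding k_def using Dfin[OF i] by (intro card_mono) auto
    then show "0 \<le> k\<^sup>2 \<and> k\<^sup>2 \<le> (card {u \<in> D i. u [^] k = \<one>})\<^sup>2" by (simp add: power_mono)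
  qed
  also have "\<dots> = card {v \<in> carrier ?V. v [^]\<^bsub>?V\<^esub> k = \<one>\<^bsub>?V\<^esub>}" by (rule card_quotient_torsion[symmetric])
  also have "\<dots> \<le> k ^ min_gens ?V"
  proof -
    obtain S where "S \<subseteq> carrier ?V" "finite S" "card S = min_gens ?V" "generate ?V S = carrier ?V"
      using V.min_gens_obtain[OF finite_quotient] by blast
    then show ?thesis using V.card_torsion_le[OF finite_quotient, of S k] k2 by simp
  qed
  finally have "2 * t \<le> min_gens ?V" using k2 by (simp add: power_increasing_iff)
  then show ?thesis using min_gens_quotient_le by simp
qed

end

section \<open>Central decompositions\<close>

lemma (in group) commuting_iff:
  assumes "H \<subseteq> carrier G" "K \<subseteq> carrier G"
  shows "commuting G H K \<longleftrightarrow> (\<forall>h\<in>H. \<forall>k\<in>K. h \<otimes> k = k \<otimes> h)"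
proof
  assume c: "commuting G H K"
  show "\<forall>h\<in>H. \<forall>k\<in>K. h \<otimes> k = k \<otimes> h"
  proof (intro ballI)
    fix h k assume hk: "h \<in> H" "k \<in> K"
    then have "h \<otimes> k \<otimes> inv h \<otimes> inv k = \<one>"
      using commutator_in_subgroup[OF hk] c unfolding commuting_def by blast
    then show "h \<otimes> k = k \<otimes> h" using commutator_eq_one_iff hk assms by blast
  qed
next
  assume c: "\<forall>h\<in>H. \<forall>k\<in>K. h \<otimes> k = k \<otimes> h"
  have "commutator_subgroup G H K \<subseteq> {\<one>}"
  proof (rule commutator_subgroup_incl[OF triv_subgroup])
    fix h k assume hk: "h \<in> H" "k \<in> K"
    then have "h \<in> carrier G" "k \<in> carrier G" using assms by blast+
    then show "h \<otimes> k \<otimes> inv h \<otimes> inv k \<in> {\<one>}"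
      using commutator_eq_one_iff[of h k] c hk by blast
  qed
  then show "commuting G H K"
    unfolding commuting_def using generate.one unfolding commutator_subgroup_def by fast
qed

lemma (in group) commuting_generate:
  assumes "S \<subseteq> carrier G" "T \<subseteq> carrier G" "\<And>s t. s \<in> S \<Longrightarrow> t \<in> T \<Longrightarrow> s \<otimes> t = t \<otimes> s"
    and g: "g \<in> generate G S" and h: "h \<in> generate G T"
  shows "g \<otimes> h = h \<otimes> g"
proof (rule commute_generate[OF assms(1) _ _ g])
  show "h \<in> carrier G" by (rule generate_in_carrier[OF assms(2) h])
  fix s assume s: "s \<in> S"
  have "h \<otimes> s = s \<otimes> h"
    by (rule commute_generate[OF assms(2) _ _ h]) (use s assms(1) assms(3)[OF s] in \<open>auto intro: sym\<close>)
  then show "s \<otimes> h = h \<otimes> s" ..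
qed

text \<open>Each new factor commutes with the span of all earlier ones, so every partial product of
  subsets is already a subgroup. This links the literal product in
  \<open>central_decomposition\<close> with generated subgroups.\<close>

lemma (in group) central_product_eq_generate:
  assumes A: "subgroup A G" and E: "\<And>i. i \<in> {1..t} \<Longrightarrow> subgroup (E i) G"
    and AE: "\<And>i a e. \<lbrakk>i \<in> {1..t}; a \<in> A; e \<in> E i\<rbrakk> \<Longrightarrow> a \<otimes> e = e \<otimes> a"
    and EE: "\<And>i j u v. \<lbrakk>i \<in> {1..t}; j \<in> {1..t}; i \<noteq> j; u \<in> E i; v \<in> E j\<rbrakk> \<Longrightarrow> u \<otimes> v = v \<otimes> u"
  shows "foldl (\<lambda>P i. P <#> E i) A [1..<Suc t] = generate G (A \<union> (\<Union>i\<in>{1..t}. E i))"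
proof -
  have "foldl (\<lambda>P i. P <#> E i) A [1..<Suc k] = generate G (A \<union> (\<Union>i\<in>{1..k}. E i))" if "k \<le> t" for k
    using that
  proof (induction k)
    case 0
    then show ?case by (simp add: generate_subgroup_self[OF A])
  next
    case (Suc k)
    let ?S = "A \<union> (\<Union>i\<in>{1..k}. E i)"
    have k: "Suc k \<in> {1..t}" using Suc by simp
    note Ek = E[OF k]
    have S: "?S \<subseteq> carrier G"
    proof -
      have "E i \<subseteq> carrier G" if "i \<in> {1..k}" for i
        using that Suc.prems by (intro subgroup.subset[OF E]) auto
      then show ?thesis using subgroup.subset[OF A] by blast
    qed
    have Ec: "E (Suc k) \<subseteq> carrier G" by (rule subgroup.subset[OF Ek])
    have comm: "g \<otimes> h = h \<otimes> g" if "g \<in> generate G ?S" "h \<in> E (Suc k)" for g h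
    proof (rule commute_generate[OF S _ _ that(1)])
      show "h \<in> carrier G" using that(2) Ec by blast
      fix s assume "s \<in> ?S"
      then consider "s \<in> A" | i where "i \<in> {1..k}" "s \<in> E i" by blast
      then show "s \<otimes> h = h \<otimes> s"
      proof cases
        case 1
        then show ?thesis by (rule AE[OF k _ that(2)])
      next
        case (2 i)
        then have "i \<in> {1..t}" "i \<noteq> Suc k" using Suc.prems by auto
        then show ?thesis by (rule EE[OF _ k _ 2(2) that(2)])
      qed
    qed
    have "[1..<Suc (Suc k)] = [1..<Suc k] @ [Suc k]" by simp
    then have "foldl (\<lambda>P i. P <#> E i) A [1..<Suc (Suc k)] = generate G ?S <#> E (Suc k)"
      using Suc by simp
    also have "\<dots> = generate G (generate G ?S \<union> E (Suc k))"
      by (rule generate_commuting_Un[symmetric, OF generate_is_subgroup[OF S] Ek comm])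
    also have "\<dots> = generate G (generate G ?S \<union> generate G (E (Suc k)))"
      by (simp add: generate_subgroup_self[OF Ek])
    also have "\<dots> = generate G (?S \<union> E (Suc k))" by (rule generate_generate_Un[OF S Ec])
    also have "?S \<union> E (Suc k) = A \<union> (\<Union>i\<in>{1..Suc k}. E i)" by (auto simp: atLeastAtMostSuc_conv)
    finally show ?case .
  qed
  then show ?thesis by simp
qed

text \<open>With fewer than two generators the subgroup would be commutative.\<close>

lemma (in group) min_gens_noncommuting_pair:
  assumes fin: "finite (carrier G)" and x: "x \<in> carrier G" and y: "y \<in> carrier G"
    and nc: "x \<otimes> y \<noteq> y \<otimes> x"
  shows "min_gens (G\<lparr>carrier := generate G {x, y}\<rparr>) = 2"
proof -
  let ?E = "generate G {x, y}"
  have E: "subgroup ?E G" using x y by (intro generate_is_subgroup) auto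
  have Ec: "?E \<subseteq> carrier G" by (rule subgroup.subset[OF E])
  have "x \<noteq> y" using nc by blast
  then have le: "min_gens (G\<lparr>carrier := ?E\<rparr>) \<le> 2"
    using min_gens_subgroup_le[OF E, of "{x, y}"] by (simp add: generate.incl)
  obtain xs where xs: "set xs \<subseteq> ?E" "length xs = min_gens (G\<lparr>carrier := ?E\<rparr>)" "generate G (set xs) = ?E"
    using min_gens_subgroup_obtain[OF E] fin Ec finite_subset by metis
  have "\<not> length xs \<le> 1"
  proof
    assume "length xs \<le> 1"
    then have "s = s'" if "s \<in> set xs" "s' \<in> set xs" for s s'
      using that by (cases xs) auto
    moreover have "set xs \<subseteq> carrier G" using xs Ec by blast
    ultimately have "g \<otimes> h = h \<otimes> g" if "g \<in> generate G (set xs)" "h \<in> generate G (set xs)" for g h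
      using commuting_generate[of "set xs" "set xs" g h] that by metis
    then show False using nc unfolding xs(3) by (simp add: generate.incl)
  qed
  then show ?thesis using le xs(2) by simp
qed

context class_two_cyclic
begin

lemma central_decomposition_exists: "\<exists>t A E. central_decomposition G t A E"
proof -
  obtain xs where xs: "set xs \<subseteq> carrier G" "length xs = min_gens G" "generate G (set xs) = carrier G"
    using min_gens_subgroup_obtain[OF subgroup_self fin] by auto
  obtain ps as where ps: "2 * length ps + length as = length xs"
    "fst ` set ps \<union> snd ` set ps \<union> set as \<subseteq> carrier G"
    "generate G (fst ` set ps \<union> snd ` set ps \<union> set as) = carrier G"
    "\<forall>a\<in>set as. \<forall>g\<in>carrier G. commutator a g = \<one>"
    "\<forall>(x, y)\<in>set ps. commutator x y \<noteq> \<one>"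
    "sorted_wrt (\<lambda>p q. orthogonal p q \<and>
      commutator (fst q) (snd q) \<in> generate G {commutator (fst p) (snd p)}) ps"
    using symplectic_generators[OF xs(1)] unfolding xs(3) by blast
  define t where "t = length ps"
  \<comment> \<open>The subgroups of a decomposition are numbered from 1, list entries from
    0.\<close>
  define x where "x i = fst (ps ! (i - 1))" for i
  define y where "y i = snd (ps ! (i - 1))" for i
  define E where "E i = generate G {x i, y i}" for i
  define A where "A = generate G (set as)"
  have mem: "(x i, y i) \<in> set ps" if "i \<in> {1..t}" for i
    using that by (auto simp: x_def y_def t_def)
  have set_ps: "set ps = (\<lambda>i. (x i, y i)) ` {1..t}"
  proof
    show "set ps \<subseteq> (\<lambda>i. (x i, y i)) ` {1..t}"
    proof
      fix p assume "p \<in> set ps"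
      then obtain i where "i < length ps" "p = ps ! i" by (auto simp: in_set_conv_nth)
      then show "p \<in> (\<lambda>i. (x i, y i)) ` {1..t}"
        by (intro image_eqI[of _ _ "Suc i"]) (auto simp: x_def y_def t_def)
    qed
  qed (use mem in auto)
  have gens: "fst ` set ps \<union> snd ` set ps \<union> set as = set as \<union> (\<Union>i\<in>{1..t}. {x i, y i})"
    unfolding set_ps by (auto simp: image_image)
  have xc: "x i \<in> carrier G" and yc: "y i \<in> carrier G" if "i \<in> {1..t}" for i
    using ps(2) that unfolding gens by blast+
  have z1: "commutator (x i) (y i) \<noteq> \<one>" if "i \<in> {1..t}" for i
    using ps(5) mem[OF that] by blast
  have asc: "set as \<subseteq> centre G"
  proof
    fix a assume a: "a \<in> set as"
    then have ac: "a \<in> carrier G" using ps(2) by blast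
    show "a \<in> centre G" using ps(4) a commutator_one_iff[OF ac] by (intro centreI[OF ac]) blast
  qed
  have less: "orthogonal (x i, y i) (x j, y j) \<and>
      commutator (x j) (y j) \<in> generate G {commutator (x i) (y i)}"
    if "i \<in> {1..t}" "j \<in> {1..t}" "i < j" for i j
    using sorted_wrt_nth_less[OF ps(6), of "i - 1" "j - 1"] that by (simp add: x_def y_def t_def)
  have orth: "commutator u v = \<one>"
    if ij: "i \<in> {1..t}" "j \<in> {1..t}" "i \<noteq> j" and u: "u \<in> {x i, y i}" and v: "v \<in> {x j, y j}" for i j u v
  proof -
    have uc: "u \<in> carrier G" and vc: "v \<in> carrier G"
      using u v xc[OF ij(1)] yc[OF ij(1)] xc[OF ij(2)] yc[OF ij(2)] by auto
    show ?thesis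
    proof (cases "i < j")
      case True
      then show ?thesis using less[OF ij(1,2)] u v unfolding orthogonal_def by auto
    next
      case False
      then have "commutator v u = \<one>"
        using less[OF ij(2,1)] ij(3) u v unfolding orthogonal_def by auto
      then show ?thesis using commutator_inv_swap[OF vc uc] by simp
    qed
  qed
  interpret S: symplectic_system G t "set as" x y
    using fin xc yc asc ps(3) orth unfolding gens by unfold_locales blast+
  have E: "subgroup (E i) G" if "i \<in> {1..t}" for i
    unfolding E_def using xc[OF that] yc[OF that] by (intro generate_is_subgroup) auto
  have asC: "set as \<subseteq> carrier G" using asc centreD(1) by blast
  have A: "subgroup A G" unfolding A_def by (rule generate_is_subgroup[OF asC])
  have Acentre: "A \<subseteq> centre G" unfolding A_def by (rule generate_subgroup_incl[OF asc centre_subgroup])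
  have AE: "a \<otimes> e = e \<otimes> a" if "i \<in> {1..t}" "a \<in> A" "e \<in> E i" for i a e
    using centreD(2) Acentre that(2) subgroup.mem_carrier[OF E[OF that(1)] that(3)] by blast
  have EE: "u \<otimes> v = v \<otimes> u" if ij: "i \<in> {1..t}" "j \<in> {1..t}" "i \<noteq> j" and u: "u \<in> E i" and v: "v \<in> E j" for i j u v
  proof (rule commuting_generate[of "{x i, y i}" "{x j, y j}"])
    show ij_c: "{x i, y i} \<subseteq> carrier G" "{x j, y j} \<subseteq> carrier G"
      using xc[OF ij(1)] yc[OF ij(1)] xc[OF ij(2)] yc[OF ij(2)] by auto
    fix a b assume ab: "a \<in> {x i, y i}" "b \<in> {x j, y j}"
    then have "a \<in> carrier G" "b \<in> carrier G" using ij_c by blast+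
    then show "a \<otimes> b = b \<otimes> a" using orth[OF ij ab] commutator_one_iff by blast
  qed (use u v in \<open>simp_all add: E_def\<close>)
  have dE: "derived G (E i) = S.D i" if "i \<in> {1..t}" for i
    unfolding E_def S.D_def by (rule derived_generate_pair[OF xc[OF that] yc[OF that]])
  have chain: "S.D j \<subseteq> S.D i" if "i \<in> {1..t}" "j \<in> {1..t}" "i < j" for i j
    using less[OF that] generate_subgroup_incl[OF _ S.D_subgroup[OF that(1)]]
    unfolding S.D_def by blast
  have foldl: "carrier G = foldl (\<lambda>P i. P <#> E i) A [1..<Suc t]"
  proof -
    have Un_c: "A \<union> (\<Union>i\<in>{1..t}. E i) \<subseteq> carrier G"
      using subgroup.subset[OF A] subgroup.subset[OF E] by blast
    have "set as \<union> (\<Union>i\<in>{1..t}. {x i, y i}) \<subseteq> A \<union> (\<Union>i\<in>{1..t}. E i)"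
      unfolding A_def E_def by (auto intro: generate.incl)
    then have "carrier G \<subseteq> generate G (A \<union> (\<Union>i\<in>{1..t}. E i))"
      unfolding S.generating[symmetric] by (rule mono_generate)
    then have "carrier G = generate G (A \<union> (\<Union>i\<in>{1..t}. E i))"
      using generate_incl[OF Un_c] by blast
    also have "\<dots> = foldl (\<lambda>P i. P <#> E i) A [1..<Suc t]"
      by (rule central_product_eq_generate[symmetric, OF A E AE EE])
    finally show ?thesis .
  qed
  have nc: "x i \<otimes> y i \<noteq> y i \<otimes> x i" if "i \<in> {1..t}" for i
    using z1[OF that] commutator_one_iff[OF xc[OF that] yc[OF that]] by blast
  have cls: "nilpotent (G\<lparr>carrier := E i\<rparr>) \<and> nilpotency_class (G\<lparr>carrier := E i\<rparr>) = 2"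
    if "i \<in> {1..t}" for i
    by (rule class_two_group.nilpotency_class_two[OF class_two_subgroup[OF E[OF that]], of "x i" "y i"])
      (use nc[OF that] in \<open>auto simp: E_def intro: generate.incl\<close>)
  \<comment> \<open>One inequality uses that \<open>as\<close> generates \<open>A\<close> and that
    \<open>2 * t + length as\<close> is the minimal number for \<open>G\<close>; the other exchanges
    \<open>as\<close> for a minimal generating list of \<open>A\<close>.\<close>
  have rank: "min_gens G = min_gens (G\<lparr>carrier := A\<rparr>) + 2 * t"
  proof (rule antisym)
    have "min_gens (G\<lparr>carrier := A\<rparr>) \<le> card (set as)"
      by (rule min_gens_subgroup_le[OF A]) (auto simp: A_def intro: generate.incl)
    also have "\<dots> \<le> length as" by (rule card_length)
    finally show "min_gens (G\<lparr>carrier := A\<rparr>) + 2 * t \<le> min_gens G"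
      using ps(1) xs(2) by (simp add: t_def)
    have "finite A" using fin subgroup.subset[OF A] finite_subset by blast
    then obtain bs where bs: "set bs \<subseteq> A" "length bs = min_gens (G\<lparr>carrier := A\<rparr>)" "generate G (set bs) = A"
      using min_gens_subgroup_obtain[OF A] by metis
    let ?T = "set (bs @ map fst ps @ map snd ps)"
    have T: "?T = set bs \<union> (\<Union>i\<in>{1..t}. {x i, y i})" unfolding set_append set_map set_ps by (auto simp: image_image)
    have bsC: "set bs \<subseteq> carrier G" using bs(1) subgroup.subset[OF A] by blast
    have "generate G ?T = generate G (set as \<union> (\<Union>i\<in>{1..t}. {x i, y i}))"
      unfolding T using bs(3) bsC asC xc yc by (intro generate_Un_cong) (auto simp: A_def)
    then have "generate G ?T = carrier G" unfolding S.generating .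
    moreover have "?T \<subseteq> carrier G" unfolding T using bsC xc yc by blast
    ultimately have "min_gens G \<le> card ?T" by (intro min_gens_le) auto
    also have "\<dots> \<le> length (bs @ map fst ps @ map snd ps)" by (rule card_length)
    finally show "min_gens G \<le> min_gens (G\<lparr>carrier := A\<rparr>) + 2 * t" using bs(2) by (simp add: t_def)
  qed
  \<comment> \<open>A general \<open>K\<close> serves both readings of the chain: the trivial
    subgroup for \<open>t = 0\<close> and \<open>S.D 1\<close> otherwise.\<close>
  have derived: "derived G (carrier G) \<subseteq> K"
    if K: "subgroup K G" and DK: "\<And>i. i \<in> {1..t} \<Longrightarrow> S.D i \<subseteq> K" for K
  proof (rule derived_subset[OF K])
    fix g h assume g: "g \<in> carrier G" and h: "h \<in> carrier G"
    show "commutator g h \<in> K"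
    proof (rule commutator_right_generate[OF g S.gens_closed K])
      show "h \<in> generate G (set as \<union> (\<Union>i\<in>{1..t}. {x i, y i}))" using h unfolding S.generating .
      fix s assume "s \<in> set as \<union> (\<Union>i\<in>{1..t}. {x i, y i})"
      then consider "s \<in> centre G" | i where "i \<in> {1..t}" "s \<in> {x i, y i}" using asc by blast
      then show "commutator g s \<in> K"
      proof cases
        case 1
        then show ?thesis using commutator_centre(2)[OF 1 g] subgroup.one_closed[OF K] by simp
      next
        case (2 i)
        then show ?thesis using S.commutator_in_D[OF 2(1) g] DK[OF 2(1)] by blast
      qed
    qed
  qed
  have "central_decomposition G t A E"
    unfolding central_decomposition_def
  proof (intro conjI ballI impI)
    show "subgroup A G" "A \<subseteq> centre G" by fact+
    show "carrier G = foldl (\<lambda>P i. P <#>\<^bsub>G\<^esub> E i) A [1..<Suc t]" by (rule foldl)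
    show "min_gens G = min_gens (G\<lparr>carrier := A\<rparr>) + 2 * t" by (rule rank)
    show "subgroup (E i) G" "min_gens (G\<lparr>carrier := E i\<rparr>) = 2" "nilpotent (G\<lparr>carrier := E i\<rparr>)"
      "nilpotency_class (G\<lparr>carrier := E i\<rparr>) = 2" if "i \<in> {1..t}" for i
      using E[OF that] cls[OF that] min_gens_noncommuting_pair[OF fin xc[OF that] yc[OF that] nc[OF that]]
      by (auto simp: E_def)
    show "commuting G A (E i)" if i: "i \<in> {1..t}" for i
      unfolding commuting_iff[OF subgroup.subset[OF A] subgroup.subset[OF E[OF i]]]
      using AE[OF i] by blast
    show "commuting G (E i) (E j)" if ij: "i \<in> {1..t}" "j \<in> {1..t}" "i \<noteq> j" for i j
      unfolding commuting_iff[OF subgroup.subset[OF E[OF ij(1)]] subgroup.subset[OF E[OF ij(2)]]]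
      using EE[OF ij] by blast
    show "if t = 0 then derived G (carrier G) = {\<one>}
      else derived G (carrier G) = derived G (E 1) \<and>
        (\<forall>i\<in>{1..<t}. derived G (E (i + 1)) \<subseteq> derived G (E i)) \<and> derived G (E t) \<noteq> {\<one>}"
    proof (cases "t = 0")
      case True
      then have "derived G (carrier G) \<subseteq> {\<one>}" by (intro derived triv_subgroup) simp
      then show ?thesis
        using True subgroup.one_closed[OF derived_is_subgroup[OF order_refl]] by auto
    next
      case False
      then have 1: "1 \<in> {1..t}" and tt: "t \<in> {1..t}" by auto
      have "S.D i \<subseteq> S.D 1" if "i \<in> {1..t}" for i
        using chain[OF 1 that] that by (cases "i = 1") auto
      then have "derived G (carrier G) \<subseteq> S.D 1" by (rule derived[OF S.D_subgroup[OF 1]])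
      moreover have "derived G (E 1) \<subseteq> derived G (carrier G)"
        by (rule mono_derived[OF subgroup.subset[OF E[OF 1]]])
      ultimately have "derived G (carrier G) = derived G (E 1)" using dE[OF 1] by simp
      moreover have "derived G (E (i + 1)) \<subseteq> derived G (E i)" if "i \<in> {1..<t}" for i
        using chain[of i "i + 1"] dE[of i] dE[of "i + 1"] that by simp
      moreover have "commutator (x t) (y t) \<in> derived G (E t)"
        unfolding dE[OF tt] S.D_def by (rule generate.incl) simp
      then have "derived G (E t) \<noteq> {\<one>}" using z1[OF tt] by blast
      ultimately show ?thesis using False by simp
    qed
  qed
  then show ?thesis by blast
qed

end

section \<open>Invariants and uniqueness of a decomposition\<close>

lemma product_group_cong:
  "(\<And>i. i \<in> I \<Longrightarrow> H i = K i) \<Longrightarrow> product_group I H = product_group I K"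
  by (simp add: product_group_def cong: PiE_cong restrict_cong)

context class_two_group
begin

text \<open>\<open>d(E i) = 2\<close> supplies the pairs \<open>x i\<close>, \<open>y i\<close>, and
  commuting of distinct \<open>E i\<close> makes the pairs orthogonal.\<close>

lemma symplectic_system_of_decomposition:
  assumes fin: "finite (carrier G)" and cd: "central_decomposition G t A E"
  shows "\<exists>x y. symplectic_system G t A x y \<and>
    (\<forall>i\<in>{1..t}. derived G (E i) = generate G {commutator (x i) (y i)})"
proof -
  have A: "subgroup A G" and E: "\<And>i. i \<in> {1..t} \<Longrightarrow> subgroup (E i) G"
    and Acentre: "A \<subseteq> centre G"
    and comm: "\<And>i j. \<lbrakk>i \<in> {1..t}; j \<in> {1..t}; i \<noteq> j\<rbrakk> \<Longrightarrow> commuting G (E i) (E j)"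
    and foldl: "carrier G = foldl (\<lambda>P i. P <#> E i) A [1..<Suc t]"
    and two: "\<And>i. i \<in> {1..t} \<Longrightarrow> min_gens (G\<lparr>carrier := E i\<rparr>) = 2"
    using cd unfolding central_decomposition_def by blast+
  have Ec: "\<And>i. i \<in> {1..t} \<Longrightarrow> E i \<subseteq> carrier G" using subgroup.subset[OF E] .
  have "\<exists>x y. generate G {x, y} = E i" if i: "i \<in> {1..t}" for i
  proof -
    have "finite (E i)" using fin Ec[OF i] finite_subset by blast
    then obtain xs where "length xs = 2" "generate G (set xs) = E i"
      using min_gens_subgroup_obtain[OF E[OF i]] two[OF i] by metis
    moreover from this obtain x y where "xs = [x, y]"
      by (metis (no_types, lifting) One_nat_def Suc_length_conv length_0_conv numeral_2_eq_2)
    ultimately show ?thesis by auto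
  qed
  then obtain x y where xy: "\<And>i. i \<in> {1..t} \<Longrightarrow> generate G {x i, y i} = E i" by metis
  have mem: "x i \<in> E i" "y i \<in> E i" if "i \<in> {1..t}" for i
    unfolding xy[OF that, symmetric] by (auto intro: generate.incl)
  have EE: "u \<otimes> v = v \<otimes> u" if ij: "i \<in> {1..t}" "j \<in> {1..t}" "i \<noteq> j" and uv: "u \<in> E i" "v \<in> E j" for i j u v
    using comm[OF ij] uv unfolding commuting_iff[OF Ec[OF ij(1)] Ec[OF ij(2)]] by blast
  have AE: "a \<otimes> e = e \<otimes> a" if "i \<in> {1..t}" "a \<in> A" "e \<in> E i" for i a e
    using centreD(2) Acentre that Ec[OF that(1)] by blast
  let ?gens = "A \<union> (\<Union>i\<in>{1..t}. {x i, y i})"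
  have gc: "?gens \<subseteq> carrier G" using mem Ec subgroup.subset[OF A] by blast
  have "E i \<subseteq> generate G ?gens" if "i \<in> {1..t}" for i
    unfolding xy[OF that, symmetric] using that by (intro mono_generate) blast
  moreover have "A \<subseteq> generate G ?gens" by (auto intro: generate.incl)
  ultimately have "A \<union> (\<Union>i\<in>{1..t}. E i) \<subseteq> generate G ?gens" by blast
  then have "generate G (A \<union> (\<Union>i\<in>{1..t}. E i)) \<subseteq> generate G ?gens"
    by (rule generate_subgroup_incl[OF _ generate_is_subgroup[OF gc]])
  moreover have "generate G (A \<union> (\<Union>i\<in>{1..t}. E i)) = carrier G"
    unfolding foldl by (rule central_product_eq_generate[symmetric, OF A E AE EE])
  ultimately have gen: "generate G ?gens = carrier G" using generate_incl[OF gc] by blast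
  have "symplectic_system G t A x y"
  proof unfold_locales
    show "finite (carrier G)" "A \<subseteq> centre G" "generate G ?gens = carrier G" by fact+
    show "x i \<in> carrier G" "y i \<in> carrier G" if "i \<in> {1..t}" for i
      using mem[OF that] Ec[OF that] by blast+
    fix i j u v
    assume ij: "i \<in> {1..t}" "j \<in> {1..t}" "i \<noteq> j" and uv: "u \<in> {x i, y i}" "v \<in> {x j, y j}"
    have "u \<in> E i" "v \<in> E j" using uv mem[OF ij(1)] mem[OF ij(2)] by blast+
    then show "commutator u v = \<one>"
      using EE[OF ij] Ec[OF ij(1)] Ec[OF ij(2)] commutator_one_iff by blast
  qed
  moreover have "derived G (E i) = generate G {commutator (x i) (y i)}" if i: "i \<in> {1..t}" for i
    unfolding xy[OF i, symmetric]
    by (rule derived_generate_pair) (use mem[OF i] Ec[OF i] in auto)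
  ultimately show ?thesis by blast
qed

lemma derived_chain:
  assumes cd: "central_decomposition G t A E" and i: "i \<in> {1..t}" and j: "j \<in> {i..t}"
  shows "derived G (E j) \<subseteq> derived G (E i)"
proof -
  have step: "derived G (E (Suc k)) \<subseteq> derived G (E k)" if "k \<in> {1..<t}" for k
    using cd that unfolding central_decomposition_def by (cases "t = 0") auto
  have "i \<le> j" "j \<le> t" using j by auto
  then show ?thesis
  proof (induction j rule: dec_induct)
    case (step n)
    then show ?case using \<open>\<And>k. k \<in> {1..<t} \<Longrightarrow> derived G (E (Suc k)) \<subseteq> derived G (E k)\<close>[of n] i by auto
  qed simp
qed

text \<open>The third claim is the form of the isomorphism used for uniqueness: its left-hand side
  does not mention the decomposition.\<close>

lemma decomposition_invariants:
  assumes fin: "finite (carrier G)" and cd: "central_decomposition G t A E"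
  shows "G Mod centre G \<cong> product_group {1..t}
      (\<lambda>i. G\<lparr>carrier := derived G (E i)\<rparr> \<times>\<times> G\<lparr>carrier := derived G (E i)\<rparr>)"
    and "min_gens (G Mod centre G) = 2 * t"
    and "card {v \<in> carrier (G Mod centre G). v [^]\<^bsub>G Mod centre G\<^esub> (k::nat) = \<one>\<^bsub>G Mod centre G\<^esub>} =
      (\<Prod>i=1..t. (card {u \<in> derived G (E i). u [^] k = \<one>})\<^sup>2)"
proof -
  obtain x y where S: "symplectic_system G t A x y"
    and d: "\<And>i. i \<in> {1..t} \<Longrightarrow> derived G (E i) = generate G {commutator (x i) (y i)}"
    using symplectic_system_of_decomposition[OF assms] by blast
  interpret S: symplectic_system G t A x y by (rule S)
  have D: "S.D i = derived G (E i)" if "i \<in> {1..t}" for i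
    unfolding S.D_def by (rule d[OF that, symmetric])
  have "S.P = product_group {1..t}
      (\<lambda>i. G\<lparr>carrier := derived G (E i)\<rparr> \<times>\<times> G\<lparr>carrier := derived G (E i)\<rparr>)"
    by (rule product_group_cong) (simp only: D)
  then show "G Mod centre G \<cong> product_group {1..t}
      (\<lambda>i. G\<lparr>carrier := derived G (E i)\<rparr> \<times>\<times> G\<lparr>carrier := derived G (E i)\<rparr>)"
    using S.quotient_iso by simp
  show "min_gens (G Mod centre G) = 2 * t"
  proof (rule S.min_gens_quotient)
    show "S.D j \<subseteq> S.D i" if "i \<in> {1..t}" "j \<in> {i..t}" for i j
      using derived_chain[OF cd that] D[OF that(1)] D[of j] that by simp
    show "S.D t \<noteq> {\<one>}" if "t > 0"
      using cd that D[of t] unfolding central_decomposition_def by simp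
  qed
  show "card {v \<in> carrier (G Mod centre G). v [^]\<^bsub>G Mod centre G\<^esub> k = \<one>\<^bsub>G Mod centre G\<^esub>} =
      (\<Prod>i=1..t. (card {u \<in> derived G (E i). u [^] k = \<one>})\<^sup>2)"
    unfolding S.card_quotient_torsion by (rule prod.cong) (simp_all add: D)
qed

end

text \<open>Counting elements annihilated by the order of \<open>D i\<close>: a factor of the first product is the
  square of that order up to index \<open>i\<close>, which is the largest possible value, and the factors
  with larger index agree.\<close>
lemma (in group) subset_of_equal_torsion_counts:
  fixes i t :: nat
  assumes fin: "finite (carrier G)" and c: "c \<in> carrier G"
    and D: "\<And>i. i \<in> {1..t} \<Longrightarrow> subgroup (D i) G" "\<And>i. i \<in> {1..t} \<Longrightarrow> D i \<subseteq> generate G {c}"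
    and F: "\<And>i. i \<in> {1..t} \<Longrightarrow> F i \<subseteq> generate G {c}"
    and chain: "\<And>i j. i \<in> {1..t} \<Longrightarrow> j \<in> {i..t} \<Longrightarrow> D j \<subseteq> D i"
    and count: "\<And>k::nat. (\<Prod>i=1..t. (card {u \<in> D i. u [^] k = \<one>})\<^sup>2) =
      (\<Prod>i=1..t. (card {u \<in> F i. u [^] k = \<one>})\<^sup>2)"
    and i: "i \<in> {1..t}" and above: "\<And>j. j \<in> {1..t} \<Longrightarrow> i < j \<Longrightarrow> D j = F j"
  shows "D i \<subseteq> F i"
proof (rule ccontr)
  assume contra: "\<not> D i \<subseteq> F i"
  let ?C = "generate G {c}"
  have finC: "finite ?C" using fin generate_incl[of "{c}"] c finite_subset by auto
  define k where "k = card (D i)"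
  have finD: "finite (D j)" if "j \<in> {1..t}" for j using D(2)[OF that] finC finite_subset by blast
  have one: "\<one> \<in> D j" if "j \<in> {1..t}" for j by (rule subgroup.one_closed[OF D(1)[OF that]])
  have k: "k > 0" unfolding k_def using one[OF i] finD[OF i] by (auto simp: card_gt_0_iff)
  \<comment> \<open>Inside the cyclic group generated by \<open>c\<close>, \<open>D i\<close> is
    exactly the set of elements annihilated by its order \<open>k\<close>. The torsion sets of
    \<open>D j\<close> and \<open>F j\<close> thus become intersections with
    \<open>D i\<close>.\<close>
  define T where "T = {u \<in> ?C. u [^] k = \<one>}"
  have finT: "finite T" using finC by (simp add: T_def)
  interpret Di: group "G\<lparr>carrier := D i\<rparr>" by (rule subgroup_imp_group[OF D(1)[OF i]])
  have "D i \<subseteq> T"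
    using Di.pow_order_eq_1 D(2)[OF i]
    by (auto simp: T_def k_def order_def subgroup_restrict_nat_pow)
  moreover have "card T \<le> card (D i)"
    unfolding T_def k_def[symmetric] by (rule card_torsion_cyclic[OF fin c k])
  ultimately have T: "T = D i" using card_seteq[OF finT] by blast
  let ?f = "\<lambda>j. (card {u \<in> D j. u [^] k = \<one>})\<^sup>2" and ?g = "\<lambda>j. (card {u \<in> F j. u [^] k = \<one>})\<^sup>2"
  have FT: "{u \<in> F j. u [^] k = \<one>} = F j \<inter> D i" if "j \<in> {1..t}" for j
    using F[OF that] unfolding T[symmetric] T_def by blast
  have DT: "{u \<in> D j. u [^] k = \<one>} = D j \<inter> D i" if "j \<in> {1..t}" for j
    using D(2)[OF that] unfolding T[symmetric] T_def by blast
  have le: "?g j \<le> ?f j" if j: "j \<in> {1..t}" for j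
  proof (cases "i < j")
    case True
    then show ?thesis using above[OF j True] by simp
  next
    case False
    then have "D i \<subseteq> D j" using chain[OF j, of i] i by (simp add: not_less)
    then have "card (F j \<inter> D i) \<le> card (D j \<inter> D i)"
      using finD[OF i] by (intro card_mono) auto
    then show ?thesis unfolding FT[OF j] DT[OF j] by (simp add: power_mono)
  qed
  have pos: "?f j > 0" if j: "j \<in> {1..t}" for j
    using one[OF j] one[OF i] finD[OF j] unfolding DT[OF j] by (auto simp: card_gt_0_iff)
  have "F i \<inter> D i \<subset> D i" using contra by blast
  then have "card (F i \<inter> D i) < card (D i)" by (rule psubset_card_mono[OF finD[OF i]])
  then have lt: "?g i < ?f i" unfolding FT[OF i] DT[OF i] by (simp add: power_strict_mono)
  have "(\<Prod>j=1..t. ?g j) = ?g i * (\<Prod>j\<in>{1..t} - {i}. ?g j)" using i by (simp add: prod.remove)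
  also have "\<dots> \<le> ?g i * (\<Prod>j\<in>{1..t} - {i}. ?f j)" using le by (intro mult_le_mono2 prod_mono) auto
  also have "\<dots> < ?f i * (\<Prod>j\<in>{1..t} - {i}. ?f j)"
    using lt pos by (intro mult_strict_right_mono prod_pos) auto
  also have "\<dots> = (\<Prod>j=1..t. ?f j)" using i by (simp add: prod.remove)
  finally show False using count[of k] by simp
qed

text \<open>Downward induction on the index, starting at \<open>t\<close>: once the groups of larger
  index agree, equal torsion counts force both inclusions at the current one.\<close>

lemma (in class_two_group) decomposition_unique:
  assumes fin: "finite (carrier G)" and c: "c \<in> carrier G" "derived G (carrier G) = generate G {c}"
    and E: "central_decomposition G t A E" and F: "central_decomposition G s B F"
  shows "s = t \<and> (\<forall>i\<in>{1..t}. derived G (F i) = derived G (E i))"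
proof -
  have st: "s = t"
    using decomposition_invariants(2)[OF fin E] decomposition_invariants(2)[OF fin F] by simp
  note F = F[unfolded st]
  have count: "(\<Prod>i=1..t. (card {u \<in> derived G (E i). u [^] k = \<one>})\<^sup>2) =
      (\<Prod>i=1..t. (card {u \<in> derived G (F i). u [^] k = \<one>})\<^sup>2)" for k :: nat
    using decomposition_invariants(3)[OF fin E, of k] decomposition_invariants(3)[OF fin F, of k] by simp
  have carr: "H i \<subseteq> carrier G" if "central_decomposition G t C H" "i \<in> {1..t}" for C H i
    using that subgroup.subset unfolding central_decomposition_def by blast
  have sub: "subgroup (derived G (H i)) G" and incl: "derived G (H i) \<subseteq> generate G {c}"
    if "central_decomposition G t C H" "i \<in> {1..t}" for C H i
    using derived_is_subgroup[OF carr[OF that]] mono_derived[OF carr[OF that]] c(2) by simp_all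
  have "derived G (F i) = derived G (E i)" if "i \<in> {1..t}" for i
    using that
  proof (induction "t - i" arbitrary: i rule: less_induct)
    case less
    have above: "derived G (F j) = derived G (E j)" if "j \<in> {1..t}" "i < j" for j
      using less.hyps[of j] that by auto
    have "derived G (E i) \<subseteq> derived G (F i)"
      by (rule subset_of_equal_torsion_counts[OF fin c(1), of t "\<lambda>i. derived G (E i)" "\<lambda>i. derived G (F i)"])
        (use sub[OF E] incl[OF E] incl[OF F] derived_chain[OF E] count less.prems above in auto)
    moreover have "derived G (F i) \<subseteq> derived G (E i)"
      by (rule subset_of_equal_torsion_counts[OF fin c(1), of t "\<lambda>i. derived G (F i)" "\<lambda>i. derived G (E i)"])
        (use sub[OF F] incl[OF F] incl[OF E] derived_chain[OF F] count less.prems above in auto)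
    ultimately show ?case by blast
  qed
  then show ?thesis using st by blast
qed

lemma (in group) cyclic_subgroup_generator:
  assumes "subgroup K G" "cyclic_group (G\<lparr>carrier := K\<rparr>)"
  shows "\<exists>c\<in>carrier G. K = generate G {c}"
proof -
  interpret K: group "G\<lparr>carrier := K\<rparr>" by (rule subgroup_imp_group[OF assms(1)])
  obtain c where c: "c \<in> K" "K = range (\<lambda>n::int. c [^]\<^bsub>G\<lparr>carrier := K\<rparr>\<^esub> n)"
    using assms(2) unfolding K.cyclic_group by auto
  have cc: "c \<in> carrier G" using subgroup.mem_carrier[OF assms(1) c(1)] .
  have "K = range (\<lambda>n::int. c [^] n)"
    using c(2) unfolding int_pow_consistent[OF assms(1) c(1), symmetric] .
  then have "K = generate G {c}" unfolding generate_pow[OF cc] by blast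
  then show ?thesis using cc by blast
qed

text \<open>The factors that are constructed are quotients of \<open>G\<close>, hence the type
  \<open>'a set monoid\<close>; the lower bound admits factors over an arbitrary type
  \<open>'c\<close>. Independence of the choice is the comparison of two arbitrary
  decompositions.\<close>

theorem theorem1:
  fixes G :: "('a, 'b) monoid_scheme"
  assumes "group G" and "finite (carrier G)"
  shows
    "(nilpotent G \<longrightarrow>
        (\<exists>(H :: nat \<Rightarrow> 'a set monoid) S.
           subdirect_product {..<min_gens (G\<lparr>carrier := centre G\<rparr>)} H S \<and>
           (\<forall>i<min_gens (G\<lparr>carrier := centre G\<rparr>). cyclic_group ((H i)\<lparr>carrier := centre (H i)\<rparr>)) \<and>
           G \<cong> (product_group {..<min_gens (G\<lparr>carrier := centre G\<rparr>)} H)\<lparr>carrier := S\<rparr>) \<and>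
        (\<forall>n<min_gens (G\<lparr>carrier := centre G\<rparr>).
           \<not> (\<exists>(H :: nat \<Rightarrow> 'c monoid) S.
                subdirect_product {..<n} H S \<and>
                (\<forall>i<n. cyclic_group ((H i)\<lparr>carrier := centre (H i)\<rparr>)) \<and>
                G \<cong> (product_group {..<n} H)\<lparr>carrier := S\<rparr>))) \<and>
     (nilpotent G \<and> nilpotency_class G \<le> 2 \<and>
      cyclic_group (G\<lparr>carrier := derived G (carrier G)\<rparr>) \<longrightarrow>
        (\<exists>t A E. central_decomposition G t A E) \<and>
        (\<forall>t A E. central_decomposition G t A E \<longrightarrow>
           real t = 1 / 2 * real (min_gens (G Mod centre G)) \<and>
           G Mod centre G \<cong>
             product_group {1..t}
               (\<lambda>i. G\<lparr>carrier := derived G (E i)\<rparr> \<times>\<times> G\<lparr>carrier := derived G (E i)\<rparr>) \<and>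
           (\<forall>s B F. central_decomposition G s B F \<longrightarrow>
              s = t \<and> (\<forall>i\<in>{1..t}. derived G (F i) = derived G (E i)))))"
proof -
  interpret group G by (rule assms(1))
  note fin = assms(2)
  have lower: "\<not> (\<exists>(H :: nat \<Rightarrow> 'c monoid) S.
      subdirect_product {..<n} H S \<and>
      (\<forall>i<n. cyclic_group ((H i)\<lparr>carrier := centre (H i)\<rparr>)) \<and>
      G \<cong> (product_group {..<n} H)\<lparr>carrier := S\<rparr>)"
    if "n < min_gens (G\<lparr>carrier := centre G\<rparr>)" for n
  proof (intro notI, elim exE conjE)
    fix H :: "nat \<Rightarrow> 'c monoid" and S
    assume "subdirect_product {..<n} H S" "\<forall>i<n. cyclic_group ((H i)\<lparr>carrier := centre (H i)\<rparr>)"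
      "G \<cong> (product_group {..<n} H)\<lparr>carrier := S\<rparr>"
    then have "min_gens (G\<lparr>carrier := centre G\<rparr>) \<le> n"
      by (intro subdirect_cyclic_centres_bound) auto
    then show False using that by simp
  qed
  have two: "(\<exists>t A E. central_decomposition G t A E) \<and>
      (\<forall>t A E. central_decomposition G t A E \<longrightarrow>
         real t = 1 / 2 * real (min_gens (G Mod centre G)) \<and>
         G Mod centre G \<cong>
           product_group {1..t}
             (\<lambda>i. G\<lparr>carrier := derived G (E i)\<rparr> \<times>\<times> G\<lparr>carrier := derived G (E i)\<rparr>) \<and>
         (\<forall>s B F. central_decomposition G s B F \<longrightarrow>
            s = t \<and> (\<forall>i\<in>{1..t}. derived G (F i) = derived G (E i))))"
    if nil: "nilpotent G" and cl: "nilpotency_class G \<le> 2"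
      and cyc: "cyclic_group (G\<lparr>carrier := derived G (carrier G)\<rparr>)"
  proof -
    interpret class_two_group G by (rule class_two_groupI[OF nil cl])
    obtain c where c: "c \<in> carrier G" "derived G (carrier G) = generate G {c}"
      using cyclic_subgroup_generator[OF derived_is_subgroup[OF order_refl] cyc] by blast
    interpret class_two_cyclic G c
    proof unfold_locales
      fix x y assume "x \<in> carrier G" "y \<in> carrier G"
      then show "commutator x y \<in> generate G {c}"
        unfolding c(2)[symmetric] by (rule commutator_in_derived)
    qed (rule fin, rule c(1))
    show ?thesis
    proof (intro conjI allI impI)
      show "\<exists>t A E. central_decomposition G t A E" by (rule central_decomposition_exists)
      fix t A E assume cd: "central_decomposition G t A E"
      show "real t = 1 / 2 * real (min_gens (G Mod centre G))"
        using decomposition_invariants(2)[OF fin cd] by simp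
      show "G Mod centre G \<cong> product_group {1..t}
          (\<lambda>i. G\<lparr>carrier := derived G (E i)\<rparr> \<times>\<times> G\<lparr>carrier := derived G (E i)\<rparr>)"
        by (rule decomposition_invariants(1)[OF fin cd])
      fix s B F assume "central_decomposition G s B F"
      from decomposition_unique[OF fin c cd this]
      show "s = t" "\<forall>i\<in>{1..t}. derived G (F i) = derived G (E i)" by blast+
    qed
  qed
  show ?thesis
  proof (intro conjI impI; (elim conjE)?)
    assume "nilpotent G"
    then show "\<exists>(H :: nat \<Rightarrow> 'a set monoid) S.
           subdirect_product {..<min_gens (G\<lparr>carrier := centre G\<rparr>)} H S \<and>
           (\<forall>i<min_gens (G\<lparr>carrier := centre G\<rparr>). cyclic_group ((H i)\<lparr>carrier := centre (H i)\<rparr>)) \<and>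
           G \<cong> (product_group {..<min_gens (G\<lparr>carrier := centre G\<rparr>)} H)\<lparr>carrier := S\<rparr>"
      by (rule subdirect_cyclic_centres[OF fin])
  qed (use lower two in blast)+
qed

end
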